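(* Consider the algorithm REM described in the context, run with positive deterministic step sizes $(a_i)_{i\ge 1}$, $A_k=\sum_{i=1}^k a_i$, $a_0=A_0=0$, and sampling distributions $p,q\in\Delta_m$. Let $x_k$ be its iterates, let $\bar{x}_k=\frac{1}{A_k}\sum_{i=1}^k a_i x_i$ for $k\ge 1$, and let $j_*\in\arg\min_{1\le j\le m} q_j$. Suppose that for all $i\ge 2$ $$\frac{a_i^2}{A_i\gamma+1}\le\Big(1+\frac{q_{j_*}}{5}\Big)\frac{a_{i-1}^2}{A_{i-1}\gamma+1}\qquad\text{and}\qquad \frac{25\,L_{p,q}^2\,a_{i-1}^2}{A_{i-1}\gamma+1}\le\frac{A_{i-2}\gamma+1}{4}.$$ Then the following hold after $k\le K$ iterations ($k \geq 1$), where expectations are with respect to all the randomness of the algorithm (the random choices $j_i,j_i'$, $i\in\{1,\dots,K\}$). (i) For any $x\in\mathrm{dom}(g)$ that is independent of the randomness of the algorithm, $$\mathbb{E}[\mathrm{Gap}(\bar{x}_k,x)]\le\frac{D(x,x_0)-\frac{A_k\gamma+1}{4}\,\mathbb{E}[\|x-x_k\|^2]}{A_k}.$$ (ii) In particular, for $\gamma\ge 0$, if $x^*\in\mathrm{dom}(g)$ is a solution of the variational inequality, i.e. $\langle F(x),x-x^*\rangle+g(x)-g(x^* )\ge 0$ for all $x\in\mathbb{R}^d$, then $$\mathbb{E}[\|x^*-x_k\|^2]\le\frac{4D(x^*,x_0)}{A_k\gamma+1}.$$ (iii) In the case $\gamma=0$, if moreover $\frac{75\,L_{p,q}^2\,a_i^2}{2}-\frac14\le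 0$ for all $i\ge 1$, then $$\mathbb{E}\Big[\sup_{x\in\mathrm{dom}(g)}\mathrm{Gap}(\bar{x}_k,x)\Big]\le\frac{2\sup_{y\in\mathrm{dom}(g)}D(y,x_0)}{A_k}.$$ (iv) All the conditions on the step sizes, namely $\frac{a_i^2}{A_i\gamma+1}\le\big(1+\frac{q_{j_*}}{5}\big)\frac{a_{i-1}^2}{A_{i-1}\gamma+1}$ and $\frac{25\,L_{p,q}^2\,a_{i-1}^2}{A_{i-1}\gamma+1}\le\frac{A_{i-2}\gamma+1}{4}$ for all $i\ge 2$, and, in the case $\gamma=0$, also $\frac{75\,L_{p,q}^2\,a_i^2}{2}-\frac14\le 0$ for all $i\ge 1$, can be satisfied with $a_1=A_1=\sqrt{\frac23}\,\frac{1}{10L_{p,q}}$ and $A_k=A_1\max\Big\{k,\ \big(1+\min\big\{\frac{q_{j_*}}{11},\frac{\gamma}{10L_{p,q}}\big\}\big)^{k-1}\Big\}$.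
   Context: Setting. $\|\cdot\|$ is a norm on $\mathbb{R}^d$ and $\|\cdot\|_*$ its dual norm. $F:\mathbb{R}^d\to\mathbb{R}^d$ is monotone ($\langle F(x)-F(y),x-y\rangle\ge 0$ for all $x,y$) and Lipschitz. $g:\mathbb{R}^d\to\mathbb{R}\cup\{+\infty\}$ is proper, convex, lower semicontinuous, and $\gamma$-strongly convex with respect to $\|\cdot\|$ for some $\gamma\ge 0$ ($\gamma=0$ meaning merely convex). It is assumed that either $g$ is strongly convex ($\gamma>0$) or $\mathrm{dom}(g)$ is compact. There is a decomposition $F(x)=\sum_{j=1}^m F_j(x)$ for all $x\in\mathrm{dom}(g)$, for given operators $F_1,\dots,F_m$. $D(\cdot,\cdot)$ is the Bregman divergence, $D(u,v)=\psi(u)-\psi(v)-\langle\nabla\psi(v),u-v\rangle$, of a function $\psi$ that is $1$-strongly convex with respect to $\|\cdot\|$ (chosen so that the minimization problem defining $x_k$ in step 5 of the algorithm REM is solvable). $\Delta_m$ is the probability simplex in $\mathbb{R}^m$; $p,q\in\Delta_m$ have positive entries. Gap function: $\mathrm{Gap}(\hat{x},x)=\langle F(x),\hat{x}-x\rangle-g(x)+g(\hat{x})$. Lipschitz parameter (assumed positive and finite): $$L_{p,q}:=\sqrt{\sup_{x,y\in\mathrm{dom}(g),\,x\ne y}\frac{\sum_{j=1}^m\frac{1}{p_jq_j^2}\|F_j(x)-F_j(y)\|_*^2}{\|x-y\|^2}}.$$ Algorithm REM. Input $x_0\in\mathrm{dom}(g)$ (deterministic), $p,q\in\Delta_m$,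 number of iterations $K$, $\gamma$. Initialize $\widetilde{F}_{0,j}=F_j(x_0)$ for $j=1,\dots,m$, $a_0=A_0=0$, $z_0=0$. Throughout $\widetilde{F}_k=\sum_{j=1}^m\widetilde{F}_{k,j}$. For $k=1,\dots,K$: 1. take the step size $a_k>0$ and set $A_k=a_k+A_{k-1}$; 2. draw $j_k\in\{1,\dots,m\}$ from distribution $p$, independently of all prior random choices; 3. $\widehat{F}_k=\widetilde{F}_{k-1}+\frac{a_{k-1}}{a_kp_{j_k}}\big(F_{j_k}(x_{k-1})-\widetilde{F}_{k-2,j_k}\big)$ (for $k=1$ the second term is zero since $a_0=0$); 4. $z_k=z_{k-1}+a_k\widehat{F}_k$; 5. $x_k=\arg\min_{u\in\mathbb{R}^d}\{\langle z_k,u\rangle+A_kg(u)+D(u,x_0)\}$; 6. draw $j_k'\in\{1,\dots,m\}$ from distribution $q$, independently of all prior random choices; 7. $\widetilde{F}_{k,j}=\widetilde{F}_{k-1,j}$ if $j\ne j_k'$, and $\widetilde{F}_{k,j}=F_j(x_k)$ if $j=j_k'$.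
   Formalization: In (iv), for γ>0 no single step sequence has A_k equal to the formula for all k (growth condition fails where the max switches branch); stated instead: equality for all k if γ=0, equality at each single k, and one sequence with A_k at least the formula for all k. *)

theory Defs
  imports "HOL-Probability.Probability"
begin

text \<open>An arbitrary norm on \<open>\<real>\<^sup>d\<close>, in general different from the Euclidean norm of the type.\<close>

definition is_norm :: "('a::real_vector \<Rightarrow> real) \<Rightarrow> bool" where
  "is_norm N \<longleftrightarrow> (\<forall>x. 0 \<le> N x) \<and> (\<forall>x. N x = 0 \<longleftrightarrow> x = 0)
     \<and> (\<forall>c x. N (c *\<^sub>R x) = \<bar>c\<bar> * N x) \<and> (\<forall>x y. N (x + y) \<le> N x + N y)"

definition dual_norm :: "('a::real_inner \<Rightarrow> real) \<Rightarrow> 'a \<Rightarrow> real" where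
  "dual_norm N y = (SUP x\<in>{x. N x \<le> 1}. y \<bullet> x)"

definition monotone_operator :: "('a::real_inner \<Rightarrow> 'a) \<Rightarrow> bool" where
  "monotone_operator F \<longleftrightarrow> (\<forall>x y. 0 \<le> (F x - F y) \<bullet> (x - y))"

definition lipschitz_operator :: "('a::real_inner \<Rightarrow> real) \<Rightarrow> ('a \<Rightarrow> 'a) \<Rightarrow> bool" where
  "lipschitz_operator N F \<longleftrightarrow> (\<exists>C. \<forall>x y. dual_norm N (F x - F y) \<le> C * N (x - y))"

definition edom :: "('a \<Rightarrow> ereal) \<Rightarrow> 'a set" where
  "edom g = {x. g x < \<infinity>}"

definition proper :: "('a \<Rightarrow> ereal) \<Rightarrow> bool" where
  "proper g \<longleftrightarrow> edom g \<noteq> {} \<and> (\<forall>x. g x \<noteq> -\<infinity>)"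

definition lower_semicontinuous :: "('a::topological_space \<Rightarrow> ereal) \<Rightarrow> bool" where
  "lower_semicontinuous g \<longleftrightarrow> (\<forall>x. g x \<le> Liminf (at x) g)"

text \<open>For \<open>\<gamma> = 0\<close> this is convexity.\<close>

definition strongly_convex_ext :: "('a::real_vector \<Rightarrow> real) \<Rightarrow> real \<Rightarrow> ('a \<Rightarrow> ereal) \<Rightarrow> bool" where
  "strongly_convex_ext N \<gamma> g \<longleftrightarrow> (\<forall>x y. \<forall>t\<in>{0<..<1}.
     g ((1 - t) *\<^sub>R x + t *\<^sub>R y) + ereal (\<gamma> / 2 * t * (1 - t) * (N (x - y))\<^sup>2)
       \<le> ereal (1 - t) * g x + ereal t * g y)"

definition strongly_convex_on ::
    "('a::real_vector) set \<Rightarrow> ('a \<Rightarrow> real) \<Rightarrow> real \<Rightarrow> ('a \<Rightarrow> real) \<Rightarrow> bool" where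
  "strongly_convex_on S N \<sigma> \<psi> \<longleftrightarrow> convex S \<and> (\<forall>x\<in>S. \<forall>y\<in>S. \<forall>t\<in>{0<..<1}.
     \<psi> ((1 - t) *\<^sub>R x + t *\<^sub>R y) + \<sigma> / 2 * t * (1 - t) * (N (x - y))\<^sup>2
       \<le> (1 - t) * \<psi> x + t * \<psi> y)"

definition grad :: "('a::real_inner \<Rightarrow> real) \<Rightarrow> 'a \<Rightarrow> 'a" where
  "grad \<psi> v = (THE w. GDERIV \<psi> v :> w)"

definition bregman :: "('a::real_inner \<Rightarrow> real) \<Rightarrow> 'a \<Rightarrow> 'a \<Rightarrow> real" where
  "bregman \<psi> u v = \<psi> u - \<psi> v - grad \<psi> v \<bullet> (u - v)"

text \<open>Finite for arguments in \<open>edom g\<close>. For \<open>xh \<in> edom g\<close> the supremum over \<open>x \<in> edom g\<close> is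
  nonnegative (take \<open>x = xh\<close>), so its expectation can be taken as a nonnegative integral.\<close>

definition Gap :: "('a::real_inner \<Rightarrow> 'a) \<Rightarrow> ('a \<Rightarrow> ereal) \<Rightarrow> 'a \<Rightarrow> 'a \<Rightarrow> ereal" where
  "Gap F g xh x = ereal (F x \<bullet> (xh - x)) - g x + g xh"

definition vi_solution :: "('a::real_inner \<Rightarrow> 'a) \<Rightarrow> ('a \<Rightarrow> ereal) \<Rightarrow> 'a \<Rightarrow> bool" where
  "vi_solution F g xs \<longleftrightarrow> xs \<in> edom g \<and> (\<forall>x. 0 \<le> ereal (F x \<bullet> (x - xs)) + g x - g xs)"

definition pos_simplex :: "('m::finite \<Rightarrow> real) \<Rightarrow> bool" where
  "pos_simplex p \<longleftrightarrow> (\<forall>j. 0 < p j) \<and> (\<Sum>j\<in>UNIV. p j) = 1"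

text \<open>The supremum is taken in the extended reals, so that positivity and finiteness of the
  Lipschitz parameter are expressible; both fail to be automatic (the supremum is \<open>-\<infinity>\<close>
  if \<open>edom g\<close> is a singleton).\<close>

definition Lsq :: "('a::real_inner \<Rightarrow> real) \<Rightarrow> ('m::finite \<Rightarrow> 'a \<Rightarrow> 'a) \<Rightarrow> ('a \<Rightarrow> ereal)
    \<Rightarrow> ('m \<Rightarrow> real) \<Rightarrow> ('m \<Rightarrow> real) \<Rightarrow> ereal" where
  "Lsq N Fs g p q = (SUP (x, y)\<in>{(x, y). x \<in> edom g \<and> y \<in> edom g \<and> x \<noteq> y}.
     ereal ((\<Sum>j\<in>UNIV. 1 / (p j * (q j)\<^sup>2) * (dual_norm N (Fs j x - Fs j y))\<^sup>2) / (N (x - y))\<^sup>2))"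

definition Lpq :: "('a::real_inner \<Rightarrow> real) \<Rightarrow> ('m::finite \<Rightarrow> 'a \<Rightarrow> 'a) \<Rightarrow> ('a \<Rightarrow> ereal)
    \<Rightarrow> ('m \<Rightarrow> real) \<Rightarrow> ('m \<Rightarrow> real) \<Rightarrow> real" where
  "Lpq N Fs g p q = sqrt (real_of_ereal (Lsq N Fs g p q))"

definition stepsum :: "(nat \<Rightarrow> real) \<Rightarrow> nat \<Rightarrow> real" where
  "stepsum a k = (\<Sum>i=1..k. a i)"

definition averaged :: "(nat \<Rightarrow> real) \<Rightarrow> (nat \<Rightarrow> 'a::real_vector) \<Rightarrow> nat \<Rightarrow> 'a" where
  "averaged a x k = (1 / stepsum a k) *\<^sub>R (\<Sum>i=1..k. a i *\<^sub>R x i)"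

text \<open>A run along one realisation \<open>j\<close>, \<open>j'\<close> of the random indices; \<open>x\<close> is the sequence of iterates.
  For \<open>k = 1\<close> the truncated index \<open>k - 2\<close> is harmless, since the term carries the factor
  \<open>a 0 = 0\<close>. Solvability of the minimisation problems is part of the existence of a run.\<close>

definition REM_run :: "('m::finite \<Rightarrow> 'a::real_inner \<Rightarrow> 'a) \<Rightarrow> ('a \<Rightarrow> ereal) \<Rightarrow> ('a \<Rightarrow> real)
    \<Rightarrow> ('m \<Rightarrow> real) \<Rightarrow> (nat \<Rightarrow> real) \<Rightarrow> 'a \<Rightarrow> nat \<Rightarrow> (nat \<Rightarrow> 'm) \<Rightarrow> (nat \<Rightarrow> 'm) \<Rightarrow> (nat \<Rightarrow> 'a) \<Rightarrow> bool" where
  "REM_run Fs g \<psi> p a x0 K j j' x \<longleftrightarrow>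
    (\<exists>(Ft :: nat \<Rightarrow> 'm \<Rightarrow> 'a) (Fh :: nat \<Rightarrow> 'a) (z :: nat \<Rightarrow> 'a).
      x 0 = x0 \<and> z 0 = 0 \<and> (\<forall>i. Ft 0 i = Fs i x0) \<and>
      (\<forall>k\<in>{1..K}.
         Fh k = (\<Sum>i\<in>UNIV. Ft (k - 1) i)
                + (a (k - 1) / (a k * p (j k))) *\<^sub>R (Fs (j k) (x (k - 1)) - Ft (k - 2) (j k)) \<and>
         z k = z (k - 1) + a k *\<^sub>R Fh k \<and>
         is_arg_min (\<lambda>u. ereal (z k \<bullet> u) + ereal (stepsum a k) * g u + ereal (bregman \<psi> u x0))
                    (\<lambda>_. True) (x k) \<and>
         (\<forall>i. Ft k i = (if i = j' k then Fs i (x k) else Ft (k - 1) i))))"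

text \<open>All \<open>2 K\<close> draws are mutually independent (each is independent of all prior ones).\<close>

definition REM_sampling :: "'w measure \<Rightarrow> nat \<Rightarrow> ('m::finite \<Rightarrow> real) \<Rightarrow> ('m \<Rightarrow> real)
    \<Rightarrow> (nat \<Rightarrow> 'w \<Rightarrow> 'm) \<Rightarrow> (nat \<Rightarrow> 'w \<Rightarrow> 'm) \<Rightarrow> bool" where
  "REM_sampling M K p q J J' \<longleftrightarrow> prob_space M \<and>
     prob_space.indep_vars M (\<lambda>_. count_space UNIV) (case_sum J J') ({1..K} <+> {1..K}) \<and>
     (\<forall>k\<in>{1..K}. \<forall>i. measure M {\<omega> \<in> space M. J k \<omega> = i} = p i
                    \<and> measure M {\<omega> \<in> space M. J' k \<omega> = i} = q i)"

definition positive_steps :: "(nat \<Rightarrow> real) \<Rightarrow> bool" where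
  "positive_steps a \<longleftrightarrow> a 0 = 0 \<and> (\<forall>i\<ge>1. 0 < a i)"

definition step_conditions :: "real \<Rightarrow> real \<Rightarrow> real \<Rightarrow> (nat \<Rightarrow> real) \<Rightarrow> bool" where
  "step_conditions L \<gamma> qmin a \<longleftrightarrow> (\<forall>i\<ge>2.
     (a i)\<^sup>2 / (stepsum a i * \<gamma> + 1)
       \<le> (1 + qmin / 5) * ((a (i - 1))\<^sup>2 / (stepsum a (i - 1) * \<gamma> + 1)) \<and>
     25 * L\<^sup>2 * (a (i - 1))\<^sup>2 / (stepsum a (i - 1) * \<gamma> + 1)
       \<le> (stepsum a (i - 2) * \<gamma> + 1) / 4)"

definition step_condition_sup :: "real \<Rightarrow> (nat \<Rightarrow> real) \<Rightarrow> bool" where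
  "step_condition_sup L a \<longleftrightarrow> (\<forall>i\<ge>1. 75 * L\<^sup>2 * (a i)\<^sup>2 / 2 - 1 / 4 \<le> 0)"

text \<open>All the requirements on the step sizes together.\<close>

definition admissible_steps :: "real \<Rightarrow> real \<Rightarrow> real \<Rightarrow> (nat \<Rightarrow> real) \<Rightarrow> bool" where
  "admissible_steps L \<gamma> qmin a \<longleftrightarrow> positive_steps a \<and> step_conditions L \<gamma> qmin a
     \<and> (\<gamma> = 0 \<longrightarrow> step_condition_sup L a)"

definition A1_choice :: "real \<Rightarrow> real" where
  "A1_choice L = sqrt (2 / 3) * (1 / (10 * L))"

definition A_choice :: "real \<Rightarrow> real \<Rightarrow> real \<Rightarrow> nat \<Rightarrow> real" where
  "A_choice L \<gamma> qmin k =
     A1_choice L * max (real k) ((1 + min (qmin / 11) (\<gamma> / (10 * L))) ^ (k - 1))"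

text \<open>For \<open>\<gamma> > 0\<close> the increments of \<open>A_choice\<close> jump where the maximum switches from the linear to
  the geometric branch, and there the growth condition fails. So no single sequence of step sizes
  has the partial sums \<open>A_choice\<close> for all \<open>k\<close>; the next lemma exhibits this for \<open>qmin = 1\<close> (a single
  operator) and large \<open>\<gamma>\<close>, the switch being at \<open>k = 45\<close>. What holds is attainment for each
  \<open>k\<close>, attainment for all \<open>k\<close> simultaneously if \<open>\<gamma> = 0\<close>, and domination for all \<open>k\<close>
  simultaneously in general.\<close>

lemma A_choice_not_uniformly_attained:
  assumes "0 < L" and "1 / 11 \<le> \<gamma> / (10 * L)"
  shows "\<not> (\<exists>a. admissible_steps L \<gamma> 1 a \<and> (\<forall>k\<ge>1. stepsum a k = A_choice L \<gamma> 1 k))"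
proof
  assume "\<exists>a. admissible_steps L \<gamma> 1 a \<and> (\<forall>k\<ge>1. stepsum a k = A_choice L \<gamma> 1 k)"
  then obtain a where adm: "admissible_steps L \<gamma> 1 a"
    and A: "\<And>k. k \<ge> 1 \<Longrightarrow> stepsum a k = A_choice L \<gamma> 1 k" by auto
  define A1 where "A1 = A1_choice L"
  have A1: "A1 > 0" using assms by (simp add: A1_def A1_choice_def)
  have g: "\<gamma> > 0" using assms by (smt (verit) divide_nonpos_pos divide_pos_pos)
  have ch: "A_choice L \<gamma> 1 k = A1 * max (real k) ((12 / 11) ^ (k - 1))" for k
    using assms by (simp add: A_choice_def A1_def min_def)
  have A43: "stepsum a 43 = A1 * 43" and A44: "stepsum a 44 = A1 * 44"
    and A45: "stepsum a 45 = A1 * (12 / 11) ^ 44"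
    by (simp_all add: A ch max_def field_simps)
  have st: "stepsum a (Suc n) = stepsum a n + a (Suc n)" for n by (simp add: stepsum_def)
  have a44: "a 44 = A1" using st[of 43] A43 A44 by simp
  have p: "(45.9 :: real) \<le> (12 / 11) ^ 44" "(12 / 11 :: real) ^ 44 \<le> 46"
    by (simp_all add: field_simps)
  have a45: "a 45 = A1 * ((12 / 11) ^ 44 - 44)" using st[of 44] A44 A45 by (simp add: algebra_simps)
  define b where "b = a 45"
  define S where "S = stepsum a 45"
  have b: "b \<ge> A1 * 1.9" unfolding b_def a45 using p A1 by (intro mult_left_mono) auto
  have S: "S \<le> A1 * 46" unfolding S_def A45 using p A1 by (intro mult_left_mono) auto
  have S0: "S > 0" unfolding S_def A45 using A1 by simp
  have "(a 45)\<^sup>2 / (stepsum a 45 * \<gamma> + 1)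
      \<le> (1 + 1 / 5) * ((a (45 - 1))\<^sup>2 / (stepsum a (45 - 1) * \<gamma> + 1))"
    using adm unfolding admissible_steps_def step_conditions_def
    by (elim conjE) (drule spec[of _ 45], simp)
  hence "b\<^sup>2 / (S * \<gamma> + 1) \<le> (6 / 5) * (A1\<^sup>2 / (A1 * 44 * \<gamma> + 1))"
    by (simp add: a44 A44 b_def S_def)
  hence le: "b\<^sup>2 * (A1 * 44 * \<gamma> + 1) \<le> (6 / 5) * A1\<^sup>2 * (S * \<gamma> + 1)"
  proof -
    have "S * \<gamma> + 1 > 0" "A1 * 44 * \<gamma> + 1 > 0" using S0 g A1 by (simp_all add: add_pos_pos)
    thus ?thesis using \<open>b\<^sup>2 / (S * \<gamma> + 1) \<le> _\<close> by (simp add: field_simps)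
  qed
  have "(A1 * 1.9)\<^sup>2 * (A1 * 44 * \<gamma> + 1) \<le> b\<^sup>2 * (A1 * 44 * \<gamma> + 1)"
    using b A1 g by (intro mult_right_mono power_mono) auto
  moreover have "(6 / 5) * A1\<^sup>2 * (S * \<gamma> + 1) \<le> (6 / 5) * A1\<^sup>2 * (A1 * 46 * \<gamma> + 1)"
    using S g by (intro mult_left_mono add_right_mono mult_right_mono) auto
  ultimately have "(A1 * 1.9)\<^sup>2 * (A1 * 44 * \<gamma> + 1) \<le> (6 / 5) * A1\<^sup>2 * (A1 * 46 * \<gamma> + 1)"
    using le by linarith
  hence "A1\<^sup>2 * (3.61 * (A1 * 44 * \<gamma> + 1)) \<le> A1\<^sup>2 * ((6 / 5) * (A1 * 46 * \<gamma> + 1))"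
    by (simp add: power2_eq_square algebra_simps)
  hence "3.61 * (A1 * 44 * \<gamma> + 1) \<le> (6 / 5) * (A1 * 46 * \<gamma> + 1)"
    using A1 by (simp only: mult_le_cancel_left_pos zero_less_power)
  moreover have "A1 * \<gamma> > 0" using A1 g by simp
  ultimately show False by (simp add: algebra_simps)
qed

end

theory Submission
  imports Defs
begin

text \<open>
  Dual averaging together with monotonicity bounds the weighted gaps by \<open>D(x, x\<^sub>0)\<close> minus the squared
  increments \<open>\<parallel>x\<^sub>i - x\<^sub>i\<^sub>-\<^sub>1\<parallel>\<^sup>2\<close>, up to the errors of the estimates of \<open>F\<close>. With
  \<open>e\<^sub>i = a\<^sub>i (F(x\<^sub>i) - \<Sum>\<^sub>j Ft\<^sub>i\<^sub>-\<^sub>1\<^sub>,\<^sub>j)\<close> and its unbiased one-index estimate \<open>eh\<^sub>i\<close>, these errors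
  telescope into \<open>e\<^sub>k\<close>, the products of \<open>eh\<^sub>i\<close> with \<open>x\<^sub>i\<^sub>+\<^sub>1 - x\<^sub>i\<close> and a martingale term.
  Every component \<open>Ft\<^sub>i\<^sub>,\<^sub>j\<close> is refreshed with probability \<open>q\<^sub>j\<close>, so its mean squared staleness contracts
  by a factor \<open>1 - q\<^sub>j/2\<close> per step while growing by \<open>(3/q\<^sub>j) \<parallel>F\<^sub>j(x\<^sub>i) - F\<^sub>j(x\<^sub>i\<^sub>-\<^sub>1)\<parallel>\<^sub>*\<^sup>2\<close>; the weights
  \<open>a\<^sub>i\<^sup>2 / (A\<^sub>i \<gamma> + 1)\<close> grow slowly enough to keep a contraction by \<open>1 - 3 q\<^sub>j/10\<close>, and the squared
  increments absorb the sum. For the supremum over \<open>x\<close> the martingale term is handled by a second,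
  auxiliary dual averaging sequence driven by the noise.
\<close>

section \<open>Norms, strong convexity and smooth conjugates\<close>

text \<open>No measurability of the iterates is assumed and no conditional expectation appears. The
  minimisers of step 5 are unique by strong convexity, so each iterate is a function of finitely
  many draws from a finite type. The quantities averaged one by one thus take finitely many values,
  which settles measurability and integrability, and conditioning on a fresh draw becomes a finite
  sum. Quadratic terms are always split in the same way: strong convexity yields the coefficient
  \<open>(A i * \<gamma> + 1) / 2\<close>, Young's inequality spends half of it on an error, and the
  remaining quarter absorbs the staleness or survives in the bound for \<open>x k\<close>. The
  weights \<open>1 / (p j * (q j)\<^sup>2)\<close> of the Lipschitz parameter arise as follows: the
  one-index estimate costs \<open>1 / p j\<close>, and growth \<open>3 / q j\<close> divided by the
  contraction rate \<open>3 * q j / 10\<close> gives \<open>10 / (q j)\<^sup>2\<close>. One copy of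
  the resulting error sum enters the expected gap and three enter the supremum, so the constants 10
  and 30 have to fit below the 25 and 75/2 of the step conditions.\<close>

locale finite_dim_norm =
  fixes N :: "'a::euclidean_space \<Rightarrow> real"
  assumes is_norm: "is_norm N"
begin

lemma N_nonneg [simp]: "0 \<le> N x"
  and N_eq_0 [simp]: "N x = 0 \<longleftrightarrow> x = 0"
  and N_scaleR: "N (c *\<^sub>R x) = \<bar>c\<bar> * N x"
  and N_triangle: "N (x + y) \<le> N x + N y"
  using is_norm by (auto simp: is_norm_def)

lemma N_0 [simp]: "N 0 = 0"
  by (simp only: N_eq_0)

lemma N_minus [simp]: "N (- x) = N x"
  using N_scaleR[of "-1" x] by simp

lemma N_minus_commute: "N (x - y) = N (y - x)"
  using N_minus[of "x - y"] by simp

lemma N_sum: "finite S \<Longrightarrow> N (sum f S) \<le> (\<Sum>i\<in>S. N (f i))"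
proof (induction S rule: finite_induct)
  case (insert i S)
  then show ?case using N_triangle[of "f i" "sum f S"] by simp
qed simp

lemma N_le_norm: obtains C where "C > 0" "\<And>x. N x \<le> C * norm x"
proof
  let ?C = "(\<Sum>b\<in>Basis. N b) + 1"
  show "?C > 0" by (simp add: add_nonneg_pos sum_nonneg)
  fix x :: 'a
  have "N x = N (\<Sum>b\<in>Basis. (x \<bullet> b) *\<^sub>R b)" by (simp add: euclidean_representation)
  also have "\<dots> \<le> (\<Sum>b\<in>Basis. N ((x \<bullet> b) *\<^sub>R b))" by (rule N_sum) simp
  also have "\<dots> \<le> (\<Sum>b\<in>Basis. norm x * N b)"
    by (intro sum_mono) (simp add: N_scaleR mult_right_mono Basis_le_norm)
  also have "\<dots> = norm x * (\<Sum>b\<in>Basis. N b)" by (simp add: sum_distrib_left)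
  also have "\<dots> \<le> ?C * norm x" by (simp add: algebra_simps)
  finally show "N x \<le> ?C * norm x" .
qed

lemma N_diff_le: "\<bar>N x - N y\<bar> \<le> N (x - y)"
  using N_triangle[of "x - y" y] N_triangle[of "y - x" x] by (simp add: N_minus_commute)

lemma continuous_on_N: "continuous_on S N"
proof -
  obtain C where C: "C > 0" "\<And>x. N x \<le> C * norm x" using N_le_norm by metis
  have "C-lipschitz_on S N"
    using C N_diff_le order_trans by (intro lipschitz_onI) (fastforce simp: dist_norm)+
  then show ?thesis by (rule lipschitz_on_continuous_on)
qed

lemma norm_le_N: obtains C where "C > 0" "\<And>x. norm x \<le> C * N x"
proof -
  have "compact (sphere (0::'a) 1)" "sphere (0::'a) 1 \<noteq> {}" by auto
  then obtain v where v: "v \<in> sphere 0 1" "\<And>x. x \<in> sphere 0 1 \<Longrightarrow> N v \<le> N x"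
    using continuous_attains_inf continuous_on_N by metis
  have pos: "N v > 0" using v(1) N_nonneg[of v] N_eq_0[of v] by (auto simp: less_le simp del: N_nonneg N_eq_0)
  show thesis
  proof
    show "1 / N v > 0" using pos by simp
    fix x :: 'a
    show "norm x \<le> 1 / N v * N x"
    proof (cases "x = 0")
      case False
      then have "N v \<le> N ((1 / norm x) *\<^sub>R x)" by (intro v(2)) simp
      also have "\<dots> = N x / norm x" by (simp add: N_scaleR)
      finally show ?thesis using False pos by (simp add: field_simps)
    qed simp
  qed
qed

text \<open>The supremum in \<open>dual_norm_def\<close> is one of reals and carries no information
  for an unbounded set. Equivalence of \<open>N\<close> with the Euclidean norm supplies the bound
  behind all further facts on \<open>Dn\<close>.\<close>

lemma dual_norm_bdd: "bdd_above ((\<lambda>x. y \<bullet> x) ` {x. N x \<le> 1})"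
proof -
  obtain C where C: "C > 0" "\<And>x. norm x \<le> C * N x" using norm_le_N by metis
  have "y \<bullet> x \<le> norm y * C" if "N x \<le> 1" for x
  proof -
    have "norm x \<le> C" using C(2)[of x] that C(1) by (smt (verit) mult_left_le)
    then show ?thesis using norm_cauchy_schwarz[of y x] by (smt (verit) mult_left_mono norm_ge_zero)
  qed
  then show ?thesis by (intro bdd_aboveI2[where M = "norm y * C"]) auto
qed

abbreviation "Dn \<equiv> dual_norm N"

lemma dual_norm_upper: "N x \<le> 1 \<Longrightarrow> y \<bullet> x \<le> Dn y"
  unfolding dual_norm_def by (rule cSUP_upper[OF _ dual_norm_bdd]) simp

lemma dual_norm_least: "(\<And>x. N x \<le> 1 \<Longrightarrow> y \<bullet> x \<le> b) \<Longrightarrow> Dn y \<le> b"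
  unfolding dual_norm_def by (rule cSUP_least) (auto intro!: exI[of _ "0::'a"])

lemma dual_norm_nonneg [simp]: "0 \<le> Dn y"
  using dual_norm_upper[of 0 y] by simp

lemma inner_le_dual_norm: "y \<bullet> x \<le> Dn y * N x"
proof (cases "x = 0")
  case False
  then have pos: "N x > 0" using N_nonneg[of x] N_eq_0[of x] by (simp add: less_le)
  have "y \<bullet> ((1 / N x) *\<^sub>R x) \<le> Dn y" by (rule dual_norm_upper) (use False in \<open>simp add: N_scaleR\<close>)
  then show ?thesis using pos by (simp add: field_simps)
qed simp

lemma dual_norm_0 [simp]: "Dn 0 = 0"
  by (rule antisym) (simp_all add: dual_norm_least)

lemma dual_norm_triangle: "Dn (y + y') \<le> Dn y + Dn y'"
  by (rule dual_norm_least) (simp add: inner_add_left add_mono dual_norm_upper)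

lemma dual_norm_scaleR: "Dn (c *\<^sub>R y) = \<bar>c\<bar> * Dn y"
proof -
  have le: "Dn (c *\<^sub>R y) \<le> \<bar>c\<bar> * Dn y" for c y
  proof (rule dual_norm_least)
    fix x assume "N x \<le> 1"
    then have "y \<bullet> (sgn c *\<^sub>R x) \<le> Dn y" by (intro dual_norm_upper) (simp add: N_scaleR sgn_if)
    then have "\<bar>c\<bar> * (y \<bullet> (sgn c *\<^sub>R x)) \<le> \<bar>c\<bar> * Dn y" by (rule mult_left_mono) simp
    then show "c *\<^sub>R y \<bullet> x \<le> \<bar>c\<bar> * Dn y" by (simp add: sgn_if abs_if split: if_splits)
  qed
  show ?thesis
  proof (cases "c = 0")
    case False
    have "Dn y \<le> \<bar>1 / c\<bar> * Dn (c *\<^sub>R y)" using le[of "1 / c" "c *\<^sub>R y"] False by simp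
    then have "\<bar>c\<bar> * Dn y \<le> Dn (c *\<^sub>R y)" using False by (simp add: field_simps)
    then show ?thesis using le[of c y] by simp
  qed simp
qed

lemma dual_norm_minus [simp]: "Dn (- y) = Dn y"
  using dual_norm_scaleR[of "-1" y] by simp

lemma dual_norm_sum: "finite S \<Longrightarrow> Dn (sum f S) \<le> (\<Sum>i\<in>S. Dn (f i))"
proof (induction S rule: finite_induct)
  case (insert i S)
  then show ?case using dual_norm_triangle[of "f i" "sum f S"] by simp
qed simp

text \<open>Cauchy-Schwarz after splitting off \<open>sqrt (p j)\<close> from each summand; the
  first factor is 1 because the \<open>p j\<close> sum to 1.\<close>

lemma dual_norm_sum_squared:
  fixes p :: "'m::finite \<Rightarrow> real"
  assumes "pos_simplex p"
  shows "(Dn (\<Sum>j\<in>UNIV. v j))\<^sup>2 \<le> (\<Sum>j\<in>UNIV. 1 / p j * (Dn (v j))\<^sup>2)"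
proof -
  have p: "p j > 0" "(\<Sum>j\<in>UNIV. p j) = 1" for j using assms by (auto simp: pos_simplex_def)
  have "(Dn (\<Sum>j\<in>UNIV. v j))\<^sup>2 \<le> (\<Sum>j\<in>UNIV. Dn (v j))\<^sup>2"
    by (intro power_mono dual_norm_sum) auto
  also have "\<dots> = (\<Sum>j\<in>UNIV. sqrt (p j) * (Dn (v j) / sqrt (p j)))\<^sup>2"
    using p(1) by (simp add: less_imp_neq[symmetric])
  also have "\<dots> \<le> (\<Sum>j\<in>UNIV. (sqrt (p j))\<^sup>2) * (\<Sum>j\<in>UNIV. (Dn (v j) / sqrt (p j))\<^sup>2)"
    by (rule Cauchy_Schwarz_ineq_sum)
  also have "\<dots> = (\<Sum>j\<in>UNIV. 1 / p j * (Dn (v j))\<^sup>2)"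
    using p by (simp add: power_divide less_imp_le)
  finally show ?thesis .
qed

lemma dual_norm_diff_squared: "(Dn (x - y))\<^sup>2 \<le> 2 * (Dn x)\<^sup>2 + 2 * (Dn y)\<^sup>2"
proof -
  have "(Dn (x - y))\<^sup>2 \<le> (Dn x + Dn y)\<^sup>2"
    using dual_norm_triangle[of x "- y"] by (intro power_mono) auto
  also have "\<dots> \<le> 2 * (Dn x)\<^sup>2 + 2 * (Dn y)\<^sup>2"
    using sum_squares_bound[of "Dn x" "Dn y"] by (simp add: power2_sum)
  finally show ?thesis .
qed

text \<open>Young's inequality, weighted so that \<open>y\<close> keeps a factor close to 1. With
  \<open>c = q l\<close> the factor \<open>1 + c / 2\<close> still leaves a contraction when
  \<open>y\<close> vanishes with probability \<open>q l\<close>. The bound \<open>c \<le> 1\<close>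
  turns \<open>1 + 2 / c\<close> into \<open>3 / c\<close>.\<close>

lemma dual_norm_add_squared:
  assumes "0 < c" "c \<le> 1"
  shows "(Dn (x + y))\<^sup>2 \<le> 3 / c * (Dn x)\<^sup>2 + (1 + c / 2) * (Dn y)\<^sup>2"
proof -
  have "(Dn (x + y))\<^sup>2 \<le> (Dn x + Dn y)\<^sup>2"
    by (intro power_mono dual_norm_triangle) auto
  also have "\<dots> \<le> (1 + 2 / c) * (Dn x)\<^sup>2 + (1 + c / 2) * (Dn y)\<^sup>2"
  proof -
    have "0 \<le> (2 * Dn x - c * Dn y)\<^sup>2 / (2 * c)" using assms by simp
    also have "\<dots> = 2 / c * (Dn x)\<^sup>2 + c / 2 * (Dn y)\<^sup>2 - 2 * Dn x * Dn y"
      using assms by (simp add: power2_eq_square field_simps)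
    finally show ?thesis by (simp add: power2_sum algebra_simps)
  qed
  also have "(1 + 2 / c) * (Dn x)\<^sup>2 \<le> 3 / c * (Dn x)\<^sup>2"
    using assms by (intro mult_right_mono) (simp_all add: field_simps)
  finally show ?thesis by simp
qed

text \<open>The factor \<open>c / 4\<close> is half of the \<open>c / 2\<close> that strong
  convexity provides for \<open>c = A i * \<gamma> + 1\<close>.\<close>

lemma inner_le_young:
  assumes "0 < c"
  shows "y \<bullet> x \<le> (Dn y)\<^sup>2 / c + c / 4 * (N x)\<^sup>2"
proof -
  have "0 \<le> (2 * Dn y - c * N x)\<^sup>2 / (4 * c)" using assms by simp
  also have "\<dots> = (Dn y)\<^sup>2 / c + c / 4 * (N x)\<^sup>2 - Dn y * N x"
    using assms by (simp add: power2_eq_square field_simps)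
  finally show ?thesis using inner_le_dual_norm[of y x] by simp
qed

text \<open>Compare \<open>x\<close> with the point at parameter \<open>t\<close> on the segment to
  \<open>u\<close>, divide by \<open>t\<close> and let \<open>t\<close> tend to 0 from the right. No
  derivative is involved, so nonsmooth objectives are covered.\<close>

lemma strongly_convex_on_minimum:
  assumes sc: "strongly_convex_on E N \<sigma> \<phi>" and x: "x \<in> E" and u: "u \<in> E"
    and min: "\<And>v. v \<in> E \<Longrightarrow> \<phi> x \<le> \<phi> v"
  shows "\<phi> x + \<sigma> / 2 * (N (u - x))\<^sup>2 \<le> \<phi> u"
proof -
  have "\<phi> x + (1 - t) * (\<sigma> / 2 * (N (u - x))\<^sup>2) \<le> \<phi> u" if t: "t \<in> {0<..<1}" for t
  proof -
    have inE: "(1 - t) *\<^sub>R x + t *\<^sub>R u \<in> E"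
      using sc x u t by (auto simp: strongly_convex_on_def convex_alt)
    have "\<phi> x + t * ((1 - t) * (\<sigma> / 2 * (N (u - x))\<^sup>2))
        \<le> \<phi> ((1 - t) *\<^sub>R x + t *\<^sub>R u) + \<sigma> / 2 * t * (1 - t) * (N (x - u))\<^sup>2"
      using min[OF inE] by (simp add: N_minus_commute[of x u] mult_ac)
    also have "\<dots> \<le> (1 - t) * \<phi> x + t * \<phi> u"
      using sc x u t by (auto simp: strongly_convex_on_def)
    finally have "t * (\<phi> x + (1 - t) * (\<sigma> / 2 * (N (u - x))\<^sup>2)) \<le> t * \<phi> u"
      by (simp add: algebra_simps)
    then show ?thesis using t by simp
  qed
  then have ev: "eventually (\<lambda>t. \<phi> x + (1 - t) * (\<sigma> / 2 * (N (u - x))\<^sup>2) \<le> \<phi> u) (at_right (0::real))"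
    unfolding eventually_at_right_field by (intro exI[of _ 1]) auto
  have "((\<lambda>t. \<phi> x + (1 - t) * (\<sigma> / 2 * (N (u - x))\<^sup>2)) \<longlongrightarrow> \<phi> x + (1 - 0) * (\<sigma> / 2 * (N (u - x))\<^sup>2)) (at_right 0)"
    by (intro tendsto_intros)
  from tendsto_upperbound[OF this ev] show ?thesis by simp
qed

text \<open>Since \<open>D\<close> need not be lower semicontinuous, the supremum need not be attained; the gradient
  \<open>u\<close> is the limit of a maximising sequence, which is Cauchy by strong convexity.\<close>

lemma conjugate_smooth:
  assumes sc: "strongly_convex_on E N 1 D" and ne: "E \<noteq> {}"
    and bdd: "\<And>s. bdd_above ((\<lambda>x. s \<bullet> x - D x) ` E)"
  shows "\<exists>u. \<forall>d. (SUP x\<in>E. (s + d) \<bullet> x - D x) \<le> (SUP x\<in>E. s \<bullet> x - D x) + d \<bullet> u + (Dn d)\<^sup>2 / 2"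
proof -
  define h where "h = (SUP x\<in>E. s \<bullet> x - D x)"
  define \<phi> where "\<phi> x = s \<bullet> x - D x" for x
  have le_h: "\<phi> x \<le> h" if "x \<in> E" for x
    unfolding h_def \<phi>_def by (rule cSUP_upper[OF that bdd])
  have cc: "(1 - t) * \<phi> x + t * \<phi> y + t * (1 - t) / 2 * (N (x - y))\<^sup>2 \<le> h"
    if "x \<in> E" "y \<in> E" "t \<in> {0<..<1}" for x y t
  proof -
    have "(1 - t) *\<^sub>R x + t *\<^sub>R y \<in> E" 
      using sc that by (auto simp: strongly_convex_on_def convex_alt)
    from le_h[OF this] have 1: "s \<bullet> ((1 - t) *\<^sub>R x + t *\<^sub>R y) - D ((1 - t) *\<^sub>R x + t *\<^sub>R y) \<le> h"
      by (simp add: \<phi>_def)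
    have "D ((1 - t) *\<^sub>R x + t *\<^sub>R y) + 1 / 2 * t * (1 - t) * (N (x - y))\<^sup>2 \<le> (1 - t) * D x + t * D y"
      using sc that unfolding strongly_convex_on_def by blast
    with 1 show ?thesis by (simp add: \<phi>_def algebra_simps inner_add_right)
  qed
  have "\<exists>x\<in>E. h - (1 / 2) ^ n < \<phi> x" for n
    using less_cSUP_iff[OF ne bdd[of s], of "h - (1 / 2) ^ n"] by (simp add: h_def \<phi>_def)
  then obtain U where U: "\<And>n. U n \<in> E" "\<And>n. h - (1 / 2) ^ n < \<phi> (U n)" by metis
  \<comment> \<open>Take \<open>t = 1 / 2\<close>: both values miss \<open>h\<close> by at most
    \<open>(1 / 2) ^ n\<close>, so the gain \<open>(N (U m - U n))\<^sup>2 / 8\<close> from strong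
    convexity cannot exceed that.\<close>
  have close: "(N (U m - U n))\<^sup>2 \<le> 8 * (1 / 2) ^ n" if "n \<le> m" for m n
  proof -
    have "(1 / 2 :: real) ^ m \<le> (1 / 2) ^ n" using that by (intro power_decreasing) auto
    moreover have "\<phi> (U m) / 2 + \<phi> (U n) / 2 + (N (U m - U n))\<^sup>2 / 8 \<le> h"
      using cc[OF U(1)[of m] U(1)[of n], of "1/2"] by simp
    ultimately show ?thesis using U(2)[of m] U(2)[of n] by linarith
  qed
  obtain C where C: "C > 0" "\<And>x. norm x \<le> C * N x" using norm_le_N by metis
  obtain C' where C': "C' > 0" "\<And>x. N x \<le> C' * norm x" using N_le_norm by metis
  have "Cauchy U"
  proof (rule CauchyI)
    fix e :: real assume e: "0 < e"
    have "(\<lambda>n. 8 * (1 / 2 :: real) ^ n) \<longlonglongrightarrow> 8 * 0" by (intro tendsto_intros LIMSEQ_power_zero) auto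
    then have "eventually (\<lambda>n. 8 * (1 / 2 :: real) ^ n < (e / (2 * C))\<^sup>2) sequentially"
      by (rule order_tendstoD) (use e C in auto)
    then obtain M where M: "8 * (1 / 2 :: real) ^ M < (e / (2 * C))\<^sup>2"
      by (auto simp: eventually_sequentially)
    have near: "norm (U m - U M) < e / 2" if "m \<ge> M" for m
    proof -
      have "N (U m - U M) < e / (2 * C)"
        using power_less_imp_less_base[of _ 2 "e / (2 * C)"] close[OF that] M e C(1) by fastforce
      then have "C * N (U m - U M) < C * (e / (2 * C))" using C(1) by (intro mult_strict_left_mono)
      then show ?thesis using C(2)[of "U m - U M"] C(1) by simp
    qed
    show "\<exists>M. \<forall>m\<ge>M. \<forall>n\<ge>M. norm (U m - U n) < e"
    proof (intro exI allI impI)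
      fix m n assume "m \<ge> M" "n \<ge> M"
      then show "norm (U m - U n) < e"
        using near[of m] near[of n] norm_triangle_ineq4[of "U m - U M" "U n - U M"] by simp
    qed
  qed
  then obtain u where u: "U \<longlonglongrightarrow> u" using Cauchy_convergent_iff convergent_def by blast
  have Nlim: "(\<lambda>n. N (U n - x)) \<longlonglongrightarrow> N (u - x)" for x
    by (rule continuous_on_tendsto_compose[OF continuous_on_N[of UNIV]]) (auto intro!: tendsto_intros u)
  \<comment> \<open>Here \<open>u\<close> plays the role of a maximiser although it may lie outside
    \<open>E\<close>: the values \<open>\<phi> (U n)\<close> are replaced by their lower bounds, and
    \<open>u\<close> enters only through \<open>N (u - x)\<close>.\<close>
  have str: "\<phi> x + (N (u - x))\<^sup>2 / 2 \<le> h" if x: "x \<in> E" for x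
  proof -
    have "\<phi> x + (1 - t) * ((N (u - x))\<^sup>2 / 2) \<le> h" if t: "t \<in> {0<..<1}" for t
    proof -
      have "(\<lambda>n. (1 - t) * (h - (1 / 2) ^ n) + t * \<phi> x + t * (1 - t) / 2 * (N (U n - x))\<^sup>2)
          \<longlonglongrightarrow> (1 - t) * (h - 0) + t * \<phi> x + t * (1 - t) / 2 * (N (u - x))\<^sup>2"
        by (intro tendsto_intros Nlim LIMSEQ_power_zero) auto
      moreover have "(1 - t) * (h - (1 / 2) ^ n) + t * \<phi> x + t * (1 - t) / 2 * (N (U n - x))\<^sup>2 \<le> h" for n
      proof -
        have "(1 - t) * (h - (1 / 2) ^ n) \<le> (1 - t) * \<phi> (U n)"
          using t U(2)[of n] by (intro mult_left_mono) auto
        then show ?thesis using cc[OF U(1)[of n] x t] by linarith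
      qed
      ultimately have "(1 - t) * (h - 0) + t * \<phi> x + t * (1 - t) / 2 * (N (u - x))\<^sup>2 \<le> h"
        by (intro LIMSEQ_le_const2) auto
      then have "t * (\<phi> x + (1 - t) * ((N (u - x))\<^sup>2 / 2)) \<le> t * h" by (simp add: algebra_simps)
      then show ?thesis using t by simp
    qed
    then have ev: "eventually (\<lambda>t. \<phi> x + (1 - t) * ((N (u - x))\<^sup>2 / 2) \<le> h) (at_right (0::real))"
      unfolding eventually_at_right_field by (intro exI[of _ 1]) auto
    have "((\<lambda>t. \<phi> x + (1 - t) * ((N (u - x))\<^sup>2 / 2)) \<longlongrightarrow> \<phi> x + (1 - 0) * ((N (u - x))\<^sup>2 / 2)) (at_right 0)"
      by (intro tendsto_intros)
    from tendsto_upperbound[OF this ev] show ?thesis by simp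
  qed
  show ?thesis
  proof (intro exI allI)
    fix d
    show "(SUP x\<in>E. (s + d) \<bullet> x - D x) \<le> (SUP x\<in>E. s \<bullet> x - D x) + d \<bullet> u + (Dn d)\<^sup>2 / 2"
    proof (rule cSUP_least[OF ne])
      fix x assume x: "x \<in> E"
      have "0 \<le> (Dn d - N (x - u))\<^sup>2" by simp
      then have "Dn d * N (x - u) \<le> (Dn d)\<^sup>2 / 2 + (N (u - x))\<^sup>2 / 2"
        by (simp add: power2_diff N_minus_commute[of x u])
      then show "(s + d) \<bullet> x - D x \<le> (SUP x\<in>E. s \<bullet> x - D x) + d \<bullet> u + (Dn d)\<^sup>2 / 2"
        using str[OF x] inner_le_dual_norm[of d "x - u"]
        by (simp add: h_def[symmetric] \<phi>_def inner_add_left inner_diff_right)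
    qed
  qed
qed

end

text \<open>\<open>grad\<close> is a definite description, so it has content only once a
  representing vector exists (read off on the basis) and is unique.\<close>

lemma gderiv_grad:
  fixes \<psi> :: "'a::euclidean_space \<Rightarrow> real"
  assumes "\<psi> differentiable (at v)"
  shows "GDERIV \<psi> v :> grad \<psi> v"
proof -
  obtain f where f: "(\<psi> has_derivative f) (at v)" using assms by (auto simp: differentiable_def)
  then interpret f: linear f by (rule has_derivative_linear)
  have "f h = h \<bullet> (\<Sum>b\<in>Basis. f b *\<^sub>R b)" for h
  proof -
    have "f h = f (\<Sum>b\<in>Basis. (h \<bullet> b) *\<^sub>R b)" by (simp add: euclidean_representation)
    also have "\<dots> = (\<Sum>b\<in>Basis. (h \<bullet> b) * f b)" by (simp add: f.sum f.scaleR)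
    finally show ?thesis by (simp add: inner_sum_right mult.commute)
  qed
  then have G: "GDERIV \<psi> v :> (\<Sum>b\<in>Basis. f b *\<^sub>R b)"
    using f unfolding gderiv_def by (metis (no_types, lifting) ext)
  have "w = w'" if "GDERIV \<psi> v :> w" "GDERIV \<psi> v :> w'" for w w'
  proof -
    have "(\<lambda>h. h \<bullet> w) = (\<lambda>h. h \<bullet> w')"
      using that unfolding gderiv_def by (rule has_derivative_unique)
    then have "h \<bullet> w = h \<bullet> w'" for h by (rule fun_cong)
    then show ?thesis using vector_eq_ldot[of w w'] by blast
  qed
  with G show ?thesis unfolding grad_def by (intro theI[of "gderiv \<psi> v"])
qed

text \<open>The difference quotient of \<open>\<psi>\<close> from \<open>x0\<close> towards
  \<open>u\<close> tends to the directional derivative. Strong convexity is known on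
  \<open>E\<close> only and controls the quotient for \<open>t\<close> in (0,1), hence the
  right-hand limit.\<close>

lemma (in finite_dim_norm) bregman_lower_bound:
  assumes sc: "strongly_convex_on E N 1 \<psi>" and diff: "\<psi> differentiable (at x0)"
    and x0: "x0 \<in> E" and u: "u \<in> E"
  shows "(N (u - x0))\<^sup>2 / 2 \<le> bregman \<psi> u x0"
proof -
  have "(\<psi> has_derivative (\<lambda>h. h \<bullet> grad \<psi> x0)) (at x0)"
    using gderiv_grad[OF diff] by (simp add: gderiv_def)
  moreover have "((\<lambda>t. x0 + t *\<^sub>R (u - x0)) has_derivative (\<lambda>t. t *\<^sub>R (u - x0))) (at 0)"
    by (auto intro!: derivative_eq_intros)
  ultimately have "((\<lambda>t. \<psi> (x0 + t *\<^sub>R (u - x0))) has_derivative (\<lambda>t. (t *\<^sub>R (u - x0)) \<bullet> grad \<psi> x0)) (at 0)"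
    using has_derivative_compose[of "\<lambda>t. x0 + t *\<^sub>R (u - x0)" "\<lambda>t. t *\<^sub>R (u - x0)" 0 UNIV \<psi> "\<lambda>h. h \<bullet> grad \<psi> x0"]
    by simp
  then have "((\<lambda>t. \<psi> (x0 + t *\<^sub>R (u - x0))) has_derivative (\<lambda>t. ((u - x0) \<bullet> grad \<psi> x0) * t)) (at 0)"
    by (simp only: inner_scaleR_left mult.commute)
  then have "((\<lambda>t. \<psi> (x0 + t *\<^sub>R (u - x0))) has_real_derivative ((u - x0) \<bullet> grad \<psi> x0)) (at 0)"
    unfolding has_field_derivative_def .
  then have "((\<lambda>t. (\<psi> (x0 + t *\<^sub>R (u - x0)) - \<psi> x0) / t) \<longlongrightarrow> (u - x0) \<bullet> grad \<psi> x0) (at 0)"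
    by (simp add: has_field_derivative_iff)
  then have lim: "((\<lambda>t. (\<psi> (x0 + t *\<^sub>R (u - x0)) - \<psi> x0) / t) \<longlongrightarrow> (u - x0) \<bullet> grad \<psi> x0) (at_right 0)"
    by (rule filterlim_mono) (auto simp: at_le)
  have "(\<psi> (x0 + t *\<^sub>R (u - x0)) - \<psi> x0) / t + (1 - t) * ((N (u - x0))\<^sup>2 / 2) \<le> \<psi> u - \<psi> x0"
    if t: "t \<in> {0<..<1}" for t
  proof -
    have "\<psi> ((1 - t) *\<^sub>R x0 + t *\<^sub>R u) + 1 / 2 * t * (1 - t) * (N (x0 - u))\<^sup>2 \<le> (1 - t) * \<psi> x0 + t * \<psi> u"
      using sc x0 u t unfolding strongly_convex_on_def by blast
    moreover have "(1 - t) *\<^sub>R x0 + t *\<^sub>R u = x0 + t *\<^sub>R (u - x0)" by (simp add: algebra_simps)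
    ultimately have "(\<psi> (x0 + t *\<^sub>R (u - x0)) - \<psi> x0) + t * ((1 - t) * ((N (u - x0))\<^sup>2 / 2)) \<le> t * (\<psi> u - \<psi> x0)"
      by (simp add: N_minus_commute[of x0 u] algebra_simps)
    then have "t * ((\<psi> (x0 + t *\<^sub>R (u - x0)) - \<psi> x0) / t + (1 - t) * ((N (u - x0))\<^sup>2 / 2)) \<le> t * (\<psi> u - \<psi> x0)"
      using t by (simp add: distrib_left)
    then show ?thesis using t by simp
  qed
  then have ev: "eventually (\<lambda>t. (\<psi> (x0 + t *\<^sub>R (u - x0)) - \<psi> x0) / t + (1 - t) * ((N (u - x0))\<^sup>2 / 2) \<le> \<psi> u - \<psi> x0) (at_right 0)"
    unfolding eventually_at_right_field by (intro exI[of _ 1]) auto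
  have "((\<lambda>t. (\<psi> (x0 + t *\<^sub>R (u - x0)) - \<psi> x0) / t + (1 - t) * ((N (u - x0))\<^sup>2 / 2))
      \<longlongrightarrow> (u - x0) \<bullet> grad \<psi> x0 + (1 - 0) * ((N (u - x0))\<^sup>2 / 2)) (at_right 0)"
    by (intro tendsto_intros lim)
  from tendsto_upperbound[OF this ev] show ?thesis
    by (simp add: bregman_def inner_commute)
qed

section \<open>Step sizes\<close>

lemma stepsum_0 [simp]: "stepsum a 0 = 0"
  and stepsum_Suc [simp]: "stepsum a (Suc k) = stepsum a k + a (Suc k)"
  by (simp_all add: stepsum_def)

lemma stepsum_mono_pos:
  assumes "positive_steps a"
  shows "0 \<le> stepsum a k" "k \<ge> 1 \<Longrightarrow> 0 < stepsum a k" "stepsum a k \<le> stepsum a (Suc k)"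
proof -
  have a: "0 < a (Suc i)" for i using assms by (simp add: positive_steps_def)
  show nonneg: "0 \<le> stepsum a k" for k by (induction k) (simp_all add: a less_imp_le)
  show "0 < stepsum a k" if "k \<ge> 1"
    using that a nonneg[of "k - 1"] by (cases k) (simp_all add: add_nonneg_pos)
  show "stepsum a k \<le> stepsum a (Suc k)" using a[of k] by simp
qed

locale step_choice =
  fixes L \<gamma> qmin :: real
  assumes L: "0 < L" and \<gamma>: "0 \<le> \<gamma>" and qmin: "0 < qmin" "qmin \<le> 1"
begin

definition "A1 = A1_choice L"
definition "r = min (qmin / 11) (\<gamma> / (10 * L))"

text \<open>At this value \<open>75 * L\<^sup>2 * A1\<^sup>2 / 2\<close> equals 1/4, so a constant
  step \<open>A1\<close> meets the condition for the supremum with equality, while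
  \<open>25 * L\<^sup>2 * A1\<^sup>2 = 1 / 6\<close> stays below 1/4.\<close>

lemma A1_pos: "0 < A1" and A1_sq: "L\<^sup>2 * A1\<^sup>2 = 1 / 150"
  using L by (simp_all add: A1_def A1_choice_def power_mult_distrib power_divide real_sqrt_divide)

lemma r_nonneg: "0 \<le> r" and r_le_q: "r \<le> qmin / 11" and r_le_\<gamma>: "r \<le> \<gamma> / (10 * L)"
  using L \<gamma> qmin by (simp_all add: r_def)

text \<open>The 11 in the rate comes from here: \<open>2 * r + r\<^sup>2\<close> is at most
  \<open>23 / 121 * qmin\<close>, just below \<open>qmin / 5\<close>.\<close>

lemma growth: "(1 + r)\<^sup>2 \<le> 1 + qmin / 5"
proof -
  have "r\<^sup>2 \<le> (qmin / 11) * (1 / 11)"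
    unfolding power2_eq_square using r_nonneg r_le_q qmin by (intro mult_mono) auto
  then show ?thesis using r_le_q qmin by (simp add: power2_sum)
qed

lemma A_choice_eq: "A_choice L \<gamma> qmin k = A1 * max (real k) ((1 + r) ^ (k - 1))"
  by (simp add: A_choice_def A1_def r_def)

text \<open>The denominators increase, which only helps, so comparing successive increments is
  enough.\<close>

lemma condition1I:
  assumes pos: "positive_steps a" and le: "a (Suc n) \<le> (1 + r) * a n" and n: "n \<ge> 1"
  shows "(a (Suc n))\<^sup>2 / (stepsum a (Suc n) * \<gamma> + 1) \<le> (1 + qmin / 5) * ((a n)\<^sup>2 / (stepsum a n * \<gamma> + 1))"
proof -
  have a: "0 < a (Suc n)" "0 < a n" using pos n by (auto simp: positive_steps_def)
  have S: "0 \<le> stepsum a n" "stepsum a n \<le> stepsum a (Suc n)"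
    using stepsum_mono_pos[OF pos] by auto
  have "(a (Suc n))\<^sup>2 \<le> ((1 + r) * a n)\<^sup>2" using le a by (intro power_mono) auto
  also have "\<dots> \<le> (1 + qmin / 5) * (a n)\<^sup>2"
    using growth by (simp add: power_mult_distrib mult_right_mono)
  finally have "(a (Suc n))\<^sup>2 / (stepsum a (Suc n) * \<gamma> + 1) \<le> (1 + qmin / 5) * (a n)\<^sup>2 / (stepsum a n * \<gamma> + 1)"
    using S \<gamma> qmin by (intro frac_le) (auto intro!: mult_right_mono add_nonneg_pos simp del: stepsum_Suc)
  then show ?thesis by simp
qed

text \<open>The partial sums are only bounded from below in the second alternative, so that linear,
  geometric and combined steps can share the lemma.\<close>

lemma condition2I:
  assumes pos: "positive_steps a"
    and "a (Suc n) = A1 \<or> n \<ge> 1 \<and> a (Suc n) = A1 * (r * (1 + r) ^ (n - 1)) \<and>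
        A1 * (1 + r) ^ (n - 1) \<le> stepsum a n \<and> A1 * (1 + r) ^ n \<le> stepsum a (Suc n)"
  shows "25 * L\<^sup>2 * (a (Suc n))\<^sup>2 / (stepsum a (Suc n) * \<gamma> + 1) \<le> (stepsum a n * \<gamma> + 1) / 4"
proof -
  have S: "0 \<le> stepsum a n" "0 \<le> stepsum a (Suc n)"
    using stepsum_mono_pos[OF pos] by auto
  have S1: "0 < stepsum a (Suc n) * \<gamma> + 1" "1 \<le> stepsum a (Suc n) * \<gamma> + 1" "1 \<le> stepsum a n * \<gamma> + 1"
    using S \<gamma> by (auto intro: add_nonneg_pos simp del: stepsum_Suc)
  have "25 * L\<^sup>2 * (a (Suc n))\<^sup>2 \<le> (stepsum a n * \<gamma> + 1) * (stepsum a (Suc n) * \<gamma> + 1) / 4"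
    using assms(2)
  proof (elim disjE conjE)
    assume "a (Suc n) = A1"
    then have "25 * L\<^sup>2 * (a (Suc n))\<^sup>2 \<le> 1 * 1 / 4" using A1_sq by simp
    also have "\<dots> \<le> (stepsum a n * \<gamma> + 1) * (stepsum a (Suc n) * \<gamma> + 1) / 4"
      using S1 by (intro divide_right_mono mult_mono) auto
    finally show ?thesis .
  next
    assume n: "n \<ge> 1" and a: "a (Suc n) = A1 * (r * (1 + r) ^ (n - 1))"
      and le: "A1 * (1 + r) ^ (n - 1) \<le> stepsum a n" "A1 * (1 + r) ^ n \<le> stepsum a (Suc n)"
    define E where "E = (1 + r) ^ (n - 1)"
    have E: "0 \<le> E" using r_nonneg by (simp add: E_def)
    \<comment> \<open>The bound \<open>\<gamma> / (10 * L)\<close> rewritten through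
      \<open>A1\<^sup>2 = 1 / (150 * L\<^sup>2)\<close>. The chain below then ends in exactly
      \<open>(A1 * E * \<gamma>)\<^sup>2 / 4\<close>, so 10 is the smallest constant that it
      allows.\<close>
    have r2: "r\<^sup>2 \<le> \<gamma>\<^sup>2 * (25 * A1\<^sup>2) * (6 / 100)"
    proof -
      have "r\<^sup>2 \<le> (\<gamma> / (10 * L))\<^sup>2" using r_le_\<gamma> r_nonneg by (rule power_mono)
      also have "\<dots> = \<gamma>\<^sup>2 / (100 * L\<^sup>2)" by (simp add: power_divide power_mult_distrib)
      also have "\<dots> = \<gamma>\<^sup>2 * (25 * A1\<^sup>2) * (6 / 100)"
      proof -
        have "A1\<^sup>2 = 1 / (150 * L\<^sup>2)" using A1_sq L by (simp add: field_simps)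
        then show ?thesis by (simp add: field_simps)
      qed
      finally show ?thesis .
    qed
    have "25 * L\<^sup>2 * (a (Suc n))\<^sup>2 = 25 * (L\<^sup>2 * A1\<^sup>2) * (r\<^sup>2 * E\<^sup>2)"
      by (simp add: a E_def power_mult_distrib algebra_simps)
    also have "\<dots> = (r\<^sup>2 * E\<^sup>2) / 6" by (simp add: A1_sq)
    also have "\<dots> \<le> (\<gamma>\<^sup>2 * (25 * A1\<^sup>2) * (6 / 100) * E\<^sup>2) / 6"
      using r2 by (intro divide_right_mono mult_right_mono) auto
    also have "\<dots> = (A1 * E * \<gamma>) * (A1 * E * \<gamma>) / 4" by (simp add: power2_eq_square)
    also have "\<dots> \<le> (stepsum a n * \<gamma> + 1) * (stepsum a (Suc n) * \<gamma> + 1) / 4"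
    proof (intro divide_right_mono mult_mono)
      show "A1 * E * \<gamma> \<le> stepsum a n * \<gamma> + 1"
        using le(1) \<gamma> by (intro add_increasing2 mult_right_mono) (auto simp: E_def)
      have "A1 * E \<le> A1 * (1 + r) ^ n"
        unfolding E_def using A1_pos r_nonneg by (intro mult_left_mono power_increasing) auto
      then show "A1 * E * \<gamma> \<le> stepsum a (Suc n) * \<gamma> + 1"
        using le(2) \<gamma> by (intro add_increasing2 mult_right_mono) auto
    qed (use S1 A1_pos \<gamma> E in auto)
    finally show ?thesis .
  qed
  then show ?thesis using S1 by (simp add: pos_divide_le_eq mult.commute del: stepsum_Suc)
qed

lemma step_conditionsI:
  assumes "\<And>n. n \<ge> 1 \<Longrightarrow> (a (Suc n))\<^sup>2 / (stepsum a (Suc n) * \<gamma> + 1)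
      \<le> (1 + qmin / 5) * ((a n)\<^sup>2 / (stepsum a n * \<gamma> + 1))"
    and "\<And>n. 25 * L\<^sup>2 * (a (Suc n))\<^sup>2 / (stepsum a (Suc n) * \<gamma> + 1) \<le> (stepsum a n * \<gamma> + 1) / 4"
  shows "step_conditions L \<gamma> qmin a"
  unfolding step_conditions_def
proof (intro allI impI conjI)
  fix i :: nat assume "2 \<le> i"
  then obtain n where i: "i = Suc (Suc n)" by (metis add_2_eq_Suc le_Suc_ex)
  show "(a i)\<^sup>2 / (stepsum a i * \<gamma> + 1) \<le> (1 + qmin / 5) * ((a (i - 1))\<^sup>2 / (stepsum a (i - 1) * \<gamma> + 1))"
    using assms(1)[of "Suc n"] by (simp add: i)
  show "25 * L\<^sup>2 * (a (i - 1))\<^sup>2 / (stepsum a (i - 1) * \<gamma> + 1) \<le> (stepsum a (i - 2) * \<gamma> + 1) / 4"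
    using assms(2)[of n] by (simp add: i)
qed

section \<open>Linear, geometric and combined step sizes\<close>

definition "linear_steps i = (if i = 0 then 0 else A1)"

lemma stepsum_linear: "stepsum linear_steps k = A1 * real k"
  by (induction k) (simp_all add: linear_steps_def algebra_simps)

lemma admissible_linear: "admissible_steps L \<gamma> qmin linear_steps"
proof -
  have pos: "positive_steps linear_steps"
    using A1_pos by (simp add: positive_steps_def linear_steps_def)
  moreover have "step_conditions L \<gamma> qmin linear_steps"
    using A1_pos r_nonneg
    by (intro step_conditionsI condition1I condition2I pos) (auto simp: linear_steps_def)
  moreover have "step_condition_sup L linear_steps"
    using A1_sq by (simp add: step_condition_sup_def linear_steps_def)
  ultimately show ?thesis by (simp add: admissible_steps_def)
qed

text \<open>The increments of \<open>A1 * (1 + r) ^ (i - 1)\<close>. For \<open>r = 0\<close> they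
  vanish from \<open>i = 2\<close> on, hence the assumption \<open>0 < r\<close> for
  admissibility.\<close>

definition "geometric_steps i = (if i = 0 then 0 else if i = 1 then A1 else A1 * (r * (1 + r) ^ (i - 2)))"

lemma stepsum_geometric: "stepsum geometric_steps (Suc k) = A1 * (1 + r) ^ k"
  by (induction k) (simp_all add: geometric_steps_def algebra_simps)

lemma admissible_geometric:
  assumes "0 < r"
  shows "admissible_steps L \<gamma> qmin geometric_steps"
proof -
  \<comment> \<open>A positive rate forces \<open>\<gamma> > 0\<close>, which makes the condition
    for the supremum vacuous.\<close>
  have "\<gamma> > 0" using assms r_le_\<gamma> L by (metis \<gamma> div_0 less_eq_real_def not_le)
  have pos: "positive_steps geometric_steps"
    using A1_pos assms by (simp add: positive_steps_def geometric_steps_def)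
  moreover have "step_conditions L \<gamma> qmin geometric_steps"
  proof (intro step_conditionsI condition1I condition2I pos)
    fix n :: nat assume "n \<ge> 1"
    then obtain k where n: "n = Suc k" by (cases n) auto
    show "geometric_steps (Suc n) \<le> (1 + r) * geometric_steps n"
      using A1_pos assms by (cases k) (simp_all add: n geometric_steps_def algebra_simps)
  next
    fix n
    show "geometric_steps (Suc n) = A1 \<or> n \<ge> 1 \<and> geometric_steps (Suc n) = A1 * (r * (1 + r) ^ (n - 1)) \<and>
        A1 * (1 + r) ^ (n - 1) \<le> stepsum geometric_steps n \<and> A1 * (1 + r) ^ n \<le> stepsum geometric_steps (Suc n)"
    proof (cases n)
      case (Suc k)
      then show ?thesis
        using stepsum_geometric[of k] stepsum_geometric[of "Suc k"] by (simp add: geometric_steps_def del: stepsum_Suc)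
    qed (simp add: geometric_steps_def)
  qed
  ultimately show ?thesis using \<open>\<gamma> > 0\<close> by (simp add: admissible_steps_def)
qed

text \<open>Taking the larger of the two increments dominates both sequences of partial sums.\<close>

definition "max_steps i = max (linear_steps i) (geometric_steps i)"

lemma stepsum_max_ge: "stepsum linear_steps k \<le> stepsum max_steps k" "stepsum geometric_steps k \<le> stepsum max_steps k"
  by (auto simp: stepsum_def max_steps_def intro!: sum_mono)

lemma admissible_max: "admissible_steps L \<gamma> qmin max_steps"
proof -
  have pos: "positive_steps max_steps"
    using A1_pos by (auto simp: positive_steps_def max_steps_def linear_steps_def geometric_steps_def less_max_iff_disj)
  moreover have "step_conditions L \<gamma> qmin max_steps"
  proof (intro step_conditionsI condition1I condition2I pos)
    fix n :: nat assume "n \<ge> 1"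
    then obtain k where n: "n = Suc k" by (cases n) auto
    have "linear_steps (Suc n) \<le> (1 + r) * linear_steps n"
      using A1_pos r_nonneg by (simp add: linear_steps_def n)
    moreover have "geometric_steps (Suc n) \<le> (1 + r) * geometric_steps n"
      using A1_pos r_nonneg by (cases k) (simp_all add: n geometric_steps_def algebra_simps)
    moreover have "(1 + r) * linear_steps n \<le> (1 + r) * max_steps n" "(1 + r) * geometric_steps n \<le> (1 + r) * max_steps n"
      using r_nonneg by (auto simp: max_steps_def intro!: mult_left_mono)
    ultimately show "max_steps (Suc n) \<le> (1 + r) * max_steps n" by (simp add: max_steps_def[of "Suc n"])
  next
    fix n
    show "max_steps (Suc n) = A1 \<or> n \<ge> 1 \<and> max_steps (Suc n) = A1 * (r * (1 + r) ^ (n - 1)) \<and>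
        A1 * (1 + r) ^ (n - 1) \<le> stepsum max_steps n \<and> A1 * (1 + r) ^ n \<le> stepsum max_steps (Suc n)"
    proof (cases n)
      case 0
      then show ?thesis by (simp add: max_steps_def linear_steps_def geometric_steps_def)
    next
      case (Suc k)
      then show ?thesis
        using stepsum_geometric[of k] stepsum_geometric[of "Suc k"] stepsum_max_ge(2)[of n] stepsum_max_ge(2)[of "Suc n"]
        by (auto simp add: max_steps_def linear_steps_def geometric_steps_def max_def simp del: stepsum_Suc)
    qed
  qed
  moreover have "step_condition_sup L max_steps" if "\<gamma> = 0"
  proof -
    \<comment> \<open>With rate 0 the geometric increments vanish after the first one, so the
      maximum is the constant \<open>A1\<close>.\<close>
    have "r = 0" using that r_nonneg r_le_\<gamma> by simp
    then have "max_steps = linear_steps"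
      using A1_pos by (auto simp: max_steps_def linear_steps_def geometric_steps_def fun_eq_iff)
    then show ?thesis using A1_sq by (simp add: step_condition_sup_def linear_steps_def)
  qed
  ultimately show ?thesis by (simp add: admissible_steps_def)
qed

lemma A_choice_eq_max:
  assumes "k \<ge> 1"
  shows "A_choice L \<gamma> qmin k = max (stepsum linear_steps k) (stepsum geometric_steps k)"
proof -
  obtain n where k: "k = Suc n" using assms by (cases k) auto
  show ?thesis
    using A1_pos unfolding A_choice_eq stepsum_linear k stepsum_geometric
    by (simp add: max_mult_distrib_left)
qed

lemma A_choice_attained_if_\<gamma>_eq_0:
  assumes "\<gamma> = 0"
  shows "\<exists>a. admissible_steps L \<gamma> qmin a \<and> a 1 = A1_choice L \<and> (\<forall>k\<ge>1. stepsum a k = A_choice L \<gamma> qmin k)"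
proof (intro exI[of _ linear_steps] conjI admissible_linear allI impI)
  fix k :: nat assume "k \<ge> 1"
  have "r = 0" using assms r_nonneg r_le_\<gamma> by simp
  then show "stepsum linear_steps k = A_choice L \<gamma> qmin k"
    using \<open>k \<ge> 1\<close> by (simp add: A_choice_eq stepsum_linear max_def)
qed (simp add: linear_steps_def A1_def)

text \<open>The sequence depends on \<open>k\<close>: it is the one of the two whose partial sum
  realises the maximum at \<open>k\<close>.\<close>

lemma A_choice_attained:
  assumes k: "k \<ge> 1"
  shows "\<exists>a. admissible_steps L \<gamma> qmin a \<and> a 1 = A1_choice L \<and> stepsum a k = A_choice L \<gamma> qmin k"
proof (cases "stepsum geometric_steps k \<le> stepsum linear_steps k")
  case True
  then show ?thesis using A_choice_eq_max[OF k] admissible_linear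
    by (intro exI[of _ linear_steps]) (simp add: linear_steps_def A1_def)
next
  case False
  obtain n where n: "k = Suc n" using k by (cases k) auto
  \<comment> \<open>For \<open>r = 0\<close> the geometric sum is \<open>A1\<close>, which never
    exceeds \<open>A1 * k\<close>.\<close>
  have "r \<noteq> 0"
  proof
    assume "r = 0"
    then show False using False A1_pos unfolding n stepsum_geometric stepsum_linear by simp
  qed
  then have "0 < r" using r_nonneg by simp
  then show ?thesis using A_choice_eq_max[OF k] admissible_geometric False
    by (intro exI[of _ geometric_steps]) (simp add: geometric_steps_def A1_def)
qed

lemma A_choice_dominated:
  "\<exists>a. admissible_steps L \<gamma> qmin a \<and> a 1 = A1_choice L \<and> (\<forall>k\<ge>1. A_choice L \<gamma> qmin k \<le> stepsum a k)"
  using A_choice_eq_max stepsum_max_ge admissible_max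
  by (intro exI[of _ max_steps]) (auto simp: max_steps_def linear_steps_def geometric_steps_def A1_def)

end

section \<open>The composite variational inequality\<close>

locale composite_vi = finite_dim_norm N
  for N :: "'a::euclidean_space \<Rightarrow> real" +
  fixes F :: "'a \<Rightarrow> 'a" and Fs :: "'m::finite \<Rightarrow> 'a \<Rightarrow> 'a" and g :: "'a \<Rightarrow> ereal"
    and \<psi> :: "'a \<Rightarrow> real" and \<gamma> :: real and p q :: "'m \<Rightarrow> real" and x0 :: 'a
  assumes monotone: "monotone_operator F" and lipschitz: "lipschitz_operator N F"
    and \<gamma>_nonneg: "0 \<le> \<gamma>"
    and proper: "proper g" and g_convex: "strongly_convex_ext N \<gamma> g"
    and F_sum: "\<And>x. x \<in> edom g \<Longrightarrow> F x = (\<Sum>l\<in>UNIV. Fs l x)"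
    and x0: "x0 \<in> edom g"
    and \<psi>_convex: "strongly_convex_on (edom g) N 1 \<psi>" and \<psi>_diff: "\<psi> differentiable (at x0)"
    and p: "pos_simplex p" and q: "pos_simplex q"
    and Lsq_pos: "0 < Lsq N Fs g p q" and Lsq_finite: "Lsq N Fs g p q < \<infinity>"
begin

abbreviation "E \<equiv> edom g"
abbreviation "D u \<equiv> bregman \<psi> u x0"
abbreviation "L \<equiv> Lpq N Fs g p q"

definition "gr x = real_of_ereal (g x)"

lemma p_pos: "0 < p l" and p_sum: "(\<Sum>l\<in>UNIV. p l) = 1"
  and q_pos: "0 < q l" and q_sum: "(\<Sum>l\<in>UNIV. q l) = 1"
  using p q by (auto simp: pos_simplex_def)

lemma q_le_1: "q l \<le> 1"
  using member_le_sum[of l UNIV q] q_sum q_pos by (auto simp: less_imp_le)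

lemma g_eq: "x \<in> E \<Longrightarrow> g x = ereal (gr x)"
  using proper by (cases "g x") (auto simp: edom_def proper_def gr_def)

lemma gr_convex: "strongly_convex_on E N \<gamma> gr"
proof -
  have "(1 - t) *\<^sub>R x + t *\<^sub>R y \<in> E \<and>
      gr ((1 - t) *\<^sub>R x + t *\<^sub>R y) + \<gamma> / 2 * t * (1 - t) * (N (x - y))\<^sup>2 \<le> (1 - t) * gr x + t * gr y"
    if xy: "x \<in> E" "y \<in> E" and t: "t \<in> {0<..<1}" for x y t
  proof -
    have le: "g ((1 - t) *\<^sub>R x + t *\<^sub>R y) + ereal (\<gamma> / 2 * t * (1 - t) * (N (x - y))\<^sup>2)
        \<le> ereal ((1 - t) * gr x + t * gr y)"
      using g_convex[unfolded strongly_convex_ext_def, rule_format, OF t, of x y] xy by (simp add: g_eq)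
    then have "(1 - t) *\<^sub>R x + t *\<^sub>R y \<in> E"
      unfolding edom_def by (cases "g ((1 - t) *\<^sub>R x + t *\<^sub>R y)") auto
    with le show ?thesis by (simp add: g_eq)
  qed
  moreover have "convex E"
    using \<psi>_convex by (simp add: strongly_convex_on_def)
  ultimately show ?thesis by (simp add: strongly_convex_on_def)
qed

lemma convex_E: "convex E"
  using gr_convex by (simp add: strongly_convex_on_def)

lemma convex_on_gr: "convex_on E gr"
proof (rule convex_onI[OF _ convex_E])
  fix t x y assume t: "0 < (t::real)" "t < 1" and xy: "x \<in> E" "y \<in> E"
  have "gr ((1 - t) *\<^sub>R x + t *\<^sub>R y) + \<gamma> / 2 * t * (1 - t) * (N (x - y))\<^sup>2 \<le> (1 - t) * gr x + t * gr y"
    using gr_convex t xy unfolding strongly_convex_on_def by auto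
  moreover have "0 \<le> \<gamma> / 2 * t * (1 - t) * (N (x - y))\<^sup>2" using t \<gamma>_nonneg by simp
  ultimately show "gr ((1 - t) *\<^sub>R x + t *\<^sub>R y) \<le> (1 - t) * gr x + t * gr y" by linarith
qed

lemma D_lower: "u \<in> E \<Longrightarrow> (N (u - x0))\<^sup>2 / 2 \<le> D u"
  by (rule bregman_lower_bound[OF \<psi>_convex \<psi>_diff x0])

lemma D_x0 [simp]: "D x0 = 0"
  by (simp add: bregman_def)

text \<open>Origin of \<open>A * \<gamma> + 1\<close>: \<open>A * gr\<close> contributes
  \<open>A * \<gamma>\<close>, and \<open>D\<close> contributes 1 because it differs from
  \<open>\<psi>\<close> by an affine function.\<close>

lemma objective_strongly_convex:
  assumes "0 \<le> A"
  shows "strongly_convex_on E N (A * \<gamma> + 1) (\<lambda>u. z \<bullet> u + A * gr u + D u)"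
  unfolding strongly_convex_on_def
proof (intro conjI convex_E ballI)
  fix x y t assume xy: "x \<in> E" "y \<in> E" and t: "t \<in> {0<..<(1::real)}"
  let ?m = "(1 - t) *\<^sub>R x + t *\<^sub>R y"
  have "gr ?m + \<gamma> / 2 * t * (1 - t) * (N (x - y))\<^sup>2 \<le> (1 - t) * gr x + t * gr y"
    using gr_convex t xy unfolding strongly_convex_on_def by blast
  then have "A * (gr ?m + \<gamma> / 2 * t * (1 - t) * (N (x - y))\<^sup>2) \<le> A * ((1 - t) * gr x + t * gr y)"
    using assms by (rule mult_left_mono)
  moreover have "\<psi> ?m + 1 / 2 * t * (1 - t) * (N (x - y))\<^sup>2 \<le> (1 - t) * \<psi> x + t * \<psi> y"
    using \<psi>_convex t xy unfolding strongly_convex_on_def by blast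
  ultimately show "z \<bullet> ?m + A * gr ?m + D ?m + (A * \<gamma> + 1) / 2 * t * (1 - t) * (N (x - y))\<^sup>2
      \<le> (1 - t) * (z \<bullet> x + A * gr x + D x) + t * (z \<bullet> y + A * gr y + D y)"
    unfolding bregman_def by (simp add: algebra_simps inner_add_right add_divide_distrib)
qed

lemma D_convex: "strongly_convex_on E N 1 D"
  using objective_strongly_convex[of 0 0] by simp

text \<open>Comparison with \<open>x0\<close>, where the objective is finite. The strict bound
  \<open>0 < A\<close> matters since \<open>0 * \<infinity> = 0\<close> in
  \<open>ereal\<close>.\<close>

lemma arg_min_in_E:
  assumes "is_arg_min (\<lambda>u. ereal (z \<bullet> u) + ereal A * g u + ereal (D u)) (\<lambda>_. True) x" and "0 < A"
  shows "x \<in> E"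
proof (rule ccontr)
  assume "x \<notin> E"
  then have "g x = \<infinity>" by (simp add: edom_def)
  then have "ereal (z \<bullet> x0) + ereal A * g x0 + ereal (D x0) < ereal (z \<bullet> x) + ereal A * g x + ereal (D x)"
    using assms(2) by (simp add: g_eq[OF x0])
  then show False using assms(1) unfolding is_arg_min_def by blast
qed

lemma arg_min_strong:
  assumes am: "is_arg_min (\<lambda>u. ereal (z \<bullet> u) + ereal A * g u + ereal (D u)) (\<lambda>_. True) x"
    and A: "0 < A" and u: "u \<in> E"
  shows "z \<bullet> x + A * gr x + D x + (A * \<gamma> + 1) / 2 * (N (u - x))\<^sup>2 \<le> z \<bullet> u + A * gr u + D u"
proof (rule strongly_convex_on_minimum[OF objective_strongly_convex])
  show x: "x \<in> E" by (rule arg_min_in_E[OF am A])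
  fix v assume v: "v \<in> E"
  have "\<not> ereal (z \<bullet> v) + ereal A * g v + ereal (D v) < ereal (z \<bullet> x) + ereal A * g x + ereal (D x)"
    using am by (auto simp: is_arg_min_def)
  then show "z \<bullet> x + A * gr x + D x \<le> z \<bullet> v + A * gr v + D v"
    by (simp add: g_eq x v)
qed (use A u in auto)

text \<open>Each minimiser competes in the growth inequality of the other, and the two inequalities
  are added. This is what makes the iterates functions of the draws.\<close>

lemma arg_min_unique:
  assumes "is_arg_min (\<lambda>u. ereal (z \<bullet> u) + ereal A * g u + ereal (D u)) (\<lambda>_. True) x"
    and "is_arg_min (\<lambda>u. ereal (z \<bullet> u) + ereal A * g u + ereal (D u)) (\<lambda>_. True) y"
    and A: "0 < A"
  shows "x = y"
proof -
  have "(A * \<gamma> + 1) / 2 * (N (x - y))\<^sup>2 \<le> 0"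
    using arg_min_strong[OF assms(1) A arg_min_in_E[OF assms(2) A]]
      arg_min_strong[OF assms(2) A arg_min_in_E[OF assms(1) A]]
    by (simp add: N_minus_commute[of x y])
  moreover have "0 < (A * \<gamma> + 1) / 2" using A \<gamma>_nonneg by (simp add: add_nonneg_pos)
  ultimately have "(N (x - y))\<^sup>2 \<le> 0" by (simp add: mult_le_0_iff)
  then show ?thesis by simp
qed

lemma L_sq: "ereal (L\<^sup>2) = Lsq N Fs g p q" and L_pos: "0 < L"
  using Lsq_pos Lsq_finite by (cases "Lsq N Fs g p q"; simp add: Lpq_def)+

lemma Fs_lipschitz:
  assumes "x \<in> E" "y \<in> E"
  shows "(\<Sum>l\<in>UNIV. 1 / (p l * (q l)\<^sup>2) * (Dn (Fs l x - Fs l y))\<^sup>2) \<le> L\<^sup>2 * (N (x - y))\<^sup>2"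
proof (cases "x = y")
  case False
  then have pos: "0 < N (x - y)" using N_nonneg[of "x - y"] N_eq_0[of "x - y"] by (simp add: less_le)
  have "ereal ((\<Sum>l\<in>UNIV. 1 / (p l * (q l)\<^sup>2) * (Dn (Fs l x - Fs l y))\<^sup>2) / (N (x - y))\<^sup>2) \<le> ereal (L\<^sup>2)"
    unfolding L_sq Lsq_def by (rule SUP_upper2[of "(x, y)"]) (use assms False in auto)
  then show ?thesis using pos_divide_le_eq[OF zero_less_power[OF pos, of 2]] by simp
qed simp

lemma Gap_eq:
  assumes "xh \<in> E" "u \<in> E"
  shows "Gap F g xh u = ereal (F u \<bullet> (xh - u) - gr u + gr xh)"
  using assms by (simp add: Gap_def g_eq)

text \<open>A solution in the sense of Minty is one in the sense of Stampacchia, since \<open>F\<close> is continuous.\<close>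

lemma Gap_solution_nonneg:
  assumes vi: "vi_solution F g xs" and xh: "xh \<in> E"
  shows "0 \<le> real_of_ereal (Gap F g xh xs)"
proof -
  have xs: "xs \<in> E" using vi by (simp add: vi_solution_def)
  define v where "v = xh - xs"
  obtain C where C: "\<And>x y. Dn (F x - F y) \<le> C * N (x - y)"
    using lipschitz by (auto simp: lipschitz_operator_def)
  \<comment> \<open>Test the inequality at parameter \<open>t\<close> on the segment from
    \<open>xs\<close> to \<open>xh\<close> and divide by \<open>t\<close>; the Lipschitz bound
    replaces \<open>F m\<close> by \<open>F xs\<close> at a cost of order \<open>t\<close>.\<close>
  have "0 \<le> F xs \<bullet> v + gr xh - gr xs + t * (C * (N v)\<^sup>2)" if t: "t \<in> {0<..<1}" for t
  proof -
    define m where "m = (1 - t) *\<^sub>R xs + t *\<^sub>R xh"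
    have m: "m \<in> E" unfolding m_def using convex_E xs xh t by (auto simp: convex_alt)
    have mv: "m - xs = t *\<^sub>R v" by (simp add: m_def v_def algebra_simps)
    have "0 \<le> F m \<bullet> (m - xs) + gr m - gr xs"
      using vi[unfolded vi_solution_def, THEN conjunct2, rule_format, of m] by (simp add: g_eq m xs)
    moreover have "gr m \<le> (1 - t) * gr xs + t * gr xh"
      unfolding m_def using convex_onD[OF convex_on_gr, of t] t xs xh by auto
    ultimately have "0 \<le> t * (F m \<bullet> v + gr xh - gr xs)"
      by (simp add: mv algebra_simps)
    then have "0 \<le> F m \<bullet> v + gr xh - gr xs" using t by (simp add: zero_le_mult_iff)
    moreover have "(F m - F xs) \<bullet> v \<le> t * (C * (N v)\<^sup>2)"
    proof -
      have "(F m - F xs) \<bullet> v \<le> Dn (F m - F xs) * N v" by (rule inner_le_dual_norm)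
      also have "\<dots> \<le> (C * N (m - xs)) * N v" by (intro mult_right_mono C) simp
      also have "\<dots> = t * (C * (N v)\<^sup>2)" using t by (simp add: mv N_scaleR power2_eq_square)
      finally show ?thesis .
    qed
    ultimately show ?thesis by (simp add: inner_diff_left)
  qed
  then have ev: "eventually (\<lambda>t. 0 \<le> F xs \<bullet> v + gr xh - gr xs + t * (C * (N v)\<^sup>2)) (at_right (0::real))"
    unfolding eventually_at_right_field by (intro exI[of _ 1]) auto
  have "((\<lambda>t. F xs \<bullet> v + gr xh - gr xs + t * (C * (N v)\<^sup>2)) \<longlongrightarrow> F xs \<bullet> v + gr xh - gr xs + 0 * (C * (N v)\<^sup>2)) (at_right 0)"
    by (intro tendsto_intros)
  from tendsto_lowerbound[OF this ev] show ?thesis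
    by (simp add: Gap_eq xs xh v_def)
qed

section \<open>The Fenchel conjugate of the Bregman divergence on the domain of
  \<open>g\<close>\<close>

definition "D_conj s = (SUP u\<in>E. s \<bullet> u - D u)"

text \<open>The quadratic growth of \<open>D\<close> dominates every linear functional, so the
  conjugate is finite everywhere even on an unbounded domain.\<close>

lemma D_conj_bdd: "bdd_above ((\<lambda>u. s \<bullet> u - D u) ` E)"
proof (rule bdd_aboveI2)
  fix u assume u: "u \<in> E"
  have "0 \<le> (Dn s - N (u - x0))\<^sup>2" by simp
  then have "Dn s * N (u - x0) \<le> (Dn s)\<^sup>2 / 2 + (N (u - x0))\<^sup>2 / 2"
    by (simp add: power2_diff)
  then show "s \<bullet> u - D u \<le> s \<bullet> x0 + (Dn s)\<^sup>2 / 2"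
    using inner_le_dual_norm[of s "u - x0"] D_lower[OF u] by (simp add: inner_diff_right)
qed

lemma fenchel: "u \<in> E \<Longrightarrow> s \<bullet> u \<le> D_conj s + D u"
  using cSUP_upper[OF _ D_conj_bdd, of u s] by (simp add: D_conj_def)

lemma D_conj_0: "D_conj 0 = 0"
proof (rule antisym)
  have "0 \<le> D u" if "u \<in> E" for u using D_lower[OF that] by (rule order_trans[rotated]) simp
  then show "D_conj 0 \<le> 0" unfolding D_conj_def using x0 by (intro cSUP_least) auto
  show "0 \<le> D_conj 0" using fenchel[OF x0, of 0] by simp
qed

text \<open>Some point satisfying the smoothness inequality at \<open>s\<close>; it may lie outside
  \<open>E\<close>. It is a function of \<open>s\<close> alone, so its value at a random
  \<open>s\<close> uses no further randomness.\<close>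

definition "D_conj_grad s = (SOME u. \<forall>d. D_conj (s + d) \<le> D_conj s + d \<bullet> u + (Dn d)\<^sup>2 / 2)"

lemma D_conj_smooth: "D_conj (s + d) \<le> D_conj s + d \<bullet> D_conj_grad s + (Dn d)\<^sup>2 / 2"
proof -
  have "\<exists>u. \<forall>d. D_conj (s + d) \<le> D_conj s + d \<bullet> u + (Dn d)\<^sup>2 / 2"
    unfolding D_conj_def using conjugate_smooth[OF D_convex _ D_conj_bdd] x0 by blast
  from someI_ex[OF this] show ?thesis unfolding D_conj_grad_def by blast
qed

end

section \<open>Functions of finitely many independent draws\<close>

context prob_space
begin

text \<open>Takes the place of measurability with respect to the sigma-algebra of the draws in
  \<open>A\<close>. The target type carries no structure, so arbitrary functions, also those
  obtained by choice, can be applied afterwards.\<close>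

definition determined :: "('i \<Rightarrow> 'a \<Rightarrow> 'b) \<Rightarrow> 'i set \<Rightarrow> ('a \<Rightarrow> 'c) \<Rightarrow> bool" where
  "determined Z A f \<longleftrightarrow> (\<forall>\<omega>\<in>space M. \<forall>\<omega>'\<in>space M. (\<forall>s\<in>A. Z s \<omega> = Z s \<omega>') \<longrightarrow> f \<omega> = f \<omega>')"

lemma determined_factor:
  assumes "determined Z A f"
  obtains h where "\<And>\<omega>. \<omega> \<in> space M \<Longrightarrow> f \<omega> = h (restrict (\<lambda>s. Z s \<omega>) A)"
proof
  fix \<omega> assume \<omega>: "\<omega> \<in> space M"
  let ?P = "\<lambda>\<omega>'. \<omega>' \<in> space M \<and> restrict (\<lambda>s. Z s \<omega>') A = restrict (\<lambda>s. Z s \<omega>) A"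
  \<comment> \<open>A representative outcome with the same draws; \<open>f\<close> cannot
    distinguish it from \<open>\<omega>\<close>.\<close>
  have "?P (SOME \<omega>'. ?P \<omega>')" using \<omega> by (intro someI[of ?P \<omega>]) simp
  then have *: "(SOME \<omega>'. ?P \<omega>') \<in> space M" "restrict (\<lambda>s. Z s (SOME \<omega>'. ?P \<omega>')) A = restrict (\<lambda>s. Z s \<omega>) A" by auto
  have "Z s (SOME \<omega>'. ?P \<omega>') = Z s \<omega>" if "s \<in> A" for s
    using fun_cong[OF *(2), of s] that by simp
  then have "f (SOME \<omega>'. ?P \<omega>') = f \<omega>"
    using assms \<omega> *(1) unfolding determined_def by blast
  then show "f \<omega> = (\<lambda>r. f (SOME \<omega>'. \<omega>' \<in> space M \<and> restrict (\<lambda>s. Z s \<omega>') A = r)) (restrict (\<lambda>s. Z s \<omega>) A)"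
    by simp
qed

lemma determined_comp: "determined Z A f \<Longrightarrow> determined Z A (\<lambda>\<omega>. h (f \<omega>))"
  unfolding determined_def by (intro ballI impI arg_cong[where f = h]) blast

lemma determined_comp2:
  "determined Z A f \<Longrightarrow> determined Z A f' \<Longrightarrow> determined Z A (\<lambda>\<omega>. h (f \<omega>) (f' \<omega>))"
  unfolding determined_def by (intro ballI impI arg_cong2[where f = h]) blast+

lemma determined_coordinate: "s \<in> A \<Longrightarrow> determined Z A (Z s)"
  by (simp add: determined_def)

lemma determined_mono: "determined Z A f \<Longrightarrow> A \<subseteq> B \<Longrightarrow> determined Z B f"
  unfolding determined_def by blast

context
  fixes Z :: "'i \<Rightarrow> 'a \<Rightarrow> 'b::finite" and I :: "'i set"
  assumes indep: "indep_vars (\<lambda>_. count_space UNIV) Z I" and fin: "finite I"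
begin

lemma draws_measurable: "s \<in> I \<Longrightarrow> Z s \<in> measurable M (count_space UNIV)"
  using indep by (auto simp: indep_vars_def)

text \<open>Finitely many draws from a finite type have a discrete product space, on which every
  function is measurable.\<close>

lemma PiM_draws: "A \<subseteq> I \<Longrightarrow> PiM A (\<lambda>_. count_space (UNIV :: 'b set)) = count_space (PiE A (\<lambda>_. UNIV))"
  using fin by (intro count_space_PiM_finite) (auto intro: finite_subset countable_finite)

lemma determined_measurable:
  assumes "determined Z A f" "A \<subseteq> I"
  shows "f \<in> measurable M (count_space UNIV)"
proof -
  obtain h where h: "\<And>\<omega>. \<omega> \<in> space M \<Longrightarrow> f \<omega> = h (restrict (\<lambda>s. Z s \<omega>) A)"
    using determined_factor[OF assms(1)] by metis
  have "(\<lambda>\<omega>. restrict (\<lambda>s. Z s \<omega>) A) \<in> measurable M (PiM A (\<lambda>_. count_space UNIV))"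
    using assms(2) draws_measurable by (intro measurable_restrict) auto
  then have "(\<lambda>\<omega>. h (restrict (\<lambda>s. Z s \<omega>) A)) \<in> measurable M (count_space UNIV)"
    unfolding PiM_draws[OF assms(2)] by (rule measurable_compose) simp
  then show ?thesis using h by (simp cong: measurable_cong)
qed

lemma determined_integrable:
  fixes f :: "'a \<Rightarrow> real"
  assumes "determined Z A f" "A \<subseteq> I"
  shows "integrable M f"
proof -
  obtain h where h: "\<And>\<omega>. \<omega> \<in> space M \<Longrightarrow> f \<omega> = h (restrict (\<lambda>s. Z s \<omega>) A)"
    using determined_factor[OF assms(1)] by metis
  have fin: "finite (h ` (PiE A (\<lambda>_. UNIV)))"
    using fin assms(2) by (intro finite_imageI finite_PiE) (auto intro: finite_subset)
  have "f \<in> borel_measurable M"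
    using determined_measurable[OF assms] by (rule measurable_compose) simp
  moreover have "norm (f \<omega>) \<le> (\<Sum>y\<in>h ` (PiE A (\<lambda>_. UNIV)). \<bar>y\<bar>)" if "\<omega> \<in> space M" for \<omega>
    using fin unfolding h[OF that] real_norm_def by (intro member_le_sum) auto
  then have "AE \<omega> in M. norm (f \<omega>) \<le> (\<Sum>y\<in>h ` (PiE A (\<lambda>_. UNIV)). \<bar>y\<bar>)" by (rule AE_I2)
  ultimately show ?thesis by (intro integrable_const_bound)
qed

text \<open>Substitute for conditioning on the past: split according to the value \<open>l\<close>
  of the fresh draw; on each piece the indicator is independent of \<open>G l\<close>, so the
  expectation factorises.\<close>

lemma expectation_independent_draw:
  fixes G :: "'b \<Rightarrow> 'a \<Rightarrow> real"
  assumes G: "\<And>l. determined Z A (G l)" and A: "A \<subseteq> I" and s: "s \<in> I" "s \<notin> A"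
  shows "expectation (\<lambda>\<omega>. G (Z s \<omega>) \<omega>) = (\<Sum>l\<in>UNIV. measure M {\<omega>\<in>space M. Z s \<omega> = l} * expectation (G l))"
proof -
  have ind: "indep_var (PiM {s} (\<lambda>_. count_space UNIV)) (\<lambda>\<omega>. restrict (\<lambda>i. Z i \<omega>) {s})
      (PiM A (\<lambda>_. count_space UNIV)) (\<lambda>\<omega>. restrict (\<lambda>i. Z i \<omega>) A)"
    using indep A s by (intro indep_var_restrict) auto
  have prod: "expectation (\<lambda>\<omega>. of_bool (Z s \<omega> = l) * G l \<omega>) = measure M {\<omega>\<in>space M. Z s \<omega> = l} * expectation (G l)" for l
  proof -
    obtain h where h: "\<And>\<omega>. \<omega> \<in> space M \<Longrightarrow> G l \<omega> = h (restrict (\<lambda>s. Z s \<omega>) A)"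
      using determined_factor[OF G] by metis
    have "indep_var borel ((\<lambda>r. of_bool (r s = l) :: real) \<circ> (\<lambda>\<omega>. restrict (\<lambda>i. Z i \<omega>) {s}))
        borel (h \<circ> (\<lambda>\<omega>. restrict (\<lambda>i. Z i \<omega>) A))"
      by (rule indep_var_compose[OF ind]) (use A s PiM_draws in \<open>auto simp: PiM_draws\<close>)
    then have iv: "indep_var borel (\<lambda>\<omega>. of_bool (Z s \<omega> = l) :: real) borel (\<lambda>\<omega>. h (restrict (\<lambda>i. Z i \<omega>) A))"
      by (simp add: comp_def)
    have int1: "integrable M (\<lambda>\<omega>. of_bool (Z s \<omega> = l) :: real)"
      by (rule determined_integrable[of "{s}"]) (use s in \<open>auto simp: determined_def\<close>)
    have int2: "integrable M (\<lambda>\<omega>. h (restrict (\<lambda>i. Z i \<omega>) A))"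
      by (rule determined_integrable[OF _ A]) (auto simp: determined_def intro!: arg_cong[of _ _ h] restrict_ext)
    have "expectation (\<lambda>\<omega>. of_bool (Z s \<omega> = l) * G l \<omega>) = expectation (\<lambda>\<omega>. of_bool (Z s \<omega> = l) * h (restrict (\<lambda>i. Z i \<omega>) A))"
      by (intro Bochner_Integration.integral_cong) (auto simp: h)
    also have "\<dots> = expectation (\<lambda>\<omega>. of_bool (Z s \<omega> = l)) * expectation (\<lambda>\<omega>. h (restrict (\<lambda>i. Z i \<omega>) A))"
      by (rule indep_var_lebesgue_integral[OF iv int1 int2])
    also have "expectation (\<lambda>\<omega>. of_bool (Z s \<omega> = l)) = measure M {\<omega>\<in>space M. Z s \<omega> = l}"
    proof -
      have "{\<omega>\<in>space M. Z s \<omega> = l} \<in> sets M"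
        using draws_measurable[OF s(1)] by (simp add: measurable_count_space_eq2_countable vimage_def Int_def conj_commute)
      then have "expectation (indicator {\<omega>\<in>space M. Z s \<omega> = l}) = measure M {\<omega>\<in>space M. Z s \<omega> = l}"
        by simp
      moreover have "expectation (\<lambda>\<omega>. of_bool (Z s \<omega> = l)) = expectation (indicator {\<omega>\<in>space M. Z s \<omega> = l})"
        by (intro Bochner_Integration.integral_cong) (auto simp: indicator_def)
      ultimately show ?thesis by (rule trans[rotated])
    qed
    also have "expectation (\<lambda>\<omega>. h (restrict (\<lambda>i. Z i \<omega>) A)) = expectation (G l)"
      by (intro Bochner_Integration.integral_cong) (auto simp: h)
    finally show ?thesis .
  qed
  have int: "integrable M (\<lambda>\<omega>. of_bool (Z s \<omega> = l) * G l \<omega>)" for l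
  proof (rule determined_integrable)
    show "determined Z (insert s A) (\<lambda>\<omega>. of_bool (Z s \<omega> = l) * G l \<omega>)"
      by (intro determined_comp2[where h = "\<lambda>i y. of_bool (i = l) * y"] determined_coordinate insertI1
          determined_mono[OF G subset_insertI])
    show "insert s A \<subseteq> I" using A s(1) by simp
  qed
  have "expectation (\<lambda>\<omega>. G (Z s \<omega>) \<omega>) = expectation (\<lambda>\<omega>. \<Sum>l\<in>UNIV. of_bool (Z s \<omega> = l) * G l \<omega>)"
  proof (rule arg_cong[where f = expectation], rule ext)
    fix \<omega>
    have "(\<Sum>l\<in>UNIV. of_bool (Z s \<omega> = l) * G l \<omega>) = (\<Sum>l\<in>UNIV. if l = Z s \<omega> then G l \<omega> else 0)"
      by (rule sum.cong) auto
    then show "G (Z s \<omega>) \<omega> = (\<Sum>l\<in>UNIV. of_bool (Z s \<omega> = l) * G l \<omega>)" by simp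
  qed
  also have "\<dots> = (\<Sum>l\<in>UNIV. expectation (\<lambda>\<omega>. of_bool (Z s \<omega> = l) * G l \<omega>))"
    by (rule Bochner_Integration.integral_sum) (rule int)
  finally show ?thesis by (simp only: prod)
qed

end

end

section \<open>The randomised extrapolation method\<close>

text \<open>The auxiliary sequences are fixed as functions of the outcome, without measurability
  assumptions. Recursions are stated for \<open>Suc n\<close>; the truncated index
  \<open>n - 1\<close> at \<open>n = 0\<close> sits behind the factor \<open>a 0 = 0\<close>. Of
  \<open>qm\<close> only the lower bound for all \<open>q l\<close> is recorded.\<close>

locale rem_process = composite_vi N F Fs g \<psi> \<gamma> p q x0 + prob_space M
  for N :: "'a::euclidean_space \<Rightarrow> real" and F and Fs :: "'m::finite \<Rightarrow> 'a \<Rightarrow> 'a" and g \<psi> \<gamma> p q x0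
    and M :: "'w measure" +
  fixes a :: "nat \<Rightarrow> real" and qm :: real and K :: nat and J J' :: "nat \<Rightarrow> 'w \<Rightarrow> 'm"
    and x :: "nat \<Rightarrow> 'w \<Rightarrow> 'a" and Ft :: "nat \<Rightarrow> 'w \<Rightarrow> 'm \<Rightarrow> 'a" and Fh z :: "nat \<Rightarrow> 'w \<Rightarrow> 'a"
  assumes pos: "positive_steps a" and steps: "step_conditions L \<gamma> qm a" and qm: "\<And>l. qm \<le> q l"
    and indep: "indep_vars (\<lambda>_. count_space UNIV) (case_sum J J') ({1..K} <+> {1..K})"
    and J_prob: "\<And>k l. k \<in> {1..K} \<Longrightarrow> measure M {\<omega>\<in>space M. J k \<omega> = l} = p l"
    and J'_prob: "\<And>k l. k \<in> {1..K} \<Longrightarrow> measure M {\<omega>\<in>space M. J' k \<omega> = l} = q l"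
    and x_0: "\<And>\<omega>. \<omega> \<in> space M \<Longrightarrow> x 0 \<omega> = x0"
    and z_0: "\<And>\<omega>. \<omega> \<in> space M \<Longrightarrow> z 0 \<omega> = 0"
    and Ft_0: "\<And>\<omega> l. \<omega> \<in> space M \<Longrightarrow> Ft 0 \<omega> l = Fs l x0"
    and Fh_step: "\<And>\<omega> n. \<omega> \<in> space M \<Longrightarrow> n < K \<Longrightarrow>
      Fh (Suc n) \<omega> = (\<Sum>l\<in>UNIV. Ft n \<omega> l)
        + (a n / (a (Suc n) * p (J (Suc n) \<omega>))) *\<^sub>R (Fs (J (Suc n) \<omega>) (x n \<omega>) - Ft (n - 1) \<omega> (J (Suc n) \<omega>))"
    and z_step: "\<And>\<omega> n. \<omega> \<in> space M \<Longrightarrow> n < K \<Longrightarrow> z (Suc n) \<omega> = z n \<omega> + a (Suc n) *\<^sub>R Fh (Suc n) \<omega>"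
    and x_step: "\<And>\<omega> n. \<omega> \<in> space M \<Longrightarrow> n < K \<Longrightarrow>
      is_arg_min (\<lambda>u. ereal (z (Suc n) \<omega> \<bullet> u) + ereal (stepsum a (Suc n)) * g u + ereal (D u))
        (\<lambda>_. True) (x (Suc n) \<omega>)"
    and Ft_step: "\<And>\<omega> n l. \<omega> \<in> space M \<Longrightarrow> n < K \<Longrightarrow>
      Ft (Suc n) \<omega> l = (if l = J' (Suc n) \<omega> then Fs l (x (Suc n) \<omega>) else Ft n \<omega> l)"
begin

abbreviation "A \<equiv> stepsum a"
abbreviation "Z \<equiv> case_sum J J'"

text \<open>\<open>e n\<close> is the amount by which the stale operator values miss \<open>F\<close> at step \<open>n\<close>, and \<open>eh n\<close> the
  correction that the algorithm applies for it in step \<open>n + 1\<close>, an unbiased estimate of \<open>e n\<close>.\<close>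

definition "e n \<omega> = a n *\<^sub>R (F (x n \<omega>) - (\<Sum>l\<in>UNIV. Ft (n - 1) \<omega> l))"

text \<open>The correction if index \<open>l\<close> were drawn. With \<open>l\<close> free it
  depends on the past only; the fresh draw enters when \<open>eh\<close> substitutes it.\<close>

definition "es l n \<omega> = (a n / p l) *\<^sub>R (Fs l (x n \<omega>) - Ft (n - 1) \<omega> l)"

definition "eh n \<omega> = es (J (Suc n) \<omega>) n \<omega>"

definition "T n l \<omega> = (Dn (Fs l (x n \<omega>) - Ft (n - 1) \<omega> l))\<^sup>2"

definition "S n \<omega> = (\<Sum>l\<in>UNIV. 1 / p l * T n l \<omega>)"

definition "\<delta> n l \<omega> = (Dn (Fs l (x (Suc n) \<omega>) - Fs l (x n \<omega>)))\<^sup>2"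

definition "w n = (a n)\<^sup>2 / (A n * \<gamma> + 1)"

lemma a_0 [simp]: "a 0 = 0" and a_pos: "0 < a (Suc n)"
  using pos by (auto simp: positive_steps_def)

lemma A_nonneg: "0 \<le> A n" and A_pos: "0 < A (Suc n)"
  using stepsum_mono_pos(1)[OF pos] stepsum_mono_pos(2)[OF pos, of "Suc n"] by (simp_all del: stepsum_Suc)

lemma A\<gamma>_pos: "0 < A n * \<gamma> + 1"
  using A_nonneg \<gamma>_nonneg by (simp add: add_nonneg_pos)

lemma x_in_E: "\<omega> \<in> space M \<Longrightarrow> n \<le> K \<Longrightarrow> x n \<omega> \<in> E"
  using arg_min_in_E[OF x_step A_pos] x_0 x0 by (cases n) auto

lemma x_minimal:
  assumes "\<omega> \<in> space M" "n \<le> K" "u \<in> E"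
  shows "z n \<omega> \<bullet> x n \<omega> + A n * gr (x n \<omega>) + D (x n \<omega>) + (A n * \<gamma> + 1) / 2 * (N (u - x n \<omega>))\<^sup>2
    \<le> z n \<omega> \<bullet> u + A n * gr u + D u"
proof (cases n)
  case 0
  \<comment> \<open>At index 0 the objective is \<open>D\<close> itself, minimised at
    \<open>x0\<close>, and its quadratic lower bound is the required growth; this lets dual
    averaging start at \<open>x 0\<close>.\<close>
  then show ?thesis using D_lower[OF assms(3)] by (simp add: x_0 z_0 assms)
next
  case (Suc m)
  then show ?thesis using arg_min_strong[OF x_step A_pos assms(3)] assms by simp
qed

subsection \<open>Pathwise estimates\<close>

text \<open>Test the growth inequality of \<open>x k\<close> with \<open>x (Suc k)\<close>: the
  minimal value rises by at least the new linear term plus the squared increment.\<close>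

lemma dual_averaging:
  assumes \<omega>: "\<omega> \<in> space M" and "k \<le> K"
  shows "(\<Sum>i<k. a (Suc i) * (Fh (Suc i) \<omega> \<bullet> x (Suc i) \<omega> + gr (x (Suc i) \<omega>))
        + (A i * \<gamma> + 1) / 2 * (N (x (Suc i) \<omega> - x i \<omega>))\<^sup>2)
    \<le> z k \<omega> \<bullet> x k \<omega> + A k * gr (x k \<omega>) + D (x k \<omega>)"
  using assms(2)
proof (induction k)
  case (Suc k)
  then show ?case
    using x_minimal[OF \<omega>, of k "x (Suc k) \<omega>"] x_in_E[OF \<omega>, of "Suc k"] z_step[OF \<omega>, of k]
    by (simp add: algebra_simps inner_add_left)
qed (simp add: x_0 z_0 \<omega>)

lemma z_eq:
  assumes "\<omega> \<in> space M" "k \<le> K"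
  shows "z k \<omega> \<bullet> u = (\<Sum>i<k. a (Suc i) * (Fh (Suc i) \<omega> \<bullet> u))"
  using assms(2)
proof (induction k)
  case (Suc k)
  then show ?case using z_step[OF assms(1), of k] by (simp add: inner_add_left)
qed (simp add: z_0 assms)

lemma A_eq: "A k = (\<Sum>i<k. a (Suc i))"
  by (induction k) auto

text \<open>By the update rule the weighted error of \<open>Fh (Suc k)\<close> is
  \<open>e (Suc k) - eh k\<close>. Splitting \<open>x (Suc k) - u\<close> at \<open>x k\<close>
  makes the terms in \<open>e\<close> telescope and leaves the mean-zero difference
  \<open>e k - eh k\<close> paired with \<open>x k - u\<close>.\<close>

lemma error_decomposition:
  assumes \<omega>: "\<omega> \<in> space M" and "k \<le> K"
  shows "(\<Sum>i<k. a (Suc i) * ((F (x (Suc i) \<omega>) - Fh (Suc i) \<omega>) \<bullet> (x (Suc i) \<omega> - u)))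
    = e k \<omega> \<bullet> (x k \<omega> - u) - (\<Sum>i<k. eh i \<omega> \<bullet> (x (Suc i) \<omega> - x i \<omega>)) + (\<Sum>i<k. (e i \<omega> - eh i \<omega>) \<bullet> (x i \<omega> - u))"
  using assms(2)
proof (induction k)
  case 0
  show ?case by (simp add: e_def)
next
  case (Suc k)
  have "a (Suc k) *\<^sub>R Fh (Suc k) \<omega> = a (Suc k) *\<^sub>R (\<Sum>l\<in>UNIV. Ft k \<omega> l) + eh k \<omega>"
    using Suc.prems a_pos[of k] by (simp add: Fh_step[OF \<omega>] eh_def es_def scaleR_add_right)
  then have "a (Suc k) *\<^sub>R (F (x (Suc k) \<omega>) - Fh (Suc k) \<omega>) = e (Suc k) \<omega> - eh k \<omega>"
    by (simp add: e_def scaleR_diff_right)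
  then have "a (Suc k) * ((F (x (Suc k) \<omega>) - Fh (Suc k) \<omega>) \<bullet> (x (Suc k) \<omega> - u)) = (e (Suc k) \<omega> - eh k \<omega>) \<bullet> (x (Suc k) \<omega> - u)"
    by (metis inner_scaleR_left)
  then show ?case using Suc by (simp add: inner_diff_left inner_diff_right)
qed

section \<open>From the averaged point back to the iterates\<close>

lemma averaged_eq: "averaged a (\<lambda>i. x i \<omega>) k = (\<Sum>i<k. (a (Suc i) / A k) *\<^sub>R x (Suc i) \<omega>)"
proof -
  have "(\<Sum>i=1..k. a i *\<^sub>R x i \<omega>) = (\<Sum>i<k. a (Suc i) *\<^sub>R x (Suc i) \<omega>)"
    by (induction k) auto
  then show ?thesis by (simp add: averaged_def scaleR_sum_right)
qed

lemma averaged_weights: "1 \<le> k \<Longrightarrow> (\<Sum>i<k. a (Suc i) / A k) = 1" "0 \<le> a (Suc i) / A k"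
  using stepsum_mono_pos(2)[OF pos, of k] A_nonneg[of k] a_pos[of i]
  by (auto simp: A_eq[symmetric] sum_divide_distrib[symmetric])

lemma averaged_in_E:
  assumes "\<omega> \<in> space M" "1 \<le> k" "k \<le> K"
  shows "averaged a (\<lambda>i. x i \<omega>) k \<in> E"
  unfolding averaged_eq using assms
  by (intro convex_sum convex_E averaged_weights x_in_E) auto

definition "gap k u \<omega> = real_of_ereal (Gap F g (averaged a (\<lambda>i. x i \<omega>) k) u)"

lemma gap_eq:
  assumes "\<omega> \<in> space M" "1 \<le> k" "k \<le> K" "u \<in> E"
  shows "Gap F g (averaged a (\<lambda>i. x i \<omega>) k) u = ereal (gap k u \<omega>)"
  unfolding gap_def Gap_eq[OF averaged_in_E[OF assms(1-3)] assms(4)] by simp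

text \<open>Jensen's inequality for \<open>gr\<close>; monotonicity moves the argument of
  \<open>F\<close> from \<open>u\<close> to the iterates, where the algorithm has
  information.\<close>

lemma gap_averaged:
  assumes \<omega>: "\<omega> \<in> space M" and k: "1 \<le> k" "k \<le> K" and u: "u \<in> E"
  shows "A k * gap k u \<omega> \<le> (\<Sum>i<k. a (Suc i) * (F (x (Suc i) \<omega>) \<bullet> (x (Suc i) \<omega> - u) + gr (x (Suc i) \<omega>) - gr u))"
proof -
  have Ak: "0 < A k" using stepsum_mono_pos(2)[OF pos k(1)] .
  let ?xb = "averaged a (\<lambda>i. x i \<omega>) k"
  have "gr ?xb \<le> (\<Sum>i<k. a (Suc i) / A k * gr (x (Suc i) \<omega>))"
    unfolding averaged_eq using k x_in_E[OF \<omega>]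
    by (intro convex_on_sum[OF _ _ convex_on_gr]) (auto simp: averaged_weights lessThan_empty_iff)
  then have "A k * gr ?xb \<le> A k * (\<Sum>i<k. a (Suc i) / A k * gr (x (Suc i) \<omega>))"
    using Ak by (intro mult_left_mono) auto
  also have "\<dots> = (\<Sum>i<k. a (Suc i) * gr (x (Suc i) \<omega>))"
    using Ak by (simp add: sum_distrib_left)
  finally have 1: "A k * gr ?xb \<le> (\<Sum>i<k. a (Suc i) * gr (x (Suc i) \<omega>))" .
  have "A k *\<^sub>R ?xb = (\<Sum>i<k. a (Suc i) *\<^sub>R x (Suc i) \<omega>)"
    unfolding averaged_eq using Ak by (simp add: scaleR_sum_right)
  then have "A k *\<^sub>R (?xb - u) = (\<Sum>i<k. a (Suc i) *\<^sub>R (x (Suc i) \<omega> - u))"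
    by (simp add: scaleR_diff_right sum_subtractf A_eq scaleR_sum_left)
  then have "A k * (F u \<bullet> (?xb - u)) = (\<Sum>i<k. a (Suc i) * (F u \<bullet> (x (Suc i) \<omega> - u)))"
    by (metis (no_types, lifting) inner_scaleR_right inner_sum_right sum.cong)
  also have "\<dots> \<le> (\<Sum>i<k. a (Suc i) * (F (x (Suc i) \<omega>) \<bullet> (x (Suc i) \<omega> - u)))"
  proof (intro sum_mono mult_left_mono)
    fix i
    have "0 \<le> (F (x (Suc i) \<omega>) - F u) \<bullet> (x (Suc i) \<omega> - u)"
      using monotone by (simp add: monotone_operator_def)
    then show "F u \<bullet> (x (Suc i) \<omega> - u) \<le> F (x (Suc i) \<omega>) \<bullet> (x (Suc i) \<omega> - u)"
      by (simp add: inner_diff_left)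
  qed (simp add: a_pos less_imp_le)
  finally have 2: "A k * (F u \<bullet> (?xb - u)) \<le> (\<Sum>i<k. a (Suc i) * (F (x (Suc i) \<omega>) \<bullet> (x (Suc i) \<omega> - u)))" .
  have "gap k u \<omega> = F u \<bullet> (?xb - u) - gr u + gr ?xb"
    unfolding gap_def Gap_eq[OF averaged_in_E[OF \<omega> k] u] by simp
  then have "A k * gap k u \<omega> = A k * (F u \<bullet> (?xb - u)) - A k * gr u + A k * gr ?xb"
    by (simp only: distrib_left right_diff_distrib)
  also have "A k * gr u = (\<Sum>i<k. a (Suc i) * gr u)" by (simp add: A_eq sum_distrib_right)
  finally show ?thesis using 1 2
    by (simp add: distrib_left right_diff_distrib sum.distrib sum_subtractf)
qed

text \<open>What Young's inequality leaves: squared errors minus the unspent half of the squared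
  increments. It does not depend on the comparison point \<open>u\<close>.\<close>

definition "residual k \<omega> = (Dn (e k \<omega>))\<^sup>2 / (A k * \<gamma> + 1) + (\<Sum>i<k. (Dn (eh i \<omega>))\<^sup>2 / (A i * \<gamma> + 1))
  - (\<Sum>i<k. (A i * \<gamma> + 1) / 4 * (N (x (Suc i) \<omega> - x i \<omega>))\<^sup>2)"

text \<open>Half of the increments pays for the products with \<open>eh i\<close>, and half of the
  growth of the last objective pays for \<open>e k\<close>. The other half of that growth is the
  term with factor 1/4 in the final bound.\<close>

lemma gap_pathwise:
  assumes \<omega>: "\<omega> \<in> space M" and k: "1 \<le> k" "k \<le> K" and u: "u \<in> E"
  shows "A k * gap k u \<omega> \<le> D u - (A k * \<gamma> + 1) / 4 * (N (u - x k \<omega>))\<^sup>2 + residual k \<omega>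
    + (\<Sum>i<k. (e i \<omega> - eh i \<omega>) \<bullet> (x i \<omega> - u))"
proof -
  let ?xi = "\<lambda>i. x (Suc i) \<omega>" and ?Fh = "\<lambda>i. Fh (Suc i) \<omega>"
  let ?B = "\<lambda>i. (A i * \<gamma> + 1) / 4 * (N (?xi i - x i \<omega>))\<^sup>2"
  have "(\<Sum>i<k. a (Suc i) * (F (?xi i) \<bullet> (?xi i - u) + gr (?xi i) - gr u))
    = (\<Sum>i<k. a (Suc i) * (?Fh i \<bullet> ?xi i + gr (?xi i)))
      - ((\<Sum>i<k. a (Suc i) * (?Fh i \<bullet> u)) + (\<Sum>i<k. a (Suc i)) * gr u)
      + (\<Sum>i<k. a (Suc i) * ((F (?xi i) - ?Fh i) \<bullet> (?xi i - u)))"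
    unfolding sum_distrib_right sum.distrib[symmetric] sum_subtractf[symmetric]
    by (intro sum.cong) (simp_all add: algebra_simps inner_diff_left inner_diff_right)
  also have "\<dots> = (\<Sum>i<k. a (Suc i) * (?Fh i \<bullet> ?xi i + gr (?xi i))) - (z k \<omega> \<bullet> u + A k * gr u)
      + (\<Sum>i<k. a (Suc i) * ((F (?xi i) - ?Fh i) \<bullet> (?xi i - u)))"
    by (simp add: z_eq[OF \<omega> k(2)] A_eq)
  also have "(\<Sum>i<k. a (Suc i) * ((F (?xi i) - ?Fh i) \<bullet> (?xi i - u)))
    = e k \<omega> \<bullet> (x k \<omega> - u) - (\<Sum>i<k. eh i \<omega> \<bullet> (?xi i - x i \<omega>)) + (\<Sum>i<k. (e i \<omega> - eh i \<omega>) \<bullet> (x i \<omega> - u))"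
    by (rule error_decomposition[OF \<omega> k(2)])
  finally have 1: "A k * gap k u \<omega> \<le> (\<Sum>i<k. a (Suc i) * (?Fh i \<bullet> ?xi i + gr (?xi i))) - (z k \<omega> \<bullet> u + A k * gr u)
      + (e k \<omega> \<bullet> (x k \<omega> - u) - (\<Sum>i<k. eh i \<omega> \<bullet> (?xi i - x i \<omega>)) + (\<Sum>i<k. (e i \<omega> - eh i \<omega>) \<bullet> (x i \<omega> - u)))"
    using gap_averaged[OF \<omega> k u] by linarith
  have 2: "(\<Sum>i<k. a (Suc i) * (?Fh i \<bullet> ?xi i + gr (?xi i))) + 2 * (\<Sum>i<k. ?B i)
      \<le> z k \<omega> \<bullet> x k \<omega> + A k * gr (x k \<omega>) + D (x k \<omega>)"
    using dual_averaging[OF \<omega> k(2)] by (simp add: sum.distrib sum_distrib_left mult_ac)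
  have 3: "e k \<omega> \<bullet> (x k \<omega> - u) \<le> (Dn (e k \<omega>))\<^sup>2 / (A k * \<gamma> + 1) + (A k * \<gamma> + 1) / 4 * (N (u - x k \<omega>))\<^sup>2"
    using inner_le_young[OF A\<gamma>_pos] by (simp add: N_minus_commute[of u])
  have "(\<Sum>i<k. - (eh i \<omega> \<bullet> (?xi i - x i \<omega>))) \<le> (\<Sum>i<k. (Dn (eh i \<omega>))\<^sup>2 / (A i * \<gamma> + 1) + ?B i)"
  proof (rule sum_mono)
    fix i
    show "- (eh i \<omega> \<bullet> (?xi i - x i \<omega>)) \<le> (Dn (eh i \<omega>))\<^sup>2 / (A i * \<gamma> + 1) + ?B i"
      using inner_le_young[OF A\<gamma>_pos[of i], of "- eh i \<omega>" "?xi i - x i \<omega>"] by simp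
  qed
  then have 4: "- (\<Sum>i<k. eh i \<omega> \<bullet> (?xi i - x i \<omega>)) \<le> (\<Sum>i<k. (Dn (eh i \<omega>))\<^sup>2 / (A i * \<gamma> + 1)) + (\<Sum>i<k. ?B i)"
    by (simp add: sum.distrib sum_negf)
  have half: "(A k * \<gamma> + 1) / 2 * (N (u - x k \<omega>))\<^sup>2 = 2 * ((A k * \<gamma> + 1) / 4 * (N (u - x k \<omega>))\<^sup>2)" by simp
  show ?thesis
    using 1 2 3 4 x_minimal[OF \<omega> k(2) u] unfolding residual_def half by linarith
qed

subsection \<open>Second moments of the extrapolation errors\<close>

text \<open>The draws that determine \<open>x n\<close>: \<open>Inl i\<close> stands for \<open>J i\<close> and \<open>Inr i\<close> for \<open>J' i\<close>. The draw
  \<open>J' n\<close> is made after \<open>x n\<close>.\<close>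

definition Past :: "nat \<Rightarrow> (nat + nat) set" where
  "Past n = Inl ` {1..n} \<union> Inr ` {1..<n}"

abbreviation "Draws \<equiv> {1..K} <+> {1..K}"

lemma Past_subset: "n \<le> K \<Longrightarrow> Past n \<subseteq> Draws"
  by (auto simp: Past_def)

lemma Past_mono: "n \<le> k \<Longrightarrow> Past n \<subseteq> Past k"
  unfolding Past_def by (intro Un_mono image_mono) auto

lemma Past_iff: "Inl i \<in> Past n \<longleftrightarrow> 1 \<le> i \<and> i \<le> n" "Inr i \<in> Past n \<longleftrightarrow> 1 \<le> i \<and> i < n"
  by (auto simp: Past_def)

text \<open>Uniqueness of the minimisers carries the induction, so iterates and tables depend on the
  draws only, whatever choice produced them. The index \<open>n - 1\<close> of the table reflects
  that the refresh by \<open>J' n\<close> comes after \<open>x n\<close>.\<close>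

lemma run_unique:
  assumes \<omega>: "\<omega> \<in> space M" "\<omega>' \<in> space M" and n: "n \<le> K" and eq: "\<forall>s\<in>Past n. Z s \<omega> = Z s \<omega>'"
  shows "x n \<omega> = x n \<omega>' \<and> z n \<omega> = z n \<omega>' \<and> Ft (n - 1) \<omega> = Ft (n - 1) \<omega>'"
  using n eq
proof (induction n)
  case 0
  then show ?case by (simp add: x_0 z_0 \<omega> fun_eq_iff Ft_0)
next
  case (Suc n)
  have IH: "x n \<omega> = x n \<omega>'" "z n \<omega> = z n \<omega>'" "Ft (n - 1) \<omega> = Ft (n - 1) \<omega>'"
    using Suc.IH Suc.prems Past_mono[of n "Suc n"] by auto
  have J: "J (Suc n) \<omega> = J (Suc n) \<omega>'"
    using bspec[OF Suc.prems(2), of "Inl (Suc n)"] by (simp add: Past_iff)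
  have Ft: "Ft n \<omega> = Ft n \<omega>'"
  proof (cases n)
    case 0
    then show ?thesis by (simp add: fun_eq_iff Ft_0 \<omega>)
  next
    case (Suc m)
    have "J' (Suc m) \<omega> = J' (Suc m) \<omega>'"
      using bspec[OF Suc.prems(2), of "Inr (Suc m)"] Suc by (simp add: Past_iff)
    then show ?thesis using IH Suc Suc.prems(1) by (simp add: fun_eq_iff Ft_step \<omega>)
  qed
  have z: "z (Suc n) \<omega> = z (Suc n) \<omega>'"
    using Suc.prems(1) IH J Ft by (simp add: z_step Fh_step \<omega>)
  have "x (Suc n) \<omega> = x (Suc n) \<omega>'"
    using Suc.prems(1) x_step[of \<omega> n] x_step[of \<omega>' n] \<omega> z
    by (intro arg_min_unique[OF _ _ A_pos[of n], of "z (Suc n) \<omega>"]) simp_all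
  then show ?case using z Ft by simp
qed

lemma determinedI:
  assumes k: "k \<le> K"
    and f: "\<And>\<omega> \<omega>'. \<omega> \<in> space M \<Longrightarrow> \<omega>' \<in> space M \<Longrightarrow> (\<And>n. n \<le> k \<Longrightarrow> x n \<omega> = x n \<omega>') \<Longrightarrow>
      (\<And>n. n \<le> k - 1 \<Longrightarrow> Ft n \<omega> = Ft n \<omega>') \<Longrightarrow> (\<And>n. n < k \<Longrightarrow> J (Suc n) \<omega> = J (Suc n) \<omega>') \<Longrightarrow> f \<omega> = f \<omega>'"
  shows "determined Z (Past k) f"
  unfolding determined_def
proof (intro ballI impI)
  fix \<omega> \<omega>' assume \<omega>: "\<omega> \<in> space M" "\<omega>' \<in> space M" and eq: "\<forall>s\<in>Past k. Z s \<omega> = Z s \<omega>'"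
  have *: "x n \<omega> = x n \<omega>' \<and> Ft (n - 1) \<omega> = Ft (n - 1) \<omega>'" if "n \<le> k" for n
    using run_unique[OF \<omega>, of n] eq that k Past_mono[OF that] by auto
  show "f \<omega> = f \<omega>'"
  proof (rule f[OF \<omega>])
    fix n assume n: "n \<le> k - 1"
    show "Ft n \<omega> = Ft n \<omega>'"
    proof (cases n)
      case 0
      then show ?thesis by (simp add: fun_eq_iff Ft_0 \<omega>)
    next
      case (Suc m)
      then show ?thesis using *[of "Suc n"] n by simp
    qed
  next
    fix n assume "n < k"
    then show "J (Suc n) \<omega> = J (Suc n) \<omega>'" using bspec[OF eq, of "Inl (Suc n)"] by (simp add: Past_iff)
  next
    fix n assume "n \<le> k"
    then show "x n \<omega> = x n \<omega>'" using * by blast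
  qed
qed

lemma integrable_determined: "determined Z B f \<Longrightarrow> B \<subseteq> Draws \<Longrightarrow> integrable M (f :: 'w \<Rightarrow> real)"
  using determined_integrable[OF indep] by auto

lemma integrable_Past: "determined Z (Past n) f \<Longrightarrow> n \<le> K \<Longrightarrow> integrable M (f :: 'w \<Rightarrow> real)"
  using integrable_determined Past_subset by blast

lemma expectation_J:
  assumes "\<And>l. determined Z (Past n) (G l)" and "n < K"
  shows "expectation (\<lambda>\<omega>. G (J (Suc n) \<omega>) \<omega>) = (\<Sum>l\<in>UNIV. p l * expectation (G l))"
proof -
  have "expectation (\<lambda>\<omega>. G (Z (Inl (Suc n)) \<omega>) \<omega>)
      = (\<Sum>l\<in>UNIV. measure M {\<omega>\<in>space M. Z (Inl (Suc n)) \<omega> = l} * expectation (G l))"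
    using assms(2) by (intro expectation_independent_draw[OF indep _ assms(1)] Past_subset) (auto simp: Past_iff)
  then show ?thesis using J_prob[of "Suc n"] assms(2) by simp
qed

text \<open>\<open>Past (Suc n)\<close> contains \<open>J (Suc n)\<close> but not
  \<open>J' (Suc n)\<close>, so \<open>G\<close> may depend on \<open>x (Suc n)\<close>.\<close>

lemma expectation_J':
  assumes "\<And>l. determined Z (Past (Suc n)) (G l)" and "n < K"
  shows "expectation (\<lambda>\<omega>. G (J' (Suc n) \<omega>) \<omega>) = (\<Sum>l\<in>UNIV. q l * expectation (G l))"
proof -
  have "expectation (\<lambda>\<omega>. G (Z (Inr (Suc n)) \<omega>) \<omega>)
      = (\<Sum>l\<in>UNIV. measure M {\<omega>\<in>space M. Z (Inr (Suc n)) \<omega> = l} * expectation (G l))"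
    using assms(2) by (intro expectation_independent_draw[OF indep _ assms(1)] Past_subset) (auto simp: Past_iff)
  then show ?thesis using J'_prob[of "Suc n"] assms(2) by simp
qed

lemma determined_x: "n \<le> k \<Longrightarrow> k \<le> K \<Longrightarrow> determined Z (Past k) (x n)"
  by (rule determinedI) auto

lemma determined_T: "n \<le> k \<Longrightarrow> k \<le> K \<Longrightarrow> determined Z (Past k) (T n l)"
  by (rule determinedI) (auto simp: T_def)

lemma determined_S: "n \<le> k \<Longrightarrow> k \<le> K \<Longrightarrow> determined Z (Past k) (S n)"
  by (rule determinedI) (auto simp: S_def T_def)

lemma determined_\<delta>: "n < k \<Longrightarrow> k \<le> K \<Longrightarrow> determined Z (Past k) (\<delta> n l)"
  by (rule determinedI) (auto simp: \<delta>_def)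

lemma determined_e: "n \<le> k \<Longrightarrow> k \<le> K \<Longrightarrow> determined Z (Past k) (e n)"
  by (rule determinedI) (auto simp: e_def)

lemma determined_es: "n \<le> k \<Longrightarrow> k \<le> K \<Longrightarrow> determined Z (Past k) (es l n)"
  by (rule determinedI) (auto simp: es_def)

lemma determined_eh: "n < k \<Longrightarrow> k \<le> K \<Longrightarrow> determined Z (Past k) (eh n)"
  by (rule determinedI) (auto simp: eh_def es_def)

lemma integrable_T [simp]: "n \<le> K \<Longrightarrow> integrable M (T n l)"
  by (rule integrable_Past[OF determined_T]) auto

lemma integrable_\<delta> [simp]: "n < K \<Longrightarrow> integrable M (\<delta> n l)"
  by (rule integrable_Past[OF determined_\<delta>, of n "Suc n"]) auto

lemma integrable_S [simp]: "n \<le> K \<Longrightarrow> integrable M (S n)"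
  by (rule integrable_Past[OF determined_S]) auto

lemma integrable_dist [simp]: "n \<le> K \<Longrightarrow> integrable M (\<lambda>\<omega>. (N (u - x n \<omega>))\<^sup>2)"
  by (intro integrable_Past[of n] determined_comp[where h = "\<lambda>y. (N (u - y))\<^sup>2"] determined_x) auto

lemma integrable_increment [simp]: "n < K \<Longrightarrow> integrable M (\<lambda>\<omega>. (N (x (Suc n) \<omega> - x n \<omega>))\<^sup>2)"
  by (intro integrable_Past[of "Suc n"] determined_comp2[where h = "\<lambda>y y'. (N (y - y'))\<^sup>2"] determined_x) auto

lemma integrable_e [simp]: "n \<le> K \<Longrightarrow> integrable M (\<lambda>\<omega>. (Dn (e n \<omega>))\<^sup>2)"
  by (intro integrable_Past[of n] determined_comp[where h = "\<lambda>y. (Dn y)\<^sup>2"] determined_e) auto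

lemma integrable_eh [simp]: "n < K \<Longrightarrow> integrable M (\<lambda>\<omega>. (Dn (eh n \<omega>))\<^sup>2)"
  by (intro integrable_Past[of "Suc n"] determined_comp[where h = "\<lambda>y. (Dn y)\<^sup>2"] determined_eh) auto

section \<open>Unbiasedness and second moments\<close>

lemma e_eq:
  assumes "\<omega> \<in> space M" "n \<le> K"
  shows "e n \<omega> = (\<Sum>l\<in>UNIV. p l *\<^sub>R es l n \<omega>)"
proof -
  have "p l *\<^sub>R es l n \<omega> = a n *\<^sub>R (Fs l (x n \<omega>) - Ft (n - 1) \<omega> l)" for l
    using p_pos[of l] by (simp add: es_def)
  then show ?thesis
    by (simp add: e_def F_sum x_in_E assms sum_subtractf scaleR_sum_right[symmetric])
qed

lemma e_le_S:
  assumes "\<omega> \<in> space M" "n \<le> K"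
  shows "(Dn (e n \<omega>))\<^sup>2 \<le> (a n)\<^sup>2 * S n \<omega>"
proof -
  have "(Dn (e n \<omega>))\<^sup>2 \<le> (\<Sum>l\<in>UNIV. 1 / p l * (Dn (p l *\<^sub>R es l n \<omega>))\<^sup>2)"
    unfolding e_eq[OF assms] by (rule dual_norm_sum_squared[OF p])
  also have "\<dots> = (a n)\<^sup>2 * S n \<omega>"
    unfolding S_def sum_distrib_left
    by (rule sum.cong) (simp_all add: T_def es_def dual_norm_scaleR power_mult_distrib p_pos power_divide)
  finally show ?thesis .
qed

lemma expectation_e_le:
  assumes "n \<le> K"
  shows "expectation (\<lambda>\<omega>. (Dn (e n \<omega>))\<^sup>2) \<le> (a n)\<^sup>2 * expectation (S n)"
proof -
  have "expectation (\<lambda>\<omega>. (Dn (e n \<omega>))\<^sup>2) \<le> expectation (\<lambda>\<omega>. (a n)\<^sup>2 * S n \<omega>)"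
    using assms by (intro integral_mono) (simp_all add: e_le_S)
  then show ?thesis by simp
qed

lemma expectation_S: "n \<le> K \<Longrightarrow> expectation (S n) = (\<Sum>l\<in>UNIV. 1 / p l * expectation (T n l))"
  unfolding S_def by (subst Bochner_Integration.integral_sum) simp_all

text \<open>Averaging \<open>(1 / p l)\<^sup>2\<close> against \<open>p l\<close> leaves the weight
  \<open>1 / p l\<close> of \<open>S\<close>, so \<open>e n\<close> and \<open>eh n\<close> obey the
  same second-moment bound.\<close>

lemma expectation_eh:
  assumes "n < K"
  shows "expectation (\<lambda>\<omega>. (Dn (eh n \<omega>))\<^sup>2) = (a n)\<^sup>2 * expectation (S n)"
proof -
  have "expectation (\<lambda>\<omega>. (Dn (eh n \<omega>))\<^sup>2) = (\<Sum>l\<in>UNIV. p l * expectation (\<lambda>\<omega>. (Dn (es l n \<omega>))\<^sup>2))"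
    unfolding eh_def using assms
    by (intro expectation_J determined_comp[where h = "\<lambda>y. (Dn y)\<^sup>2"] determined_es) auto
  also have "\<dots> = (\<Sum>l\<in>UNIV. (a n)\<^sup>2 * (1 / p l * expectation (T n l)))"
  proof (rule sum.cong)
    fix l
    have "(\<lambda>\<omega>. (Dn (es l n \<omega>))\<^sup>2) = (\<lambda>\<omega>. (a n)\<^sup>2 / (p l)\<^sup>2 * T n l \<omega>)"
      by (simp add: es_def T_def dual_norm_scaleR power_mult_distrib power_divide)
    then have "expectation (\<lambda>\<omega>. (Dn (es l n \<omega>))\<^sup>2) = (a n)\<^sup>2 / (p l)\<^sup>2 * expectation (T n l)" by simp
    then show "p l * expectation (\<lambda>\<omega>. (Dn (es l n \<omega>))\<^sup>2) = (a n)\<^sup>2 * (1 / p l * expectation (T n l))"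
      using p_pos[of l] by (simp add: power2_eq_square)
  qed simp
  finally show ?thesis using assms by (simp add: expectation_S sum_distrib_left)
qed

text \<open>The martingale difference property: for a vector \<open>v\<close> fixed by the past, the
  \<open>p\<close>-average of \<open>e n - es l n\<close> is zero.\<close>

lemma expectation_noise:
  assumes n: "n < K" and v: "determined Z (Past n) v"
  shows "expectation (\<lambda>\<omega>. (e n \<omega> - eh n \<omega>) \<bullet> v \<omega>) = 0"
    and "integrable M (\<lambda>\<omega>. (e n \<omega> - eh n \<omega>) \<bullet> v \<omega>)"
proof -
  have det: "determined Z (Past n) (\<lambda>\<omega>. (e n \<omega> - es l n \<omega>) \<bullet> v \<omega>)" for l
    using n determined_comp2[OF determined_comp2[OF determined_e determined_es, where h = "\<lambda>y y'. y - y'"] v, where h = "\<lambda>y y'. y \<bullet> y'"]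
    by simp
  have "expectation (\<lambda>\<omega>. (e n \<omega> - eh n \<omega>) \<bullet> v \<omega>) = (\<Sum>l\<in>UNIV. p l * expectation (\<lambda>\<omega>. (e n \<omega> - es l n \<omega>) \<bullet> v \<omega>))"
    unfolding eh_def by (rule expectation_J[OF det n])
  also have "\<dots> = (\<Sum>l\<in>UNIV. expectation (\<lambda>\<omega>. p l * ((e n \<omega> - es l n \<omega>) \<bullet> v \<omega>)))" by simp
  also have "\<dots> = expectation (\<lambda>\<omega>. \<Sum>l\<in>UNIV. p l * ((e n \<omega> - es l n \<omega>) \<bullet> v \<omega>))"
    by (rule Bochner_Integration.integral_sum[symmetric]) (use integrable_Past[OF det] n in simp)
  also have "\<dots> = expectation (\<lambda>\<omega>. 0)"
  proof (rule Bochner_Integration.integral_cong)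
    fix \<omega> assume "\<omega> \<in> space M"
    then have "(\<Sum>l\<in>UNIV. p l *\<^sub>R (e n \<omega> - es l n \<omega>)) = 0"
      using e_eq[of \<omega> n] n by (simp add: scaleR_diff_right sum_subtractf scaleR_sum_left[symmetric] p_sum)
    then have "(\<Sum>l\<in>UNIV. p l *\<^sub>R (e n \<omega> - es l n \<omega>)) \<bullet> v \<omega> = 0" by simp
    then show "(\<Sum>l\<in>UNIV. p l * ((e n \<omega> - es l n \<omega>) \<bullet> v \<omega>)) = 0" by (simp add: inner_sum_left)
  qed simp
  finally show "expectation (\<lambda>\<omega>. (e n \<omega> - eh n \<omega>) \<bullet> v \<omega>) = 0" by simp
  have "determined Z (Past (Suc n)) (\<lambda>\<omega>. (e n \<omega> - eh n \<omega>) \<bullet> v \<omega>)"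
    using n determined_mono[OF v Past_mono[of n "Suc n"]]
    by (intro determined_comp2[where h = "\<lambda>y y'. y \<bullet> y'"] determined_comp2[where h = "\<lambda>y y'. y - y'"] determined_e determined_eh) auto
  then show "integrable M (\<lambda>\<omega>. (e n \<omega> - eh n \<omega>) \<bullet> v \<omega>)" using n by (intro integrable_Past) auto
qed

lemma expectation_T_step:
  assumes n: "n < K"
  shows "expectation (T (Suc n) l) \<le> 3 / q l * expectation (\<delta> n l) + (1 - q l / 2) * expectation (T n l)"
proof (cases n)
  case 0
  \<comment> \<open>There is no refresh at index 0; the initial table is exact, so no staleness is
    inherited.\<close>
  have "T n l \<omega> = 0" "T (Suc n) l \<omega> = \<delta> n l \<omega>" if "\<omega> \<in> space M" for \<omega>
    using that by (simp_all add: 0 T_def \<delta>_def Ft_0 x_0)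
  then have "expectation (T n l) = 0" "expectation (T (Suc n) l) = expectation (\<delta> n l)"
    by (auto cong: Bochner_Integration.integral_cong)
  moreover have "0 \<le> expectation (\<delta> n l)" by (simp add: \<delta>_def)
  then have "1 * expectation (\<delta> n l) \<le> 3 / q l * expectation (\<delta> n l)"
    using q_pos[of l] q_le_1[of l] by (intro mult_right_mono) (simp_all add: pos_le_divide_eq)
  ultimately show ?thesis by simp
next
  case (Suc m)
  \<comment> \<open>The staleness left after the refresh drawn by \<open>i\<close>: none if
    \<open>l\<close> was refreshed, the old one otherwise. Averaging over \<open>J' n\<close> gives
    the factor \<open>1 - q l\<close>.\<close>
  define G where "G i \<omega> = (if i = l then 0 else T n l \<omega>)" for i \<omega>
  have det: "determined Z (Past n) (G i)" for i
    unfolding G_def using n by (intro determined_comp[where h = "\<lambda>y. if i = l then 0 else y"] determined_T) auto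
  have intG: "integrable M (\<lambda>\<omega>. G (J' n \<omega>) \<omega>)"
  proof (rule integrable_determined)
    show "determined Z (insert (Inr n) (Past n)) (\<lambda>\<omega>. G (J' n \<omega>) \<omega>)"
      using det unfolding determined_def by (metis insertCI old.sum.simps(6))
  qed (use n Suc Past_subset[of n] in auto)
  have "expectation (T (Suc n) l) \<le> expectation (\<lambda>\<omega>. 3 / q l * \<delta> n l \<omega> + (1 + q l / 2) * G (J' n \<omega>) \<omega>)"
  proof (rule integral_mono)
    fix \<omega> assume \<omega>: "\<omega> \<in> space M"
    have "T (Suc n) l \<omega> = (Dn ((Fs l (x (Suc n) \<omega>) - Fs l (x n \<omega>)) + (Fs l (x n \<omega>) - Ft n \<omega> l)))\<^sup>2"
      by (simp add: T_def)
    also have "\<dots> \<le> 3 / q l * \<delta> n l \<omega> + (1 + q l / 2) * (Dn (Fs l (x n \<omega>) - Ft n \<omega> l))\<^sup>2"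
      unfolding \<delta>_def by (rule dual_norm_add_squared) (simp_all add: q_pos q_le_1)
    also have "(Dn (Fs l (x n \<omega>) - Ft n \<omega> l))\<^sup>2 = G (J' n \<omega>) \<omega>"
      using n \<omega> by (simp add: Suc Ft_step G_def T_def)
    finally show "T (Suc n) l \<omega> \<le> 3 / q l * \<delta> n l \<omega> + (1 + q l / 2) * G (J' n \<omega>) \<omega>" .
  qed (use n intG in simp_all)
  also have "\<dots> = 3 / q l * expectation (\<delta> n l) + (1 + q l / 2) * expectation (\<lambda>\<omega>. G (J' n \<omega>) \<omega>)"
    using n intG by simp
  also have "expectation (\<lambda>\<omega>. G (J' n \<omega>) \<omega>) = (\<Sum>i\<in>UNIV. q i * expectation (G i))"
    using expectation_J'[of m G] det n by (simp add: Suc)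
  also have "\<dots> = (\<Sum>i\<in>UNIV. q i * expectation (T n l) - (if i = l then q i * expectation (T n l) else 0))"
  proof (rule sum.cong)
    fix i
    have "G i = (\<lambda>\<omega>. if i = l then 0 else T n l \<omega>)" by (simp add: G_def fun_eq_iff)
    then show "q i * expectation (G i) = q i * expectation (T n l) - (if i = l then q i * expectation (T n l) else 0)"
      by simp
  qed simp
  also have "\<dots> = (1 - q l) * expectation (T n l)"
    by (simp add: sum_subtractf sum_distrib_right[symmetric] q_sum left_diff_distrib)
  also have "(1 + q l / 2) * ((1 - q l) * expectation (T n l)) \<le> (1 - q l / 2) * expectation (T n l)"
  proof -
    \<comment> \<open>The product equals \<open>1 - q l / 2 - (q l)\<^sup>2 / 2\<close>.\<close>
    have "(1 + q l / 2) * (1 - q l) \<le> 1 - q l / 2" using q_pos[of l] by (simp add: algebra_simps)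
    moreover have "0 \<le> expectation (T n l)" by (simp add: T_def)
    ultimately show ?thesis by (metis mult.assoc mult_right_mono)
  qed
  finally show ?thesis by simp
qed

section \<open>The weighted staleness recursion and its absorption\<close>

lemma w_nonneg: "0 \<le> w n" and w_0 [simp]: "w 0 = 0"
  using A\<gamma>_pos[of n] by (simp_all add: w_def)

text \<open>The product \<open>(1 + q l / 5) * (1 - q l / 2)\<close> equals
  \<open>1 - 3 / 10 * q l - (q l)\<^sup>2 / 10\<close>. Index 0 is excluded because
  \<open>w 0 = 0\<close>.\<close>

lemma w_step: "w (Suc n) * (1 - q l / 2) \<le> (1 - 3 / 10 * q l) * w n" if "1 \<le> n"
proof -
  have "w (Suc n) \<le> (1 + qm / 5) * w n"
    using steps that unfolding step_conditions_def w_def by (auto dest!: spec[of _ "Suc n"] simp del: stepsum_Suc)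
  also have "\<dots> \<le> (1 + q l / 5) * w n"
    using qm[of l] w_nonneg by (intro mult_right_mono) auto
  finally have "w (Suc n) * (1 - q l / 2) \<le> (1 + q l / 5) * w n * (1 - q l / 2)"
    using q_le_1[of l] by (intro mult_right_mono) auto
  also have "\<dots> = ((1 + q l / 5) * (1 - q l / 2)) * w n" by simp
  also have "\<dots> \<le> (1 - 3 / 10 * q l) * w n"
  proof (intro mult_right_mono w_nonneg)
    have "0 \<le> q l * q l" by simp
    then show "(1 + q l / 5) * (1 - q l / 2) \<le> 1 - 3 / 10 * q l" by (simp add: algebra_simps)
  qed
  finally show ?thesis .
qed

text \<open>Summing \<open>R (Suc n) \<le> b n + (1 - c) * R n\<close> bounds the sum of
  \<open>R\<close> by that of \<open>b\<close> divided by \<open>c\<close>, and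
  \<open>3 / q l\<close> over \<open>3 / 10 * q l\<close> is
  \<open>10 / (q l)\<^sup>2\<close>.\<close>

lemma sum_T_le:
  assumes "k \<le> K"
  shows "(\<Sum>n<k. w (Suc n) * expectation (T (Suc n) l)) \<le> 10 / (q l)\<^sup>2 * (\<Sum>n<k. w (Suc n) * expectation (\<delta> n l))"
proof -
  define R where "R n = w n * expectation (T n l)" for n
  define c where "c = 3 / 10 * q l"
  have c: "0 < c" "c \<le> 1" using q_pos[of l] q_le_1[of l] by (auto simp: c_def)
  have R0: "0 \<le> R n" for n by (simp add: R_def w_nonneg T_def)
  have step: "R (Suc n) \<le> 3 / q l * (w (Suc n) * expectation (\<delta> n l)) + (1 - c) * R n" if "n < K" for n
  proof -
    have T0: "0 \<le> expectation (T n l)" by (simp add: T_def)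
    have "R (Suc n) \<le> w (Suc n) * (3 / q l * expectation (\<delta> n l) + (1 - q l / 2) * expectation (T n l))"
      unfolding R_def by (intro mult_left_mono expectation_T_step that w_nonneg)
    also have "\<dots> = 3 / q l * (w (Suc n) * expectation (\<delta> n l)) + w (Suc n) * (1 - q l / 2) * expectation (T n l)"
      by (simp add: algebra_simps)
    also have "w (Suc n) * (1 - q l / 2) * expectation (T n l) \<le> (1 - c) * R n"
    \<comment> \<open>The growth bound on \<open>w\<close> starts at index 1; at 0 the staleness
      itself vanishes.\<close>
    proof (cases "n = 0")
      case True
      have "expectation (T 0 l) = expectation (\<lambda>\<omega>. 0)"
        by (rule Bochner_Integration.integral_cong) (simp_all add: T_def Ft_0 x_0)
      then show ?thesis by (simp add: True R_def)
    next
      case False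
      then have "w (Suc n) * (1 - q l / 2) * expectation (T n l) \<le> (1 - c) * w n * expectation (T n l)"
        unfolding c_def by (intro mult_right_mono w_step T0) auto
      then show ?thesis by (simp add: R_def mult.assoc)
    qed
    finally show ?thesis by simp
  qed
  \<comment> \<open>Keeping the last term \<open>(1 - c) * R k\<close> makes the claim
    inductive.\<close>
  have "c * (\<Sum>n<k. R (Suc n)) + (1 - c) * R k \<le> 3 / q l * (\<Sum>n<k. w (Suc n) * expectation (\<delta> n l))"
    using assms
  proof (induction k)
    case (Suc k)
    then show ?case using step[of k] by (simp add: algebra_simps)
  qed (simp add: R_def)
  moreover have "0 \<le> (1 - c) * R k" using c R0 by simp
  ultimately have "c * (\<Sum>n<k. R (Suc n)) \<le> 3 / q l * (\<Sum>n<k. w (Suc n) * expectation (\<delta> n l))" by linarith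
  then have "(\<Sum>n<k. R (Suc n)) \<le> 3 / q l * (\<Sum>n<k. w (Suc n) * expectation (\<delta> n l)) / c"
    using c(1) by (subst pos_le_divide_eq) (simp_all only: mult.commute)
  also have "\<dots> = 10 / (q l)\<^sup>2 * (\<Sum>n<k. w (Suc n) * expectation (\<delta> n l))"
    using q_pos[of l] by (simp add: c_def power2_eq_square)
  finally show ?thesis unfolding R_def .
qed

lemma sum_S_le:
  assumes k: "k \<le> K"
  shows "(\<Sum>n<k. w (Suc n) * expectation (S (Suc n)))
    \<le> (\<Sum>n<k. 10 * L\<^sup>2 * w (Suc n) * expectation (\<lambda>\<omega>. (N (x (Suc n) \<omega> - x n \<omega>))\<^sup>2))"
proof -
  have "(\<Sum>n<k. w (Suc n) * expectation (S (Suc n)))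
      = (\<Sum>n<k. \<Sum>l\<in>UNIV. 1 / p l * (w (Suc n) * expectation (T (Suc n) l)))"
    using k by (intro sum.cong) (simp_all add: expectation_S sum_distrib_left mult_ac)
  also have "\<dots> = (\<Sum>l\<in>UNIV. 1 / p l * (\<Sum>n<k. w (Suc n) * expectation (T (Suc n) l)))"
    by (subst sum.swap) (simp add: sum_distrib_left)
  also have "\<dots> \<le> (\<Sum>l\<in>UNIV. 1 / p l * (10 / (q l)\<^sup>2 * (\<Sum>n<k. w (Suc n) * expectation (\<delta> n l))))"
    using p_pos by (intro sum_mono mult_left_mono sum_T_le k) (simp_all add: less_imp_le)
  also have "\<dots> = (\<Sum>l\<in>UNIV. \<Sum>n<k. 10 * w (Suc n) * (1 / (p l * (q l)\<^sup>2) * expectation (\<delta> n l)))"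
    by (intro sum.cong) (simp_all add: sum_distrib_left mult_ac)
  also have "\<dots> = (\<Sum>n<k. 10 * w (Suc n) * (\<Sum>l\<in>UNIV. 1 / (p l * (q l)\<^sup>2) * expectation (\<delta> n l)))"
    by (subst sum.swap) (simp add: sum_distrib_left)
  also have "\<dots> \<le> (\<Sum>n<k. 10 * w (Suc n) * (L\<^sup>2 * expectation (\<lambda>\<omega>. (N (x (Suc n) \<omega> - x n \<omega>))\<^sup>2)))"
  proof (intro sum_mono mult_left_mono)
    fix n assume "n \<in> {..<k}"
    then have n: "n < K" using k by simp
    have "(\<Sum>l\<in>UNIV. 1 / (p l * (q l)\<^sup>2) * expectation (\<delta> n l))
        = expectation (\<lambda>\<omega>. \<Sum>l\<in>UNIV. 1 / (p l * (q l)\<^sup>2) * \<delta> n l \<omega>)"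
      using n by (subst Bochner_Integration.integral_sum) simp_all
    also have "\<dots> \<le> expectation (\<lambda>\<omega>. L\<^sup>2 * (N (x (Suc n) \<omega> - x n \<omega>))\<^sup>2)"
    proof (rule integral_mono)
      fix \<omega> assume "\<omega> \<in> space M"
      then show "(\<Sum>l\<in>UNIV. 1 / (p l * (q l)\<^sup>2) * \<delta> n l \<omega>) \<le> L\<^sup>2 * (N (x (Suc n) \<omega> - x n \<omega>))\<^sup>2"
        unfolding \<delta>_def using n by (intro Fs_lipschitz x_in_E) auto
    qed (use n in simp_all)
    finally show "(\<Sum>l\<in>UNIV. 1 / (p l * (q l)\<^sup>2) * expectation (\<delta> n l))
        \<le> L\<^sup>2 * expectation (\<lambda>\<omega>. (N (x (Suc n) \<omega> - x n \<omega>))\<^sup>2)" by simp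
  qed (simp add: w_nonneg)
  finally show ?thesis by (simp add: mult_ac)
qed

text \<open>\<open>c\<close> counts the copies of the error sum to be absorbed by the increments: 1
  for a fixed comparison point, 3 for the supremum.\<close>

lemma sum_S_absorbed:
  assumes k: "k \<le> K" and c: "0 \<le> c" and le: "\<And>n. n < k \<Longrightarrow> c * (10 * L\<^sup>2 * w (Suc n)) \<le> (A n * \<gamma> + 1) / 4"
  shows "c * (\<Sum>n<k. w (Suc n) * expectation (S (Suc n)))
    \<le> (\<Sum>n<k. (A n * \<gamma> + 1) / 4 * expectation (\<lambda>\<omega>. (N (x (Suc n) \<omega> - x n \<omega>))\<^sup>2))"
proof -
  have "c * (\<Sum>n<k. w (Suc n) * expectation (S (Suc n)))
      \<le> c * (\<Sum>n<k. 10 * L\<^sup>2 * w (Suc n) * expectation (\<lambda>\<omega>. (N (x (Suc n) \<omega> - x n \<omega>))\<^sup>2))"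
    by (intro mult_left_mono sum_S_le k c)
  also have "\<dots> = (\<Sum>n<k. c * (10 * L\<^sup>2 * w (Suc n)) * expectation (\<lambda>\<omega>. (N (x (Suc n) \<omega> - x n \<omega>))\<^sup>2))"
    by (simp add: sum_distrib_left mult.assoc)
  also have "\<dots> \<le> (\<Sum>n<k. (A n * \<gamma> + 1) / 4 * expectation (\<lambda>\<omega>. (N (x (Suc n) \<omega> - x n \<omega>))\<^sup>2))"
    by (intro sum_mono mult_right_mono le) auto
  finally show ?thesis .
qed

subsection \<open>Expected gap\<close>

lemma integrable_gap:
  assumes "1 \<le> k" "k \<le> K"
  shows "integrable M (gap k u)"
proof (rule integrable_Past[OF determinedI[OF assms(2)] assms(2)])
  fix \<omega> \<omega>' assume "\<And>n. n \<le> k \<Longrightarrow> x n \<omega> = x n \<omega>'"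
  then have "(\<Sum>i=1..k. a i *\<^sub>R x i \<omega>) = (\<Sum>i=1..k. a i *\<^sub>R x i \<omega>')"
    by (intro sum.cong) auto
  then show "gap k u \<omega> = gap k u \<omega>'" by (simp only: gap_def averaged_def)
qed

lemma integrable_residual: "k \<le> K \<Longrightarrow> integrable M (residual k)"
  and expectation_residual: "k \<le> K \<Longrightarrow> expectation (residual k) = expectation (\<lambda>\<omega>. (Dn (e k \<omega>))\<^sup>2) / (A k * \<gamma> + 1)
      + (\<Sum>i<k. expectation (\<lambda>\<omega>. (Dn (eh i \<omega>))\<^sup>2) / (A i * \<gamma> + 1))
      - (\<Sum>i<k. (A i * \<gamma> + 1) / 4 * expectation (\<lambda>\<omega>. (N (x (Suc i) \<omega> - x i \<omega>))\<^sup>2))"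
proof -
  assume k: "k \<le> K"
  define P where "P \<omega> = (Dn (e k \<omega>))\<^sup>2 / (A k * \<gamma> + 1)" for \<omega>
  define Q where "Q i \<omega> = (Dn (eh i \<omega>))\<^sup>2 / (A i * \<gamma> + 1)" for i \<omega>
  define R where "R i \<omega> = (A i * \<gamma> + 1) / 4 * (N (x (Suc i) \<omega> - x i \<omega>))\<^sup>2" for i \<omega>
  have P: "integrable M P" "expectation P = expectation (\<lambda>\<omega>. (Dn (e k \<omega>))\<^sup>2) / (A k * \<gamma> + 1)"
    using k by (simp_all add: P_def[abs_def])
  have Q: "integrable M (Q i)" "expectation (Q i) = expectation (\<lambda>\<omega>. (Dn (eh i \<omega>))\<^sup>2) / (A i * \<gamma> + 1)" if "i < k" for i
    using k that by (simp_all add: Q_def[abs_def])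
  have R: "integrable M (R i)" "expectation (R i) = (A i * \<gamma> + 1) / 4 * expectation (\<lambda>\<omega>. (N (x (Suc i) \<omega> - x i \<omega>))\<^sup>2)" if "i < k" for i
    using k that by (simp_all add: R_def[abs_def])
  have eq: "residual k = (\<lambda>\<omega>. P \<omega> + (\<Sum>i<k. Q i \<omega>) - (\<Sum>i<k. R i \<omega>))"
    by (simp add: fun_eq_iff residual_def P_def Q_def R_def)
  have int: "integrable M (\<lambda>\<omega>. \<Sum>i<k. Q i \<omega>)" "integrable M (\<lambda>\<omega>. \<Sum>i<k. R i \<omega>)"
    using Q(1) R(1) by (intro Bochner_Integration.integrable_sum; simp)+
  show "integrable M (residual k)" unfolding eq using P(1) int by simp
  have "expectation (residual k) = expectation P + (\<Sum>i<k. expectation (Q i)) - (\<Sum>i<k. expectation (R i))"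
    unfolding eq using P(1) int Q(1) R(1) by (simp add: Bochner_Integration.integral_sum)
  then show "expectation (residual k) = expectation (\<lambda>\<omega>. (Dn (e k \<omega>))\<^sup>2) / (A k * \<gamma> + 1)
      + (\<Sum>i<k. expectation (\<lambda>\<omega>. (Dn (eh i \<omega>))\<^sup>2) / (A i * \<gamma> + 1))
      - (\<Sum>i<k. (A i * \<gamma> + 1) / 4 * expectation (\<lambda>\<omega>. (N (x (Suc i) \<omega> - x i \<omega>))\<^sup>2))"
    using P(2) sum.cong[OF refl, of "{..<k}" "\<lambda>i. expectation (Q i)", OF Q(2)]
      sum.cong[OF refl, of "{..<k}" "\<lambda>i. expectation (R i)", OF R(2)] by simp
qed

lemma w_bound: "25 * L\<^sup>2 * w (Suc n) \<le> (A n * \<gamma> + 1) / 4"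
  using steps unfolding step_conditions_def w_def by (auto dest!: spec[of _ "Suc (Suc n)"] simp del: stepsum_Suc)

lemma expectation_S_nonneg: "0 \<le> expectation (S n)"
proof (rule Bochner_Integration.integral_nonneg)
  fix \<omega>
  show "0 \<le> S n \<omega>" unfolding S_def T_def using p_pos by (intro sum_nonneg) (simp add: less_imp_le)
qed

lemma sum_w_S_shift:
  "(\<Sum>i\<le>k. w i * expectation (S i)) = (\<Sum>i<k. w (Suc i) * expectation (S (Suc i)))"
  by (subst sum.atMost_shift) simp

text \<open>The bound for \<open>e k\<close> is the missing last term of the sum over
  \<open>eh i\<close>. Together they run over \<open>i \<le> k\<close>, and \<open>w 0 = 0\<close>
  allows the shift to successors.\<close>

lemma expectation_residual_le:
  assumes k: "k \<le> K"
  shows "expectation (residual k) \<le> (\<Sum>i<k. w (Suc i) * expectation (S (Suc i)))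
    - (\<Sum>i<k. (A i * \<gamma> + 1) / 4 * expectation (\<lambda>\<omega>. (N (x (Suc i) \<omega> - x i \<omega>))\<^sup>2))"
proof -
  have "(\<Sum>i<k. expectation (\<lambda>\<omega>. (Dn (eh i \<omega>))\<^sup>2) / (A i * \<gamma> + 1)) = (\<Sum>i<k. w i * expectation (S i))"
    using k by (intro sum.cong) (simp_all add: expectation_eh w_def)
  moreover have "expectation (\<lambda>\<omega>. (Dn (e k \<omega>))\<^sup>2) / (A k * \<gamma> + 1) \<le> w k * expectation (S k)"
    using divide_right_mono[OF expectation_e_le[OF k], of "A k * \<gamma> + 1"] A\<gamma>_pos[of k] by (simp add: w_def)
  ultimately show ?thesis
    using sum_w_S_shift[of k] unfolding expectation_residual[OF k] by (simp add: lessThan_Suc_atMost[symmetric])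
qed

lemma expectation_residual_nonpos:
  assumes k: "k \<le> K"
  shows "expectation (residual k) \<le> 0"
proof -
  have "1 * (10 * L\<^sup>2 * w (Suc n)) \<le> (A n * \<gamma> + 1) / 4" for n
  proof -
    have "0 \<le> L\<^sup>2 * w (Suc n)" by (simp add: w_nonneg)
    then show ?thesis using w_bound[of n] by (simp only: mult.assoc)
  qed
  then show ?thesis using expectation_residual_le[OF k] sum_S_absorbed[OF k, of 1] by simp
qed

lemma expected_gap:
  assumes k: "1 \<le> k" "k \<le> K" and u: "u \<in> E"
  shows "expectation (gap k u) \<le> (D u - (A k * \<gamma> + 1) / 4 * expectation (\<lambda>\<omega>. (N (u - x k \<omega>))\<^sup>2)) / A k"
proof -
  have det: "determined Z (Past i) (\<lambda>\<omega>. x i \<omega> - u)" if "i < k" for i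
    using that k by (intro determined_comp[where h = "\<lambda>y. y - u"] determined_x) auto
  have noise: "integrable M (\<lambda>\<omega>. (e i \<omega> - eh i \<omega>) \<bullet> (x i \<omega> - u))"
    "expectation (\<lambda>\<omega>. (e i \<omega> - eh i \<omega>) \<bullet> (x i \<omega> - u)) = 0" if "i < k" for i
    using expectation_noise[of i] det[OF that] that k by auto
  have int: "integrable M (\<lambda>\<omega>. \<Sum>i<k. (e i \<omega> - eh i \<omega>) \<bullet> (x i \<omega> - u))"
    using noise(1) by (intro Bochner_Integration.integrable_sum) simp
  have sum_0: "expectation (\<lambda>\<omega>. \<Sum>i<k. (e i \<omega> - eh i \<omega>) \<bullet> (x i \<omega> - u)) = 0"
    using noise by (subst Bochner_Integration.integral_sum) simp_all
  have int2: "integrable M (\<lambda>\<omega>. D u - (A k * \<gamma> + 1) / 4 * (N (u - x k \<omega>))\<^sup>2)"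
    using k by (intro Bochner_Integration.integrable_diff integrable_mult_right) auto
  have "A k * expectation (gap k u) = expectation (\<lambda>\<omega>. A k * gap k u \<omega>)" by simp
  also have "\<dots> \<le> expectation (\<lambda>\<omega>. (D u - (A k * \<gamma> + 1) / 4 * (N (u - x k \<omega>))\<^sup>2) + residual k \<omega>
      + (\<Sum>i<k. (e i \<omega> - eh i \<omega>) \<bullet> (x i \<omega> - u)))"
  proof (rule integral_mono)
    show "integrable M (\<lambda>\<omega>. A k * gap k u \<omega>)" using integrable_gap[OF k] by simp
    show "integrable M (\<lambda>\<omega>. (D u - (A k * \<gamma> + 1) / 4 * (N (u - x k \<omega>))\<^sup>2) + residual k \<omega>
      + (\<Sum>i<k. (e i \<omega> - eh i \<omega>) \<bullet> (x i \<omega> - u)))"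
      by (intro Bochner_Integration.integrable_add int int2 integrable_residual k)
  qed (rule gap_pathwise[OF _ k u])
  also have "\<dots> = expectation (\<lambda>\<omega>. D u - (A k * \<gamma> + 1) / 4 * (N (u - x k \<omega>))\<^sup>2) + expectation (residual k)"
    by (simp only: Bochner_Integration.integral_add[OF Bochner_Integration.integrable_add[OF int2 integrable_residual[OF k(2)]] int]
        Bochner_Integration.integral_add[OF int2 integrable_residual[OF k(2)]] sum_0 add_0_right)
  also have "expectation (\<lambda>\<omega>. D u - (A k * \<gamma> + 1) / 4 * (N (u - x k \<omega>))\<^sup>2)
      = D u - (A k * \<gamma> + 1) / 4 * expectation (\<lambda>\<omega>. (N (u - x k \<omega>))\<^sup>2)"
    using integrable_dist[OF k(2), of u] by (subst Bochner_Integration.integral_diff) (simp_all add: prob_space)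
  also have "D u - (A k * \<gamma> + 1) / 4 * expectation (\<lambda>\<omega>. (N (u - x k \<omega>))\<^sup>2) + expectation (residual k)
      \<le> D u - (A k * \<gamma> + 1) / 4 * expectation (\<lambda>\<omega>. (N (u - x k \<omega>))\<^sup>2)"
    using expectation_residual_nonpos[OF k(2)] by simp
  finally show ?thesis
    using stepsum_mono_pos(2)[OF pos k(1)] by (simp add: pos_le_divide_eq mult.commute)
qed

lemma expected_distance_to_solution:
  assumes k: "1 \<le> k" "k \<le> K" and vi: "vi_solution F g xs"
  shows "expectation (\<lambda>\<omega>. (N (xs - x k \<omega>))\<^sup>2) \<le> 4 * D xs / (A k * \<gamma> + 1)"
proof -
  have "0 \<le> expectation (gap k xs)"
    unfolding gap_def by (intro integral_nonneg_AE AE_I2 Gap_solution_nonneg vi averaged_in_E k)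
  also have "\<dots> \<le> (D xs - (A k * \<gamma> + 1) / 4 * expectation (\<lambda>\<omega>. (N (xs - x k \<omega>))\<^sup>2)) / A k"
    using vi k by (intro expected_gap) (simp_all add: vi_solution_def)
  finally have "(A k * \<gamma> + 1) / 4 * expectation (\<lambda>\<omega>. (N (xs - x k \<omega>))\<^sup>2) \<le> D xs"
    using stepsum_mono_pos(2)[OF pos k(1)] by (simp add: zero_le_divide_iff)
  then show ?thesis using A\<gamma>_pos[of k] by (simp add: pos_le_divide_eq mult.commute)
qed

subsection \<open>Supremum of the gap\<close>

text \<open>The maximiser of the gap depends on the noise. Its product with the accumulated noise is
  bounded by Fenchel's inequality, and the conjugate is controlled by the smoothness inequality along
  the auxiliary sequence of gradients, which depends only on the past.\<close>

definition "s k \<omega> = - (\<Sum>i<k. e i \<omega> - eh i \<omega>)"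

lemma determined_s: "k \<le> K \<Longrightarrow> determined Z (Past k) (s k)"
  by (rule determinedI) (auto simp: s_def e_def eh_def es_def intro!: sum.cong)

text \<open>Smoothness of the conjugate applied once per step, starting from
  \<open>D_conj 0 = 0\<close>.\<close>

lemma D_conj_s_le:
  "D_conj (s k \<omega>) \<le> (\<Sum>i<k. (Dn (e i \<omega> - eh i \<omega>))\<^sup>2 / 2 - (e i \<omega> - eh i \<omega>) \<bullet> D_conj_grad (s i \<omega>))"
proof (induction k)
  case (Suc k)
  have "s (Suc k) \<omega> = s k \<omega> + - (e k \<omega> - eh k \<omega>)" by (simp add: s_def)
  then have "D_conj (s (Suc k) \<omega>) \<le> D_conj (s k \<omega>) - (e k \<omega> - eh k \<omega>) \<bullet> D_conj_grad (s k \<omega>) + (Dn (e k \<omega> - eh k \<omega>))\<^sup>2 / 2"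
    using D_conj_smooth[of "s k \<omega>" "- (e k \<omega> - eh k \<omega>)"] dual_norm_minus[of "e k \<omega> - eh k \<omega>"]
    by (simp only: inner_minus_left)
  then show ?case using Suc.IH by simp
qed (simp add: s_def D_conj_0)

text \<open>Collects everything random in a bound free of the comparison point, so that it survives
  the supremum.\<close>

definition "total_noise k \<omega> = residual k \<omega> + (\<Sum>i<k. (e i \<omega> - eh i \<omega>) \<bullet> x i \<omega>) + D_conj (s k \<omega>)"

text \<open>One \<open>D u\<close> comes from dual averaging and one from Fenchel's inequality; this
  is the factor 2 in the bound for the supremum.\<close>

lemma gap_le_total_noise:
  assumes \<omega>: "\<omega> \<in> space M" and k: "1 \<le> k" "k \<le> K" and u: "u \<in> E"
  shows "A k * gap k u \<omega> \<le> 2 * D u + total_noise k \<omega>"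
proof -
  have "(\<Sum>i<k. (e i \<omega> - eh i \<omega>) \<bullet> (x i \<omega> - u)) = (\<Sum>i<k. (e i \<omega> - eh i \<omega>) \<bullet> x i \<omega>) + s k \<omega> \<bullet> u"
  proof -
    have "s k \<omega> \<bullet> u = - (\<Sum>i<k. (e i \<omega> - eh i \<omega>) \<bullet> u)"
      by (simp only: s_def inner_minus_left inner_sum_left)
    then show ?thesis by (simp only: inner_diff_right[of "e _ \<omega> - eh _ \<omega>"] sum_subtractf)
  qed
  moreover have "0 \<le> (A k * \<gamma> + 1) / 4 * (N (u - x k \<omega>))\<^sup>2" using A\<gamma>_pos[of k] by simp
  ultimately show ?thesis
    using gap_pathwise[OF \<omega> k u] fenchel[OF u, of "s k \<omega>"] unfolding total_noise_def by linarith
qed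

lemma integrable_total_noise:
  assumes "k \<le> K"
  shows "integrable M (total_noise k)"
proof -
  have "integrable M (\<lambda>\<omega>. (e i \<omega> - eh i \<omega>) \<bullet> x i \<omega>)" if "i < k" for i
    using expectation_noise(2)[of i "x i"] determined_x[of i i] that assms by simp
  moreover have "integrable M (\<lambda>\<omega>. D_conj (s k \<omega>))"
    by (rule integrable_Past[OF determined_comp[OF determined_s[OF assms]] assms])
  ultimately show ?thesis unfolding total_noise_def
    by (intro Bochner_Integration.integrable_add Bochner_Integration.integrable_sum integrable_residual assms) auto
qed

text \<open>The noise is paired with \<open>x i - D_conj_grad (s i)\<close>, fixed by the past, and
  averages out. One copy of the error sum stems from the residual; the squares of
  \<open>e i - eh i\<close> halved, at most the sum of both squares, give two more.\<close>

lemma expectation_total_noise: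
  assumes k: "k \<le> K" and \<gamma>: "\<gamma> = 0" and sup: "step_condition_sup L a"
  shows "expectation (total_noise k) \<le> 0"
proof -
  have w: "w i = (a i)\<^sup>2" for i unfolding w_def by (simp add: \<gamma>)
  have det: "determined Z (Past i) (\<lambda>\<omega>. x i \<omega> - D_conj_grad (s i \<omega>))" if "i < k" for i
    using that k determined_comp[OF determined_s, of i D_conj_grad]
    by (intro determined_comp2[where h = "\<lambda>y y'. y - y'"] determined_x) auto
  have noise: "integrable M (\<lambda>\<omega>. (e i \<omega> - eh i \<omega>) \<bullet> (x i \<omega> - D_conj_grad (s i \<omega>)))"
    "expectation (\<lambda>\<omega>. (e i \<omega> - eh i \<omega>) \<bullet> (x i \<omega> - D_conj_grad (s i \<omega>))) = 0" if "i < k" for i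
    using expectation_noise[of i] det[OF that] that k by auto
  have int: "integrable M (\<lambda>\<omega>. (Dn (e i \<omega>))\<^sup>2)" "integrable M (\<lambda>\<omega>. (Dn (eh i \<omega>))\<^sup>2)" if "i < k" for i
    using that k by auto
  have ints: "integrable M (\<lambda>\<omega>. \<Sum>i<k. (e i \<omega> - eh i \<omega>) \<bullet> (x i \<omega> - D_conj_grad (s i \<omega>)))"
    "integrable M (\<lambda>\<omega>. \<Sum>i<k. (Dn (e i \<omega>))\<^sup>2 + (Dn (eh i \<omega>))\<^sup>2)"
    by (rule Bochner_Integration.integrable_sum, simp add: noise(1),
        rule Bochner_Integration.integrable_sum, simp add: int)
  have sum_0: "expectation (\<lambda>\<omega>. \<Sum>i<k. (e i \<omega> - eh i \<omega>) \<bullet> (x i \<omega> - D_conj_grad (s i \<omega>))) = 0"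
    using noise by (subst Bochner_Integration.integral_sum) simp_all
  have sum_sq: "expectation (\<lambda>\<omega>. \<Sum>i<k. (Dn (e i \<omega>))\<^sup>2 + (Dn (eh i \<omega>))\<^sup>2)
      = (\<Sum>i<k. expectation (\<lambda>\<omega>. (Dn (e i \<omega>))\<^sup>2) + expectation (\<lambda>\<omega>. (Dn (eh i \<omega>))\<^sup>2))"
    using int by (subst Bochner_Integration.integral_sum) simp_all
  have "expectation (total_noise k) \<le> expectation (\<lambda>\<omega>. residual k \<omega>
      + (\<Sum>i<k. (e i \<omega> - eh i \<omega>) \<bullet> (x i \<omega> - D_conj_grad (s i \<omega>))) + (\<Sum>i<k. (Dn (e i \<omega>))\<^sup>2 + (Dn (eh i \<omega>))\<^sup>2))"
  proof (rule integral_mono[OF integrable_total_noise[OF k]])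
    fix \<omega>
    have "(\<Sum>i<k. (Dn (e i \<omega> - eh i \<omega>))\<^sup>2 / 2) \<le> (\<Sum>i<k. (Dn (e i \<omega>))\<^sup>2 + (Dn (eh i \<omega>))\<^sup>2)"
    proof (rule sum_mono)
      fix i
      show "(Dn (e i \<omega> - eh i \<omega>))\<^sup>2 / 2 \<le> (Dn (e i \<omega>))\<^sup>2 + (Dn (eh i \<omega>))\<^sup>2"
        using dual_norm_diff_squared[of "e i \<omega>" "eh i \<omega>"] by simp
    qed
    moreover have "(\<Sum>i<k. (e i \<omega> - eh i \<omega>) \<bullet> (x i \<omega> - D_conj_grad (s i \<omega>)))
        = (\<Sum>i<k. (e i \<omega> - eh i \<omega>) \<bullet> x i \<omega>) - (\<Sum>i<k. (e i \<omega> - eh i \<omega>) \<bullet> D_conj_grad (s i \<omega>))"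
      by (simp only: inner_diff_right[of "e _ \<omega> - eh _ \<omega>"] sum_subtractf)
    moreover have "D_conj (s k \<omega>) \<le> (\<Sum>i<k. (Dn (e i \<omega> - eh i \<omega>))\<^sup>2 / 2) - (\<Sum>i<k. (e i \<omega> - eh i \<omega>) \<bullet> D_conj_grad (s i \<omega>))"
      using D_conj_s_le[of k \<omega>] by (simp only: sum_subtractf)
    ultimately show "total_noise k \<omega> \<le> residual k \<omega> + (\<Sum>i<k. (e i \<omega> - eh i \<omega>) \<bullet> (x i \<omega> - D_conj_grad (s i \<omega>)))
        + (\<Sum>i<k. (Dn (e i \<omega>))\<^sup>2 + (Dn (eh i \<omega>))\<^sup>2)"
      unfolding total_noise_def by linarith
  qed (intro Bochner_Integration.integrable_add ints integrable_residual k)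
  also have "\<dots> = expectation (residual k)
      + (\<Sum>i<k. expectation (\<lambda>\<omega>. (Dn (e i \<omega>))\<^sup>2) + expectation (\<lambda>\<omega>. (Dn (eh i \<omega>))\<^sup>2))"
    by (simp only: Bochner_Integration.integral_add[OF Bochner_Integration.integrable_add[OF integrable_residual[OF k] ints(1)] ints(2)]
        Bochner_Integration.integral_add[OF integrable_residual[OF k] ints(1)] sum_0 sum_sq add_0_right)
  also have "\<dots> \<le> expectation (residual k) + (\<Sum>i<k. 2 * (w i * expectation (S i)))"
  proof (intro add_left_mono sum_mono)
    fix i assume "i \<in> {..<k}"
    then show "expectation (\<lambda>\<omega>. (Dn (e i \<omega>))\<^sup>2) + expectation (\<lambda>\<omega>. (Dn (eh i \<omega>))\<^sup>2) \<le> 2 * (w i * expectation (S i))"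
      using expectation_e_le[of i] expectation_eh[of i] k by (simp add: w)
  qed
  \<comment> \<open>The nonnegative term \<open>i = k\<close> is added so that the shifted sum
    applies.\<close>
  also have "(\<Sum>i<k. 2 * (w i * expectation (S i))) \<le> 2 * (\<Sum>i\<le>k. w i * expectation (S i))"
    unfolding sum_distrib_left
    by (rule sum_mono2) (auto simp: w_nonneg expectation_S_nonneg)
  also have "\<dots> = 2 * (\<Sum>i<k. w (Suc i) * expectation (S (Suc i)))" by (simp only: sum_w_S_shift)
  finally have "expectation (total_noise k) \<le> 3 * (\<Sum>i<k. w (Suc i) * expectation (S (Suc i)))
      - (\<Sum>i<k. (A i * \<gamma> + 1) / 4 * expectation (\<lambda>\<omega>. (N (x (Suc i) \<omega> - x i \<omega>))\<^sup>2))"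
    using expectation_residual_le[OF k] by linarith
  also have "\<dots> \<le> 0"
  proof -
    \<comment> \<open>The condition for the supremum allows \<open>75 / 2\<close> where 30 is
      required.\<close>
    have "3 * (10 * L\<^sup>2 * w (Suc n)) \<le> (A n * \<gamma> + 1) / 4" for n
    proof -
      have "75 * (L\<^sup>2 * (a (Suc n))\<^sup>2) / 2 - 1 / 4 \<le> 0"
        using sup by (simp add: step_condition_sup_def mult.assoc)
      moreover have "0 \<le> L\<^sup>2 * (a (Suc n))\<^sup>2" by simp
      moreover have "3 * (10 * L\<^sup>2 * w (Suc n)) = 30 * (L\<^sup>2 * (a (Suc n))\<^sup>2)" unfolding w by simp
      moreover have "(A n * \<gamma> + 1) / 4 = 1 / 4" by (simp add: \<gamma>)
      ultimately show ?thesis by linarith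
    qed
    then show ?thesis using sum_S_absorbed[OF k, of 3] by simp
  qed
  finally show ?thesis .
qed

text \<open>The supremum is dominated pointwise by an integrable function, and monotonicity of the
  nonnegative integral asks for no measurability of the supremum. An infinite right-hand side is a
  separate trivial case.\<close>

lemma expected_sup_gap:
  assumes k: "1 \<le> k" "k \<le> K" and \<gamma>: "\<gamma> = 0" and sup: "step_condition_sup L a"
  shows "(\<integral>\<^sup>+ \<omega>. e2ennreal (SUP y\<in>E. Gap F g (averaged a (\<lambda>i. x i \<omega>) k) y) \<partial>M)
    \<le> e2ennreal (2 * (SUP y\<in>E. ereal (D y)) / ereal (A k))"
proof -
  have Ak: "0 < A k" by (rule stepsum_mono_pos(2)[OF pos k(1)])
  have D0: "0 \<le> (SUP y\<in>E. ereal (D y))"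
    using SUP_upper[OF x0, of "\<lambda>y. ereal (D y)"] by (simp only: D_x0 zero_ereal_def)
  show ?thesis
  proof (cases "SUP y\<in>E. ereal (D y)")
    case (real d)
    have D_le: "D y \<le> d" if "y \<in> E" for y
      using SUP_upper[OF that, of "\<lambda>y. ereal (D y)"] by (simp add: real)
    have le: "A k * gap k y \<omega> \<le> 2 * d + total_noise k \<omega>" if "\<omega> \<in> space M" "y \<in> E" for \<omega> y
      using gap_le_total_noise[OF that(1) k that(2)] D_le[OF that(2)] by simp
    \<comment> \<open>The averaged point itself is a competitor with gap 0; nonnegativity lets the
      integral pass to an ordinary expectation.\<close>
    have nonneg: "0 \<le> 2 * d + total_noise k \<omega>" if \<omega>: "\<omega> \<in> space M" for \<omega>
    proof -
      have xb: "averaged a (\<lambda>i. x i \<omega>) k \<in> E" by (rule averaged_in_E[OF \<omega> k])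
      then have "gap k (averaged a (\<lambda>i. x i \<omega>) k) \<omega> = 0" by (simp add: gap_def Gap_eq)
      then show ?thesis using le[OF \<omega> xb] by simp
    qed
    have int: "integrable M (\<lambda>\<omega>. (2 * d + total_noise k \<omega>) / A k)"
      using integrable_total_noise[OF k(2)] by simp
    have "(\<integral>\<^sup>+ \<omega>. e2ennreal (SUP y\<in>E. Gap F g (averaged a (\<lambda>i. x i \<omega>) k) y) \<partial>M)
        \<le> (\<integral>\<^sup>+ \<omega>. ennreal ((2 * d + total_noise k \<omega>) / A k) \<partial>M)"
    proof (rule nn_integral_mono)
      fix \<omega> assume \<omega>: "\<omega> \<in> space M"
      have "(SUP y\<in>E. Gap F g (averaged a (\<lambda>i. x i \<omega>) k) y) \<le> ereal ((2 * d + total_noise k \<omega>) / A k)"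
        using le[OF \<omega>] Ak by (intro SUP_least) (simp add: gap_eq[OF \<omega> k] pos_le_divide_eq mult.commute)
      from e2ennreal_mono[OF this] show "e2ennreal (SUP y\<in>E. Gap F g (averaged a (\<lambda>i. x i \<omega>) k) y) \<le> ennreal ((2 * d + total_noise k \<omega>) / A k)"
        by (simp only: e2ennreal_ereal)
    qed
    also have "\<dots> = ennreal (expectation (\<lambda>\<omega>. (2 * d + total_noise k \<omega>) / A k))"
      using nonneg Ak by (intro nn_integral_eq_integral[OF int]) auto
    also have "\<dots> \<le> ennreal (2 * d / A k)"
    proof (rule ennreal_leI)
      have "expectation (\<lambda>\<omega>. (2 * d + total_noise k \<omega>) / A k) = (2 * d + expectation (total_noise k)) / A k"
        using integrable_total_noise[OF k(2)] by (simp add: prob_space)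
      also have "\<dots> \<le> 2 * d / A k"
        using expectation_total_noise[OF k(2) \<gamma> sup] Ak by (intro divide_right_mono) auto
      finally show "expectation (\<lambda>\<omega>. (2 * d + total_noise k \<omega>) / A k) \<le> 2 * d / A k" .
    qed
    also have "ennreal (2 * d / A k) = e2ennreal (2 * (SUP y\<in>E. ereal (D y)) / ereal (A k))"
    proof -
      have "2 * ereal d = ereal (2 * d)" by (simp add: numeral_eq_ereal)
      then show ?thesis using Ak by (simp add: real)
    qed
    finally show ?thesis .
  next
    case PInf
    have "2 * (\<infinity> :: ereal) / ereal (A k) = \<infinity>" using Ak by simp
    then show ?thesis unfolding PInf by simp
  qed (use D0 in auto)
qed

end

theorem theorem1:
  fixes N :: "real ^ 'd \<Rightarrow> real"
    and F :: "real ^ 'd \<Rightarrow> real ^ 'd"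
    and Fs :: "'m::finite \<Rightarrow> real ^ 'd \<Rightarrow> real ^ 'd"
    and g :: "real ^ 'd \<Rightarrow> ereal"
    and \<psi> :: "real ^ 'd \<Rightarrow> real"
    and \<gamma> :: real
    and p q :: "'m \<Rightarrow> real"
    and jstar :: 'm
    and x0 :: "real ^ 'd"
  assumes "is_norm N"
    and "monotone_operator F" and "lipschitz_operator N F"
    and "0 \<le> \<gamma>"
    and "proper g" and "lower_semicontinuous g" and "strongly_convex_ext N \<gamma> g"
    and "0 < \<gamma> \<or> compact (edom g)"
    and "\<forall>x\<in>edom g. F x = (\<Sum>j\<in>UNIV. Fs j x)"
    and "x0 \<in> edom g"
    and "strongly_convex_on (edom g) N 1 \<psi>" and "\<psi> differentiable (at x0)"
    and "pos_simplex p" and "pos_simplex q"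
    and "is_arg_min q (\<lambda>_. True) jstar"
    and "0 < Lsq N Fs g p q" and "Lsq N Fs g p q < \<infinity>"
  shows
    "(\<forall>(a :: nat \<Rightarrow> real) (K :: nat) (M :: 'w measure) (J :: nat \<Rightarrow> 'w \<Rightarrow> 'm) (J' :: nat \<Rightarrow> 'w \<Rightarrow> 'm)
        (x :: nat \<Rightarrow> 'w \<Rightarrow> real ^ 'd).
        positive_steps a \<longrightarrow>
        step_conditions (Lpq N Fs g p q) \<gamma> (q jstar) a \<longrightarrow>
        REM_sampling M K p q J J' \<longrightarrow>
        (\<forall>\<omega>\<in>space M. REM_run Fs g \<psi> p a x0 K (\<lambda>k. J k \<omega>) (\<lambda>k. J' k \<omega>) (\<lambda>k. x k \<omega>)) \<longrightarrow>
        (\<forall>k\<in>{1..K}.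
           (\<forall>\<omega>\<in>space M. averaged a (\<lambda>i. x i \<omega>) k \<in> edom g) \<and>
           (\<forall>y\<in>edom g.
              integrable M (\<lambda>\<omega>. real_of_ereal (Gap F g (averaged a (\<lambda>i. x i \<omega>) k) y)) \<and>
              integrable M (\<lambda>\<omega>. (N (y - x k \<omega>))\<^sup>2) \<and>
              (LINT \<omega>|M. real_of_ereal (Gap F g (averaged a (\<lambda>i. x i \<omega>) k) y))
                \<le> (bregman \<psi> y x0
                     - (stepsum a k * \<gamma> + 1) / 4 * (LINT \<omega>|M. (N (y - x k \<omega>))\<^sup>2)) / stepsum a k) \<and>
           (\<forall>xs. vi_solution F g xs \<longrightarrow>
              (LINT \<omega>|M. (N (xs - x k \<omega>))\<^sup>2) \<le> 4 * bregman \<psi> xs x0 / (stepsum a k * \<gamma> + 1)) \<and>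
           (\<gamma> = 0 \<longrightarrow> step_condition_sup (Lpq N Fs g p q) a \<longrightarrow>
              (\<integral>\<^sup>+ \<omega>. e2ennreal (SUP y\<in>edom g. Gap F g (averaged a (\<lambda>i. x i \<omega>) k) y) \<partial>M)
                \<le> e2ennreal (2 * (SUP y\<in>edom g. ereal (bregman \<psi> y x0)) / ereal (stepsum a k)))))
     \<and>
     (\<gamma> = 0 \<longrightarrow>
        (\<exists>a. admissible_steps (Lpq N Fs g p q) \<gamma> (q jstar) a \<and>
             a 1 = A1_choice (Lpq N Fs g p q) \<and>
             (\<forall>k\<ge>1. stepsum a k = A_choice (Lpq N Fs g p q) \<gamma> (q jstar) k)))
     \<and>
     (\<forall>k\<ge>1. \<exists>a. admissible_steps (Lpq N Fs g p q) \<gamma> (q jstar) a \<and>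
             a 1 = A1_choice (Lpq N Fs g p q) \<and>
             stepsum a k = A_choice (Lpq N Fs g p q) \<gamma> (q jstar) k)
     \<and>
     (\<exists>a. admissible_steps (Lpq N Fs g p q) \<gamma> (q jstar) a \<and>
             a 1 = A1_choice (Lpq N Fs g p q) \<and>
             (\<forall>k\<ge>1. A_choice (Lpq N Fs g p q) \<gamma> (q jstar) k \<le> stepsum a k))"
proof -
  interpret composite_vi N F Fs g \<psi> \<gamma> p q x0
    using assms by unfold_locales blast+
  interpret step_choice "Lpq N Fs g p q" \<gamma> "q jstar"
    using L_pos \<gamma>_nonneg q_pos q_le_1 by unfold_locales
  have q_min: "q jstar \<le> q l" for l
    using assms(15) by (auto simp: is_arg_min_def not_less)
  have "(\<forall>\<omega>\<in>space M. averaged a (\<lambda>i. x i \<omega>) k \<in> edom g) \<and>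
      (\<forall>y\<in>edom g.
        integrable M (\<lambda>\<omega>. real_of_ereal (Gap F g (averaged a (\<lambda>i. x i \<omega>) k) y)) \<and>
        integrable M (\<lambda>\<omega>. (N (y - x k \<omega>))\<^sup>2) \<and>
        (LINT \<omega>|M. real_of_ereal (Gap F g (averaged a (\<lambda>i. x i \<omega>) k) y))
          \<le> (bregman \<psi> y x0 - (stepsum a k * \<gamma> + 1) / 4 * (LINT \<omega>|M. (N (y - x k \<omega>))\<^sup>2)) / stepsum a k) \<and>
      (\<forall>xs. vi_solution F g xs \<longrightarrow>
        (LINT \<omega>|M. (N (xs - x k \<omega>))\<^sup>2) \<le> 4 * bregman \<psi> xs x0 / (stepsum a k * \<gamma> + 1)) \<and>
      (\<gamma> = 0 \<longrightarrow> step_condition_sup (Lpq N Fs g p q) a \<longrightarrow>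
        (\<integral>\<^sup>+ \<omega>. e2ennreal (SUP y\<in>edom g. Gap F g (averaged a (\<lambda>i. x i \<omega>) k) y) \<partial>M)
          \<le> e2ennreal (2 * (SUP y\<in>edom g. ereal (bregman \<psi> y x0)) / ereal (stepsum a k)))"
    if a: "positive_steps a" "step_conditions (Lpq N Fs g p q) \<gamma> (q jstar) a"
      and sampling: "REM_sampling M K p q J J'"
      and run: "\<forall>\<omega>\<in>space M. REM_run Fs g \<psi> p a x0 K (\<lambda>k. J k \<omega>) (\<lambda>k. J' k \<omega>) (\<lambda>k. x k \<omega>)"
      and k: "k \<in> {1..K}"
    for a :: "nat \<Rightarrow> real" and K k :: nat and M :: "'w measure" and J J' :: "nat \<Rightarrow> 'w \<Rightarrow> 'm"
      and x :: "nat \<Rightarrow> 'w \<Rightarrow> real ^ 'd"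
  proof -
    \<comment> \<open>A run exists for each outcome separately; choosing the hidden sequences as
      functions of the outcome turns them into parameters of the locale.\<close>
    from run[unfolded REM_run_def, THEN bchoice] obtain Ft where
      "\<forall>\<omega>\<in>space M. \<exists>Fh z. x 0 \<omega> = x0 \<and> z 0 = 0 \<and> (\<forall>i. Ft \<omega> 0 i = Fs i x0) \<and>
      (\<forall>k\<in>{1..K}.
         Fh k = (\<Sum>i\<in>UNIV. Ft \<omega> (k - 1) i)
                + (a (k - 1) / (a k * p (J k \<omega>))) *\<^sub>R (Fs (J k \<omega>) (x (k - 1) \<omega>) - Ft \<omega> (k - 2) (J k \<omega>)) \<and>
         z k = z (k - 1) + a k *\<^sub>R Fh k \<and>
         is_arg_min (\<lambda>u. ereal (z k \<bullet> u) + ereal (stepsum a k) * g u + ereal (bregman \<psi> u x0))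
                    (\<lambda>_. True) (x k \<omega>) \<and>
         (\<forall>i. Ft \<omega> k i = (if i = J' k \<omega> then Fs i (x k \<omega>) else Ft \<omega> (k - 1) i)))" ..
    from this[THEN bchoice] obtain Fh where
      "\<forall>\<omega>\<in>space M. \<exists>z. x 0 \<omega> = x0 \<and> z 0 = 0 \<and> (\<forall>i. Ft \<omega> 0 i = Fs i x0) \<and>
      (\<forall>k\<in>{1..K}.
         Fh \<omega> k = (\<Sum>i\<in>UNIV. Ft \<omega> (k - 1) i)
                + (a (k - 1) / (a k * p (J k \<omega>))) *\<^sub>R (Fs (J k \<omega>) (x (k - 1) \<omega>) - Ft \<omega> (k - 2) (J k \<omega>)) \<and>
         z k = z (k - 1) + a k *\<^sub>R Fh \<omega> k \<and>
         is_arg_min (\<lambda>u. ereal (z k \<bullet> u) + ereal (stepsum a k) * g u + ereal (bregman \<psi> u x0))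
                    (\<lambda>_. True) (x k \<omega>) \<and>
         (\<forall>i. Ft \<omega> k i = (if i = J' k \<omega> then Fs i (x k \<omega>) else Ft \<omega> (k - 1) i)))" ..
    from this[THEN bchoice] obtain z where run':
      "\<forall>\<omega>\<in>space M. x 0 \<omega> = x0 \<and> z \<omega> 0 = 0 \<and> (\<forall>i. Ft \<omega> 0 i = Fs i x0) \<and>
      (\<forall>k\<in>{1..K}.
         Fh \<omega> k = (\<Sum>i\<in>UNIV. Ft \<omega> (k - 1) i)
                + (a (k - 1) / (a k * p (J k \<omega>))) *\<^sub>R (Fs (J k \<omega>) (x (k - 1) \<omega>) - Ft \<omega> (k - 2) (J k \<omega>)) \<and>
         z \<omega> k = z \<omega> (k - 1) + a k *\<^sub>R Fh \<omega> k \<and>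
         is_arg_min (\<lambda>u. ereal (z \<omega> k \<bullet> u) + ereal (stepsum a k) * g u + ereal (bregman \<psi> u x0))
                    (\<lambda>_. True) (x k \<omega>) \<and>
         (\<forall>i. Ft \<omega> k i = (if i = J' k \<omega> then Fs i (x k \<omega>) else Ft \<omega> (k - 1) i)))" ..
    have init: "x 0 \<omega> = x0" "z \<omega> 0 = 0" "Ft \<omega> 0 l = Fs l x0" if "\<omega> \<in> space M" for \<omega> l
      using bspec[OF run' that] by auto
    have step: "Fh \<omega> (Suc n) = (\<Sum>l\<in>UNIV. Ft \<omega> n l)
          + (a n / (a (Suc n) * p (J (Suc n) \<omega>))) *\<^sub>R (Fs (J (Suc n) \<omega>) (x n \<omega>) - Ft \<omega> (n - 1) (J (Suc n) \<omega>))"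
      "z \<omega> (Suc n) = z \<omega> n + a (Suc n) *\<^sub>R Fh \<omega> (Suc n)"
      "is_arg_min (\<lambda>u. ereal (z \<omega> (Suc n) \<bullet> u) + ereal (stepsum a (Suc n)) * g u + ereal (bregman \<psi> u x0))
          (\<lambda>_. True) (x (Suc n) \<omega>)"
      "Ft \<omega> (Suc n) l = (if l = J' (Suc n) \<omega> then Fs l (x (Suc n) \<omega>) else Ft \<omega> n l)"
      if "\<omega> \<in> space M" "n < K" for \<omega> n l
    proof -
      have "Suc n \<in> {1..K}" using that(2) by simp
      note * = bspec[OF bspec[OF run' that(1), THEN conjunct2, THEN conjunct2, THEN conjunct2] this]
      show "Fh \<omega> (Suc n) = (\<Sum>l\<in>UNIV. Ft \<omega> n l)
          + (a n / (a (Suc n) * p (J (Suc n) \<omega>))) *\<^sub>R (Fs (J (Suc n) \<omega>) (x n \<omega>) - Ft \<omega> (n - 1) (J (Suc n) \<omega>))"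
        \<comment> \<open>At \<open>k = Suc n\<close> the index \<open>k - 2\<close> is
          \<open>n - 1\<close>, also in the truncated case \<open>n = 0\<close>.\<close>
        using *[THEN conjunct1] by (simp add: numeral_2_eq_2)
      show "z \<omega> (Suc n) = z \<omega> n + a (Suc n) *\<^sub>R Fh \<omega> (Suc n)"
        using *[THEN conjunct2, THEN conjunct1] by simp
      show "is_arg_min (\<lambda>u. ereal (z \<omega> (Suc n) \<bullet> u) + ereal (stepsum a (Suc n)) * g u + ereal (bregman \<psi> u x0))
          (\<lambda>_. True) (x (Suc n) \<omega>)"
        by (rule *[THEN conjunct2, THEN conjunct2, THEN conjunct1])
      show "Ft \<omega> (Suc n) l = (if l = J' (Suc n) \<omega> then Fs l (x (Suc n) \<omega>) else Ft \<omega> n l)"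
        using *[THEN conjunct2, THEN conjunct2, THEN conjunct2] by simp
    qed
    interpret prob_space M using sampling by (simp add: REM_sampling_def)
    interpret rem_process N F Fs g \<psi> \<gamma> p q x0 M a "q jstar" K J J' x
      "\<lambda>n \<omega>. Ft \<omega> n" "\<lambda>n \<omega>. Fh \<omega> n" "\<lambda>n \<omega>. z \<omega> n"
      by unfold_locales
        (use a q_min sampling init step in \<open>auto simp: REM_sampling_def simp del: stepsum_Suc\<close>)
    have k': "1 \<le> k" "k \<le> K" using k by auto
    show ?thesis
      using averaged_in_E[OF _ k'] integrable_gap[OF k', unfolded gap_def] integrable_dist[OF k'(2)]
        expected_gap[OF k', unfolded gap_def] expected_distance_to_solution[OF k'] expected_sup_gap[OF k']
      by (intro conjI ballI allI impI) blast+
  qed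
  then show ?thesis
    using A_choice_attained_if_\<gamma>_eq_0 A_choice_attained A_choice_dominated by (intro conjI allI impI ballI) blast+
qed

end
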